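(* Let $\rho=\rho(\mathcal T,y,r,\phi)$ and $s=r/2$. For each double coset representative $g\in\mathcal K\backslash G/G_{y,s}\mathcal T$, the corresponding Mackey component $$\text{c-Ind}_{\mathcal K\cap(G_{y,s}\mathcal T)^g}^{\mathcal K}\rho^g$$ is an irreducible representation of $\mathcal K$.
   Context: All representations are smooth and complex. For $g\in G$, $H^g=gHg^{-1}$ and $\tau^g(x)=\tau(g^{-1}xg)$ for a representation $\tau$ of $H$. Group. $F$ is a non-archimedean local field of residual characteristic $p\neq 2$, with $\mathcal O_F$, $\mathfrak p_F$, uniformizer $\varpi$, valuation $\nu$ with $\nu(\varpi)=1$, residue field of cardinality $q$; $E=F[\sqrt\epsilon]$ is the unramified quadratic extension ($\epsilon\in\mathcal O_F^\times$ a non-square) with $\mathcal O_E,\mathfrak p_E$ and conjugation $x\mapsto\overline x$. $\psi'$ is an additive character of $F$ trivial on $\mathfrak p_F$, nontrivial on $\mathcal O_F$, and $\psi(x)=\psi'((x+\overline x)/2)$ on $E$. $G=\{g\in M_2(E):\overline g^{\top}\mathrm w g=\mathrm w\}$, $\mathrm w=\begin{pmatrix}0&1\\ 1&0\end{pmatrix}$; $Z$ is its center (scalars of norm one); $\mathfrak g=\left\{\begin{pmatrix}u+\sqrt\epsilon v&y\sqrt\epsilon\\ z\sqrt\epsilon&-u+\sqrt\epsilon v\end{pmatrix}:u,v,y,z\in F\right\}$; $\mathcal K=G\cap M_2(\mathcal O_E)$. For $y\in\mathbb R$, $r>0$: $G_{y,r}=\begin{pmatrix}1+\mathfrak p_E^{\lceil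 r\rceil}&\mathfrak p_E^{\lceil r-y\rceil}\\ \mathfrak p_E^{\lceil r+y\rceil}&1+\mathfrak p_E^{\lceil r\rceil}\end{pmatrix}\cap G$; $G_{y,r+}=\bigcup_{s>r}G_{y,s}$ ($r\ge0$). For $r\in\mathbb R$: $\mathfrak g_{y,r}=\begin{pmatrix}\mathfrak p_E^{\lceil r\rceil}&\sqrt\epsilon\mathfrak p_F^{\lceil r-y\rceil}\\ \sqrt\epsilon\mathfrak p_F^{\lceil r+y\rceil}&\mathfrak p_E^{\lceil r\rceil}\end{pmatrix}\cap\mathfrak g$. Tori. $\mathcal T=\mathcal T_{\gamma_1,\gamma_2}=\left\{\begin{pmatrix}a&b\gamma_1\\ b\gamma_2&a\end{pmatrix}\in G:a,b\in E\right\}$ with $(\gamma_1,\gamma_2)\in\{(1,1),(\varpi^{-1},\varpi),(1,\varpi),(1,\epsilon^{-1}\varpi)\}$; the associated point $y$ is $0,1,\tfrac12,\tfrac12$ respectively; the first two are unramified, the last two ramified. $\mathcal T_r=\mathcal T\cap G_{y,r}$ for $r>0$, $\mathcal T_{r+}=\mathcal T\cap G_{y,r+}$. $\mathfrak t=\left\{\Gamma_{u,v}=\begin{pmatrix}u\sqrt\epsilon&v\gamma_1\sqrt\epsilon\\ v\gamma_2\sqrt\epsilon&u\sqrt\epsilon\end{pmatrix}:u,v\in F\right\}$ and $\mathfrak t_r=\mathfrak t\cap\mathfrak g_{y,r}$. Generic characters and the datum. Let $r>0$, $s=r/2$. An element $\Gamma=\Gamma_{u,v}\in\mathfrak t_{-r}$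 is $G$-generic of depth $-r$ if $\nu(v\gamma_1)=-r-y$. It realizes a character $\phi$ of $\mathcal T$ if $\phi(t)=\psi(\mathrm{Tr}(\Gamma(t-I)))$ for all $t\in\mathcal T_{s+}$. A character $\phi$ of $\mathcal T$ is $G$-generic of depth $r$ if it is trivial on $\mathcal T_{r+}$, nontrivial on $\mathcal T_r$, and is realized by some $G$-generic $\Gamma\in\mathfrak t_{-r}$. Then $r\in\mathbb Z_{>0}$ if $\mathcal T$ is unramified and $r\in\tfrac12+\mathbb Z_{\ge0}$ if $\mathcal T$ is ramified. A datum $(\mathcal T,y,r,\phi)$ consists of a torus $\mathcal T$ above, its point $y$, $r>0$ and a $G$-generic character $\phi$ of $\mathcal T$ of depth $r$. The representation $\rho(\mathcal T,y,r,\phi)$ of $G_{y,s}\mathcal T$. Let $\Psi_\Gamma(g)=\psi(\mathrm{Tr}(\Gamma(g-I)))$ for $g\in G_{y,s+}$ and let $\hat\phi$ be the character of $G_{y,s+}\mathcal T$ with $\hat\phi(gt)=\Psi_\Gamma(g)\phi(t)$. If $G_{y,s}=G_{y,s+}$ ($\mathcal T$ ramified, or unramified with $r$ odd), $\rho=\hat\phi$. If $\mathcal T$ is unramified and $r$ is even, $V=G_{y,s}/G_{y,s+}\mathcal T_s$ is a 2-dimensional symplectic space over the residue field of $F$ (form induced by $\hat\phi$ of commutators), there is a unique irreducible representation $\eta_\phi$ of $G_{y,s}$ (dimension $q$) that is $\hat\phi$-isotypic on $G_{y,s+}\mathcal T_s$, and $\rho(gt)=\eta_\phi(g)\,\omega(t)\,\phi(t)$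 for $g\in G_{y,s},t\in\mathcal T$, where $\omega$ is the Weil representation associated with $\eta_\phi$, pulled back along the conjugation action $\mathcal T\to\mathrm{Sp}(V)$. In that case $\rho$ has dimension $q$, is $\hat\phi$-isotypic on $G_{y,s+}\mathcal T_s$ and $\phi$-isotypic on $Z\mathcal T_{0+}$. The representation $\text{c-Ind}_{G_{y,s}\mathcal T}^G\rho$ is irreducible supercuspidal of depth $r$ (known). *)

theory Defs
  imports
    "HOL-Analysis.Analysis"
    "HOL-Algebra.Coset"
    "HOL-Algebra.Bij"
    "HOL-Library.Function_Algebras"
begin

section \<open>The quadratic extension\<close>

text \<open>
  The field \<open>E\<close> is the type \<open>'e\<close>; the field \<open>F\<close> is the subset \<^term>\<open>ground S\<close> of it.  The map \<open>nu\<close> is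
  the valuation of \<open>E\<close> extending that of \<open>F\<close>; its value at 0 is irrelevant.  The element \<open>rteps\<close> is
  the square root of \<open>\<epsilon>\<close>, \<open>bar\<close> is the conjugation and \<open>addchar\<close> is the character \<open>\<psi>'\<close> of \<open>F\<close>.
\<close>

record 'e u11_data =
  ground :: "'e set"
  nu :: "'e \<Rightarrow> int"
  unif :: 'e
  rteps :: 'e
  bar :: "'e \<Rightarrow> 'e"
  addchar :: "'e \<Rightarrow> complex"

definition pE :: "'e::field u11_data \<Rightarrow> int \<Rightarrow> 'e set" where
  "pE S n = {x. x = 0 \<or> n \<le> nu S x}"

definition pF :: "'e::field u11_data \<Rightarrow> int \<Rightarrow> 'e set" where
  "pF S n = pE S n \<inter> ground S"

text \<open>The characteristic of the residue field of \<open>F\<close>:\<close>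

definition residue_char :: "'e::field u11_data \<Rightarrow> nat" where
  "residue_char S = (LEAST n. 0 < n \<and> of_nat n \<in> pF S 1)"

locale unitary_setting =
  fixes S :: "'e::field u11_data"
  assumes ground_subfield:
      "0 \<in> ground S" "1 \<in> ground S"
      "\<And>x y. x \<in> ground S \<Longrightarrow> y \<in> ground S \<Longrightarrow> x + y \<in> ground S"
      "\<And>x y. x \<in> ground S \<Longrightarrow> y \<in> ground S \<Longrightarrow> x * y \<in> ground S"
      "\<And>x. x \<in> ground S \<Longrightarrow> - x \<in> ground S"
      "\<And>x. x \<in> ground S \<Longrightarrow> inverse x \<in> ground S"
    and nu_mult: "\<And>x y. x \<noteq> 0 \<Longrightarrow> y \<noteq> 0 \<Longrightarrow> nu S (x * y) = nu S x + nu S y"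
    and nu_add: "\<And>x y. x \<noteq> 0 \<Longrightarrow> y \<noteq> 0 \<Longrightarrow> x + y \<noteq> 0 \<Longrightarrow> min (nu S x) (nu S y) \<le> nu S (x + y)"
    and unif: "unif S \<in> ground S" "unif S \<noteq> 0" "nu S (unif S) = 1"
    and complete: "\<And>X. (\<And>n. X n \<in> ground S) \<Longrightarrow>
          (\<And>N. \<exists>m. \<forall>i\<ge>m. \<forall>j\<ge>m. X i - X j \<in> pF S N) \<Longrightarrow>
          \<exists>l\<in>ground S. \<forall>N. \<exists>m::nat. \<forall>i\<ge>m. X i - l \<in> pF S N"
    and finite_residue_field:
      "finite (pF S 0 // {(x, y). x \<in> pF S 0 \<and> y \<in> pF S 0 \<and> x - y \<in> pF S 1})"
    and residue_char_odd: "residue_char S \<noteq> 2"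
    and eps_unit: "(rteps S)\<^sup>2 \<in> ground S" "rteps S \<noteq> 0" "nu S ((rteps S)\<^sup>2) = 0"
    and eps_nonsquare: "\<And>x. x \<in> ground S \<Longrightarrow> x\<^sup>2 \<noteq> (rteps S)\<^sup>2"
    and quadratic: "\<And>x. \<exists>a\<in>ground S. \<exists>b\<in>ground S. x = a + b * rteps S"
    and bar: "\<And>a b. a \<in> ground S \<Longrightarrow> b \<in> ground S \<Longrightarrow>
          bar S (a + b * rteps S) = a - b * rteps S"
    and addchar: "\<And>x y. x \<in> ground S \<Longrightarrow> y \<in> ground S \<Longrightarrow>
          addchar S (x + y) = addchar S x * addchar S y"
      "\<And>x. x \<in> ground S \<Longrightarrow> addchar S x \<noteq> 0"
      "\<And>x. x \<in> pF S 1 \<Longrightarrow> addchar S x = 1"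
      "\<exists>x\<in>pF S 0. addchar S x \<noteq> 1"

definition psi :: "'e::field u11_data \<Rightarrow> 'e \<Rightarrow> complex" where
  "psi S x = addchar S ((x + bar S x) / 2)"

section \<open>The unitary group and its filtrations\<close>

type_synonym 'e mat2 = "'e^2^2"

definition mat2 :: "'e::field \<Rightarrow> 'e \<Rightarrow> 'e \<Rightarrow> 'e \<Rightarrow> 'e mat2" where
  "mat2 a b c d = vector [vector [a, b], vector [c, d]]"

definition U :: "'e::field u11_data \<Rightarrow> 'e mat2 monoid" where
  "U S = \<lparr>carrier = {g. transpose (\<chi> i j. bar S (g $ i $ j)) ** mat2 0 1 1 0 ** g = mat2 0 1 1 0},
          mult = (**), one = mat 1\<rparr>"

definition Kmax :: "'e::field u11_data \<Rightarrow> 'e mat2 set" where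
  "Kmax S = {g \<in> carrier (U S). \<forall>i j. g $ i $ j \<in> pE S 0}"

definition mat_lattice :: "'e::field u11_data \<Rightarrow> real \<Rightarrow> real \<Rightarrow> 'e mat2 set" where
  "mat_lattice S y r = {X. X $ 1 $ 1 \<in> pE S \<lceil>r\<rceil> \<and> X $ 1 $ 2 \<in> pE S \<lceil>r - y\<rceil> \<and>
                           X $ 2 $ 1 \<in> pE S \<lceil>r + y\<rceil> \<and> X $ 2 $ 2 \<in> pE S \<lceil>r\<rceil>}"

definition mat_lattice_plus :: "'e::field u11_data \<Rightarrow> real \<Rightarrow> real \<Rightarrow> 'e mat2 set" where
  "mat_lattice_plus S y r = (\<Union>s\<in>{r<..}. mat_lattice S y s)"

text \<open>The following is only used for \<open>r > 0\<close>.\<close>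

definition Gfil :: "'e::field u11_data \<Rightarrow> real \<Rightarrow> real \<Rightarrow> 'e mat2 set" where
  "Gfil S y r = {g \<in> carrier (U S). g - mat 1 \<in> mat_lattice S y r}"

definition Gfil_plus :: "'e::field u11_data \<Rightarrow> real \<Rightarrow> real \<Rightarrow> 'e mat2 set" where
  "Gfil_plus S y r = (\<Union>s\<in>{r<..}. Gfil S y s)"

definition lie :: "'e::field u11_data \<Rightarrow> 'e mat2 set" where
  "lie S = {mat2 (u + rteps S * v) (y * rteps S) (z * rteps S) (- u + rteps S * v) | u v y z.
              u \<in> ground S \<and> v \<in> ground S \<and> y \<in> ground S \<and> z \<in> ground S}"

definition lie_fil :: "'e::field u11_data \<Rightarrow> real \<Rightarrow> real \<Rightarrow> 'e mat2 set" where
  "lie_fil S y r = {X \<in> lie S. X $ 1 $ 1 \<in> pE S \<lceil>r\<rceil> \<and> X $ 1 $ 2 \<in> (*) (rteps S) ` pF S \<lceil>r - y\<rceil> \<and>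
                      X $ 2 $ 1 \<in> (*) (rteps S) ` pF S \<lceil>r + y\<rceil> \<and> X $ 2 $ 2 \<in> pE S \<lceil>r\<rceil>}"

definition mat_top :: "'e::field u11_data \<Rightarrow> 'e mat2 topology" where
  "mat_top S = topology (\<lambda>A. \<forall>x\<in>A. \<exists>n. {z. \<forall>i j. z $ i $ j - x $ i $ j \<in> pE S n} \<subseteq> A)"

lemma istopology_mat_top:
  fixes S :: "'e::field u11_data"
  shows "istopology (\<lambda>A :: 'e mat2 set. \<forall>x\<in>A. \<exists>n. {z. \<forall>i j. z $ i $ j - x $ i $ j \<in> pE S n} \<subseteq> A)"
proof -
  have "\<exists>n. {z :: 'e mat2. \<forall>i j. z $ i $ j - x $ i $ j \<in> pE S n} \<subseteq> A \<inter> B"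
    if "\<exists>n. {z. \<forall>i j. z $ i $ j - x $ i $ j \<in> pE S n} \<subseteq> A"
       "\<exists>n. {z. \<forall>i j. z $ i $ j - x $ i $ j \<in> pE S n} \<subseteq> B" for x A B
  proof -
    from that obtain n m where
      n: "{z. \<forall>i j. z $ i $ j - x $ i $ j \<in> pE S n} \<subseteq> A" and
      m: "{z. \<forall>i j. z $ i $ j - x $ i $ j \<in> pE S m} \<subseteq> B" by blast
    have "pE S (max n m) \<subseteq> pE S n" "pE S (max n m) \<subseteq> pE S m"
      by (auto simp: pE_def)
    then have "{z. \<forall>i j. z $ i $ j - x $ i $ j \<in> pE S (max n m)} \<subseteq> A \<inter> B"
      using n m by blast
    then show ?thesis ..
  qed
  then show ?thesis
    unfolding istopology_def by (meson IntE Union_iff Union_upper subset_trans)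
qed

section \<open>Smooth representations and compact induction\<close>

text \<open>
  A representation space is a subspace \<open>W\<close> of a complex vector space, given by an abelian group type
  and a scalar multiplication; the operators of a representation only matter on \<open>W\<close>.
\<close>

definition lin_rep :: "(complex \<Rightarrow> 'v \<Rightarrow> 'v::ab_group_add) \<Rightarrow> ('g, 'b) monoid_scheme \<Rightarrow> 'v set \<Rightarrow>
    ('g \<Rightarrow> 'v \<Rightarrow> 'v) \<Rightarrow> bool" where
  "lin_rep sc H W \<pi> \<longleftrightarrow> vector_space sc \<and> module.subspace sc W \<and>
     (\<forall>h\<in>carrier H. \<forall>v\<in>W. \<pi> h v \<in> W) \<and>
     (\<forall>h\<in>carrier H. \<forall>v\<in>W. \<forall>w\<in>W. \<pi> h (v + w) = \<pi> h v + \<pi> h w) \<and>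
     (\<forall>h\<in>carrier H. \<forall>c. \<forall>v\<in>W. \<pi> h (sc c v) = sc c (\<pi> h v)) \<and>
     (\<forall>v\<in>W. \<pi> \<one>\<^bsub>H\<^esub> v = v) \<and>
     (\<forall>g\<in>carrier H. \<forall>h\<in>carrier H. \<forall>v\<in>W. \<pi> (g \<otimes>\<^bsub>H\<^esub> h) v = \<pi> g (\<pi> h v))"

definition smooth_rep :: "'e::field u11_data \<Rightarrow> (complex \<Rightarrow> 'v \<Rightarrow> 'v::ab_group_add) \<Rightarrow> 'e mat2 set \<Rightarrow>
    'v set \<Rightarrow> ('e mat2 \<Rightarrow> 'v \<Rightarrow> 'v) \<Rightarrow> bool" where
  "smooth_rep S sc H W \<pi> \<longleftrightarrow> lin_rep sc ((U S)\<lparr>carrier := H\<rparr>) W \<pi> \<and>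
     (\<forall>v\<in>W. openin (subtopology (mat_top S) H) {h \<in> H. \<pi> h v = v})"

definition irreducible_rep :: "'e::field u11_data \<Rightarrow> (complex \<Rightarrow> 'v \<Rightarrow> 'v::ab_group_add) \<Rightarrow>
    'e mat2 set \<Rightarrow> 'v set \<Rightarrow> ('e mat2 \<Rightarrow> 'v \<Rightarrow> 'v) \<Rightarrow> bool" where
  "irreducible_rep S sc H W \<pi> \<longleftrightarrow> smooth_rep S sc H W \<pi> \<and> W \<noteq> {0} \<and>
     (\<forall>W'. module.subspace sc W' \<and> W' \<subseteq> W \<and> (\<forall>h\<in>H. \<forall>v\<in>W'. \<pi> h v \<in> W') \<longrightarrow>
           W' = {0} \<or> W' = W)"

definition smooth_char :: "'e::field u11_data \<Rightarrow> 'e mat2 set \<Rightarrow> ('e mat2 \<Rightarrow> complex) \<Rightarrow> bool" where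
  "smooth_char S H \<theta> \<longleftrightarrow> (\<forall>h\<in>H. \<theta> h \<noteq> 0) \<and> (\<forall>g\<in>H. \<forall>h\<in>H. \<theta> (g ** h) = \<theta> g * \<theta> h) \<and>
     openin (subtopology (mat_top S) H) {h \<in> H. \<theta> h = 1}"

definition conj_set :: "'e::field u11_data \<Rightarrow> 'e mat2 \<Rightarrow> 'e mat2 set \<Rightarrow> 'e mat2 set" where
  "conj_set S g H = (\<lambda>h. g ** h ** inv\<^bsub>U S\<^esub> g) ` H"

definition conj_rep :: "'e::field u11_data \<Rightarrow> 'e mat2 \<Rightarrow> ('e mat2 \<Rightarrow> 'v) \<Rightarrow> 'e mat2 \<Rightarrow> 'v" where
  "conj_rep S g \<pi> x = \<pi> (inv\<^bsub>U S\<^esub> g ** x ** g)"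

text \<open>
  The space of the compact induction of \<open>(\<sigma>, W)\<close> from \<open>H\<close> to \<open>K\<close>, with elements extended by 0 outside
  \<open>K\<close>; the group \<open>K\<close> acts by right translation.
\<close>

definition cInd_space :: "'e::field u11_data \<Rightarrow> 'e mat2 set \<Rightarrow> 'e mat2 set \<Rightarrow> 'v::ab_group_add set \<Rightarrow>
    ('e mat2 \<Rightarrow> 'v \<Rightarrow> 'v) \<Rightarrow> ('e mat2 \<Rightarrow> 'v) set" where
  "cInd_space S K H W \<sigma> = {f.
     (\<forall>x. x \<notin> K \<longrightarrow> f x = 0) \<and> (\<forall>x\<in>K. f x \<in> W) \<and>
     (\<forall>h\<in>H. \<forall>x\<in>K. f (h ** x) = \<sigma> h (f x)) \<and>
     openin (subtopology (mat_top S) K) {k \<in> K. \<forall>x\<in>K. f (x ** k) = f x} \<and>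
     (\<exists>C\<subseteq>K. compactin (mat_top S) C \<and> {x. f x \<noteq> 0} \<subseteq> H <#>\<^bsub>U S\<^esub> C)}"

definition right_transl :: "'e::field mat2 \<Rightarrow> ('e mat2 \<Rightarrow> 'v) \<Rightarrow> 'e mat2 \<Rightarrow> 'v" where
  "right_transl k f = (\<lambda>x. f (x ** k))"

definition fun_scale :: "(complex \<Rightarrow> 'v \<Rightarrow> 'v) \<Rightarrow> complex \<Rightarrow> ('x \<Rightarrow> 'v) \<Rightarrow> 'x \<Rightarrow> 'v" where
  "fun_scale sc c f = (\<lambda>x. sc c (f x))"

section \<open>Tori and generic characters\<close>

definition torus_params :: "'e::field u11_data \<Rightarrow> ('e \<times> 'e \<times> real) set" where
  "torus_params S = {(1, 1, 0), (inverse (unif S), unif S, 1), (1, unif S, 1/2),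
                     (1, inverse ((rteps S)\<^sup>2) * unif S, 1/2)}"

definition torus :: "'e::field u11_data \<Rightarrow> 'e \<Rightarrow> 'e \<Rightarrow> 'e mat2 set" where
  "torus S \<gamma>1 \<gamma>2 = {mat2 a (b * \<gamma>1) (b * \<gamma>2) a | a b. True} \<inter> carrier (U S)"

definition Gam :: "'e::field u11_data \<Rightarrow> 'e \<Rightarrow> 'e \<Rightarrow> 'e \<Rightarrow> 'e \<Rightarrow> 'e mat2" where
  "Gam S \<gamma>1 \<gamma>2 u v = mat2 (u * rteps S) (v * \<gamma>1 * rteps S) (v * \<gamma>2 * rteps S) (u * rteps S)"

definition generic_elt :: "'e::field u11_data \<Rightarrow> 'e \<Rightarrow> 'e \<Rightarrow> real \<Rightarrow> real \<Rightarrow> 'e mat2 \<Rightarrow> bool" where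
  "generic_elt S \<gamma>1 \<gamma>2 y r \<Gamma> \<longleftrightarrow> (\<exists>u\<in>ground S. \<exists>v\<in>ground S.
     \<Gamma> = Gam S \<gamma>1 \<gamma>2 u v \<and> \<Gamma> \<in> lie_fil S y (- r) \<and>
     v \<noteq> 0 \<and> real_of_int (nu S (v * \<gamma>1)) = - r - y)"

definition Psi :: "'e::field u11_data \<Rightarrow> 'e mat2 \<Rightarrow> 'e mat2 \<Rightarrow> complex" where
  "Psi S \<Gamma> g = psi S (trace (\<Gamma> ** (g - mat 1)))"

definition realizes :: "'e::field u11_data \<Rightarrow> 'e \<Rightarrow> 'e \<Rightarrow> real \<Rightarrow> real \<Rightarrow> 'e mat2 \<Rightarrow>
    ('e mat2 \<Rightarrow> complex) \<Rightarrow> bool" where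
  "realizes S \<gamma>1 \<gamma>2 y r \<Gamma> \<phi> \<longleftrightarrow> (\<forall>t \<in> torus S \<gamma>1 \<gamma>2 \<inter> Gfil_plus S y (r/2). \<phi> t = Psi S \<Gamma> t)"

definition generic_char :: "'e::field u11_data \<Rightarrow> 'e \<Rightarrow> 'e \<Rightarrow> real \<Rightarrow> real \<Rightarrow>
    ('e mat2 \<Rightarrow> complex) \<Rightarrow> bool" where
  "generic_char S \<gamma>1 \<gamma>2 y r \<phi> \<longleftrightarrow> smooth_char S (torus S \<gamma>1 \<gamma>2) \<phi> \<and>
     (\<forall>t \<in> torus S \<gamma>1 \<gamma>2 \<inter> Gfil_plus S y r. \<phi> t = 1) \<and>
     (\<exists>t \<in> torus S \<gamma>1 \<gamma>2 \<inter> Gfil S y r. \<phi> t \<noteq> 1) \<and>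
     (\<exists>\<Gamma>. generic_elt S \<gamma>1 \<gamma>2 y r \<Gamma> \<and> realizes S \<gamma>1 \<gamma>2 y r \<Gamma> \<phi>)"

definition datum :: "'e::field u11_data \<Rightarrow> 'e \<Rightarrow> 'e \<Rightarrow> real \<Rightarrow> real \<Rightarrow> ('e mat2 \<Rightarrow> complex) \<Rightarrow> bool" where
  "datum S \<gamma>1 \<gamma>2 y r \<phi> \<longleftrightarrow> (\<gamma>1, \<gamma>2, y) \<in> torus_params S \<and> 0 < r \<and> generic_char S \<gamma>1 \<gamma>2 y r \<phi>"

section \<open>The inducing representation\<close>

text \<open>Only the values of \<open>\<theta>\<close> on \<open>G\<^sub>y\<^sub>,\<^sub>s\<^sub>+ T\<close>, where \<open>s = r/2\<close>, are prescribed:\<close>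

definition is_phi_hat :: "'e::field u11_data \<Rightarrow> 'e \<Rightarrow> 'e \<Rightarrow> real \<Rightarrow> real \<Rightarrow> 'e mat2 \<Rightarrow>
    ('e mat2 \<Rightarrow> complex) \<Rightarrow> ('e mat2 \<Rightarrow> complex) \<Rightarrow> bool" where
  "is_phi_hat S \<gamma>1 \<gamma>2 y r \<Gamma> \<phi> \<theta> \<longleftrightarrow>
     (\<forall>g \<in> Gfil_plus S y (r/2). \<forall>t \<in> torus S \<gamma>1 \<gamma>2. \<theta> (g ** t) = Psi S \<Gamma> g * \<phi> t)"

text \<open>The group \<open>J\<^sub>+ = G\<^sub>y\<^sub>,\<^sub>s\<^sub>+ T\<^sub>s\<close>, the quotient \<open>V = G\<^sub>y\<^sub>,\<^sub>s / J\<^sub>+\<close> and the class in \<open>V\<close> of an element:\<close>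

definition Jplus :: "'e::field u11_data \<Rightarrow> 'e \<Rightarrow> 'e \<Rightarrow> real \<Rightarrow> real \<Rightarrow> 'e mat2 set" where
  "Jplus S \<gamma>1 \<gamma>2 y s = Gfil_plus S y s <#>\<^bsub>U S\<^esub> (torus S \<gamma>1 \<gamma>2 \<inter> Gfil S y s)"

definition Vgrp :: "'e::field u11_data \<Rightarrow> 'e \<Rightarrow> 'e \<Rightarrow> real \<Rightarrow> real \<Rightarrow> 'e mat2 set monoid" where
  "Vgrp S \<gamma>1 \<gamma>2 y s = (U S)\<lparr>carrier := Gfil S y s\<rparr> Mod Jplus S \<gamma>1 \<gamma>2 y s"

definition cls :: "'e::field u11_data \<Rightarrow> 'e \<Rightarrow> 'e \<Rightarrow> real \<Rightarrow> real \<Rightarrow> 'e mat2 \<Rightarrow> 'e mat2 set" where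
  "cls S \<gamma>1 \<gamma>2 y s g = Jplus S \<gamma>1 \<gamma>2 y s #>\<^bsub>U S\<^esub> g"

text \<open>
  Scalar multiplication by (the residue class of) \<open>a \<in> \<O>\<^sub>F\<close> on \<open>V\<close>: the map \<open>g \<mapsto> g - 1\<close> identifies
  \<open>G\<^sub>y\<^sub>,\<^sub>s / G\<^sub>y\<^sub>,\<^sub>s\<^sub>+\<close> with the vector space \<open>\<g>\<^sub>y\<^sub>,\<^sub>s / \<g>\<^sub>y\<^sub>,\<^sub>s\<^sub>+\<close> over the residue field.
\<close>

definition Vscale :: "'e::field u11_data \<Rightarrow> 'e \<Rightarrow> 'e \<Rightarrow> real \<Rightarrow> real \<Rightarrow> 'e \<Rightarrow> 'e mat2 set \<Rightarrow>
    'e mat2 set" where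
  "Vscale S \<gamma>1 \<gamma>2 y s a C = Jplus S \<gamma>1 \<gamma>2 y s <#>\<^bsub>U S\<^esub>
     {h \<in> Gfil S y s. \<exists>g\<in>C. (h - mat 1) - (\<chi> i j. a * (g - mat 1) $ i $ j) \<in> mat_lattice_plus S y s}"

definition commut :: "'e::field u11_data \<Rightarrow> 'e mat2 \<Rightarrow> 'e mat2 \<Rightarrow> 'e mat2" where
  "commut S g h = g ** h ** inv\<^bsub>U S\<^esub> g ** inv\<^bsub>U S\<^esub> h"

text \<open>
  The symplectic form enters through the pairing \<open>\<theta> [g, h]\<close>, which is the form with values in the
  residue field composed with a nontrivial additive character; for linear automorphisms of \<open>V\<close>,
  preserving the pairing is the same as preserving the form.
\<close>

definition SpV :: "'e::field u11_data \<Rightarrow> 'e \<Rightarrow> 'e \<Rightarrow> real \<Rightarrow> real \<Rightarrow> ('e mat2 \<Rightarrow> complex) \<Rightarrow>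
    ('e mat2 set \<Rightarrow> 'e mat2 set) set" where
  "SpV S \<gamma>1 \<gamma>2 y s \<theta> = {\<sigma> \<in> auto (Vgrp S \<gamma>1 \<gamma>2 y s).
     (\<forall>a\<in>pF S 0. \<forall>C\<in>carrier (Vgrp S \<gamma>1 \<gamma>2 y s).
        \<sigma> (Vscale S \<gamma>1 \<gamma>2 y s a C) = Vscale S \<gamma>1 \<gamma>2 y s a (\<sigma> C)) \<and>
     (\<forall>C\<in>carrier (Vgrp S \<gamma>1 \<gamma>2 y s). \<forall>D\<in>carrier (Vgrp S \<gamma>1 \<gamma>2 y s).
        \<forall>g\<in>C. \<forall>h\<in>D. \<forall>g'\<in>\<sigma> C. \<forall>h'\<in>\<sigma> D. \<theta> (commut S g' h') = \<theta> (commut S g h))}"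

definition conj_act :: "'e::field u11_data \<Rightarrow> 'e \<Rightarrow> 'e \<Rightarrow> real \<Rightarrow> real \<Rightarrow> 'e mat2 \<Rightarrow> 'e mat2 set \<Rightarrow>
    'e mat2 set" where
  "conj_act S \<gamma>1 \<gamma>2 y s t = (\<lambda>C\<in>carrier (Vgrp S \<gamma>1 \<gamma>2 y s). conj_set S t C)"

definition heisenberg_rep :: "'e::field u11_data \<Rightarrow> 'e \<Rightarrow> 'e \<Rightarrow> real \<Rightarrow> real \<Rightarrow> ('e mat2 \<Rightarrow> complex) \<Rightarrow>
    (complex \<Rightarrow> 'v \<Rightarrow> 'v::ab_group_add) \<Rightarrow> 'v set \<Rightarrow> ('e mat2 \<Rightarrow> 'v \<Rightarrow> 'v) \<Rightarrow> bool" where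
  "heisenberg_rep S \<gamma>1 \<gamma>2 y s \<theta> sc W \<eta> \<longleftrightarrow>
     irreducible_rep S sc (Gfil S y s) W \<eta> \<and>
     (\<forall>j\<in>Jplus S \<gamma>1 \<gamma>2 y s. \<forall>w\<in>W. \<eta> j w = sc (\<theta> j) w)"

text \<open>
  The Weil representation acts by automorphisms of the Heisenberg group on \<open>V\<close>, in which \<open>Sp(V)\<close> acts
  on \<open>V\<close> and trivially on the center.  To regard \<open>\<eta>\<close> as a representation of that group one needs a
  special isomorphism, i.e. a choice of operators \<open>A v\<close>, one in each class of \<open>\<eta>\<close> modulo scalars,
  with \<open>A v A w = \<langle>v, w\<rangle>\<^sup>1\<^sup>/\<^sup>2 A (v + w)\<close>.  The pairing takes values in the \<open>p\<close>-th roots of unity, on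
  which the square root is the power with exponent \<open>(p + 1)/2\<close>.  Compatibility with the conjugation
  by the torus, which acts on \<open>V\<close> through a group containing \<open>-1\<close>, makes \<open>A\<close> unique.
\<close>

definition special_lift :: "'e::field u11_data \<Rightarrow> 'e \<Rightarrow> 'e \<Rightarrow> real \<Rightarrow> real \<Rightarrow> ('e mat2 \<Rightarrow> complex) \<Rightarrow>
    (complex \<Rightarrow> 'v \<Rightarrow> 'v::ab_group_add) \<Rightarrow> 'v set \<Rightarrow> ('e mat2 \<Rightarrow> 'v \<Rightarrow> 'v) \<Rightarrow>
    ('e mat2 set \<Rightarrow> 'v \<Rightarrow> 'v) \<Rightarrow> bool" where
  "special_lift S \<gamma>1 \<gamma>2 y s \<theta> sc W \<eta> A \<longleftrightarrow>
     (\<forall>g\<in>Gfil S y s. \<exists>c. c \<noteq> 0 \<and>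
        (\<forall>w\<in>W. A (cls S \<gamma>1 \<gamma>2 y s g) w = sc c (\<eta> g w)) \<and>
        (\<forall>t\<in>torus S \<gamma>1 \<gamma>2. \<forall>w\<in>W. A (cls S \<gamma>1 \<gamma>2 y s (t ** g ** inv\<^bsub>U S\<^esub> t)) w =
                                  sc c (\<eta> (t ** g ** inv\<^bsub>U S\<^esub> t) w))) \<and>
     (\<forall>g\<in>Gfil S y s. \<forall>h\<in>Gfil S y s. \<forall>w\<in>W.
        A (cls S \<gamma>1 \<gamma>2 y s g) (A (cls S \<gamma>1 \<gamma>2 y s h) w) =
        sc (\<theta> (commut S g h) ^ ((residue_char S + 1) div 2)) (A (cls S \<gamma>1 \<gamma>2 y s (g ** h)) w))"

text \<open>
  The intertwining property determines the representation \<open>\<omega>\<close> of \<open>Sp(V)\<close> up to a character of \<open>Sp(V)\<close>,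
  hence uniquely unless the residue field has three elements.  The last clause makes it unique in
  that case too: if \<open>\<sigma> \<in> Sp(V)\<close> fixes the line spanned by \<open>C \<noteq> 0\<close> pointwise, then \<open>\<omega> \<sigma>\<close> fixes the
  vectors invariant under that line.  In the Schroedinger model this says that the operator
  \<open>f \<mapsto> (x \<mapsto> \<psi>(b x\<^sup>2/2) f x)\<close> attached to a unipotent element fixes the delta function at 0.
\<close>

definition weil_rep :: "'e::field u11_data \<Rightarrow> 'e \<Rightarrow> 'e \<Rightarrow> real \<Rightarrow> real \<Rightarrow> ('e mat2 \<Rightarrow> complex) \<Rightarrow>
    (complex \<Rightarrow> 'v \<Rightarrow> 'v::ab_group_add) \<Rightarrow> 'v set \<Rightarrow> ('e mat2 set \<Rightarrow> 'v \<Rightarrow> 'v) \<Rightarrow>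
    (('e mat2 set \<Rightarrow> 'e mat2 set) \<Rightarrow> 'v \<Rightarrow> 'v) \<Rightarrow> bool" where
  "weil_rep S \<gamma>1 \<gamma>2 y s \<theta> sc W A \<omega> \<longleftrightarrow>
     lin_rep sc ((AutoGroup (Vgrp S \<gamma>1 \<gamma>2 y s))\<lparr>carrier := SpV S \<gamma>1 \<gamma>2 y s \<theta>\<rparr>) W \<omega> \<and>
     (\<forall>\<sigma>\<in>SpV S \<gamma>1 \<gamma>2 y s \<theta>. \<forall>C\<in>carrier (Vgrp S \<gamma>1 \<gamma>2 y s). \<forall>w\<in>W.
        \<omega> \<sigma> (A C w) = A (\<sigma> C) (\<omega> \<sigma> w)) \<and>
     (\<forall>\<sigma>\<in>SpV S \<gamma>1 \<gamma>2 y s \<theta>. \<forall>C\<in>carrier (Vgrp S \<gamma>1 \<gamma>2 y s). \<forall>w\<in>W.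
        C \<noteq> \<one>\<^bsub>Vgrp S \<gamma>1 \<gamma>2 y s\<^esub> \<and> \<sigma> C = C \<and>
        (\<forall>a\<in>pF S 0. A (Vscale S \<gamma>1 \<gamma>2 y s a C) w = w) \<longrightarrow> \<omega> \<sigma> w = w)"

text \<open>
  \<open>(\<rho>, W)\<close> is a realization of \<open>\<rho>(T, y, r, \<phi>)\<close>.  In the first case this is the character \<open>\<theta> = \<phi>\<close>-hat; the
  second case occurs exactly when the torus is unramified and \<open>r\<close> is even.
\<close>

definition is_rho :: "'e::field u11_data \<Rightarrow> 'e \<Rightarrow> 'e \<Rightarrow> real \<Rightarrow> real \<Rightarrow> ('e mat2 \<Rightarrow> complex) \<Rightarrow>
    (complex \<Rightarrow> 'v \<Rightarrow> 'v::ab_group_add) \<Rightarrow> 'v set \<Rightarrow> ('e mat2 \<Rightarrow> 'v \<Rightarrow> 'v) \<Rightarrow> bool" where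
  "is_rho S \<gamma>1 \<gamma>2 y r \<phi> sc W \<rho> \<longleftrightarrow>
     smooth_rep S sc (Gfil S y (r/2) <#>\<^bsub>U S\<^esub> torus S \<gamma>1 \<gamma>2) W \<rho> \<and>
     (\<exists>\<Gamma> \<theta>. generic_elt S \<gamma>1 \<gamma>2 y r \<Gamma> \<and> realizes S \<gamma>1 \<gamma>2 y r \<Gamma> \<phi> \<and>
        is_phi_hat S \<gamma>1 \<gamma>2 y r \<Gamma> \<phi> \<theta> \<and>
        (if Gfil S y (r/2) = Gfil_plus S y (r/2)
         then vector_space.dim sc W = 1 \<and>
              (\<forall>x \<in> Gfil S y (r/2) <#>\<^bsub>U S\<^esub> torus S \<gamma>1 \<gamma>2. \<forall>w\<in>W. \<rho> x w = sc (\<theta> x) w)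
         else \<exists>\<eta> A \<omega>.
              heisenberg_rep S \<gamma>1 \<gamma>2 y (r/2) \<theta> sc W \<eta> \<and>
              special_lift S \<gamma>1 \<gamma>2 y (r/2) \<theta> sc W \<eta> A \<and>
              weil_rep S \<gamma>1 \<gamma>2 y (r/2) \<theta> sc W A \<omega> \<and>
              (\<forall>g \<in> Gfil S y (r/2). \<forall>t \<in> torus S \<gamma>1 \<gamma>2. \<forall>w\<in>W.
                 \<rho> (g ** t) w = sc (\<phi> t) (\<eta> g (\<omega> (conj_act S \<gamma>1 \<gamma>2 y (r/2) t) w)))))"

end

theory Submission
  imports Defs
begin

text \<open>
  By Mackey's criterion it suffices that the inducing representation stays irreducible on
  \<open>H = K \<inter> J\<^sup>g\<close>, where \<open>J = G\<^sub>y\<^sub>,\<^sub>s T\<close>, and that every \<open>x \<in> K - H\<close> fails to intertwine the character by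
  which the subgroup \<open>K \<inter> (G\<^sub>y\<^sub>,\<^sub>s\<^sub>+)\<^sup>g\<close> acts.  After conjugation by an element of \<open>K\<close>, the traceless part
  of \<open>g \<Gamma> g\<^sup>-\<^sup>1\<close> is antidiagonal, and \<open>G\<^sub>y\<^sub>,\<^sub>s\<close> is recognized through the trace form with \<open>\<Gamma>\<close> and the
  determinant of the commutator with \<open>\<Gamma>\<close>, an anisotropic quadratic form; all three are invariant under
  conjugation.  An intertwining \<open>x\<close> is tested first against a principal congruence subgroup and then
  against diagonal elements, which shows that it lies in \<open>H\<close>.  For the irreducibility, every element
  of \<open>G\<^sub>y\<^sub>,\<^sub>s\<close> can be multiplied by an element of \<open>T\<^sub>s\<close>, which acts by a scalar, so that its conjugate by
  \<open>g\<close> becomes upper triangular and lies in \<open>K\<close>.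
\<close>

section \<open>Arithmetic of the quadratic extension\<close>

text \<open>Two coordinate systems compete: \<open>Kmax S\<close> is visible in the matrix entries,
  while the inducing group is visible only after undoing the conjugation by \<open>g\<close>, which
  may distort entries arbitrarily. Conjugation-invariant numbers bridge the two. A matrix splits
  into a part commuting with the traceless part of \<Gamma> and a part anticommuting with it; the
  two traces determine the first, and the commutator sees only the second. Smallness of the second
  part is what puts a group element into the inducing group, and by anisotropy a single value of the
  form bounds both of its coordinates. A congruence subgroup is a good test because it is normal in
  \<open>Kmax S\<close>: the conjugate of a test element is again one. But its level must grow with
  the distortion, so it bounds one of the two coordinates sharply and the other too weakly; diagonal
  elements repair that, at the price that their conjugates have to be controlled by hand. Mackey's
  criterion is used without Hom spaces: an element and its conjugate act by distinct scalars, and a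
  sum over a finite orbit extracts the part of a function supported on one coset.\<close>

context unitary_setting
begin

abbreviation "F \<equiv> ground S"
abbreviation "rt \<equiv> rteps S"
abbreviation "\<P> \<equiv> pE S"

lemmas F_closed [simp, intro] = ground_subfield

lemma F_diff [simp, intro]: "x \<in> F \<Longrightarrow> y \<in> F \<Longrightarrow> x - y \<in> F"
  using ground_subfield(3)[of x "-y"] by simp

lemma F_divide [simp, intro]: "x \<in> F \<Longrightarrow> y \<in> F \<Longrightarrow> x / y \<in> F"
  by (simp add: divide_inverse)

lemma F_power [simp, intro]: "x \<in> F \<Longrightarrow> x ^ n \<in> F"
  by (induction n) auto

lemma F_2 [simp, intro]: "2 \<in> F"
  using ground_subfield(3)[of 1 1] by simp

section \<open>Ultrametric rules for the valuation and its ideals\<close>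

lemma nu_one [simp]: "nu S 1 = 0"
  using nu_mult[of 1 1] by simp

lemma nu_minus [simp]: "nu S (- x) = nu S x"
proof (cases "x = 0")
  case False
  have "nu S (-1) = 0"
    using nu_mult[of "-1" "-1"] by simp
  then show ?thesis
    using False nu_mult[of "-1" x] by simp
qed simp

lemma nu_inverse: "x \<noteq> 0 \<Longrightarrow> nu S (inverse x) = - nu S x"
  using nu_mult[of x "inverse x"] by simp

lemma nu_divide: "x \<noteq> 0 \<Longrightarrow> y \<noteq> 0 \<Longrightarrow> nu S (x / y) = nu S x - nu S y"
  by (simp add: divide_inverse nu_mult nu_inverse)

lemma nu_power: "x \<noteq> 0 \<Longrightarrow> nu S (x ^ n) = int n * nu S x"
  by (induction n) (auto simp: nu_mult algebra_simps)

lemma pE_0 [simp]: "0 \<in> \<P> n"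
  by (simp add: pE_def)

lemma pE_iff: "x \<noteq> 0 \<Longrightarrow> x \<in> \<P> n \<longleftrightarrow> n \<le> nu S x"
  by (simp add: pE_def)

lemma pE_mono: "x \<in> \<P> n \<Longrightarrow> m \<le> n \<Longrightarrow> x \<in> \<P> m"
  by (auto simp: pE_def)

lemma pE_1 [simp]: "1 \<in> \<P> 0"
  by (simp add: pE_def)

lemma pE_minus [simp]: "- x \<in> \<P> n \<longleftrightarrow> x \<in> \<P> n"
  by (auto simp: pE_def)

lemma pE_add: "x \<in> \<P> n \<Longrightarrow> y \<in> \<P> n \<Longrightarrow> x + y \<in> \<P> n"
  using nu_add[of x y] by (cases "x = 0"; cases "y = 0"; cases "x + y = 0") (auto simp: pE_def)

lemma pE_diff: "x \<in> \<P> n \<Longrightarrow> y \<in> \<P> n \<Longrightarrow> x - y \<in> \<P> n"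
  using pE_add[of x n "-y"] by simp

lemma pE_mult: "x \<in> \<P> m \<Longrightarrow> y \<in> \<P> n \<Longrightarrow> x * y \<in> \<P> (m + n)"
  by (cases "x = 0"; cases "y = 0") (auto simp: pE_iff nu_mult)

lemma pE_mult': "x \<in> \<P> m \<Longrightarrow> y \<in> \<P> n \<Longrightarrow> k \<le> m + n \<Longrightarrow> x * y \<in> \<P> k"
  using pE_mult pE_mono by blast

lemma pE_mult_iff: "u \<noteq> 0 \<Longrightarrow> u * x \<in> \<P> n \<longleftrightarrow> x \<in> \<P> (n - nu S u)"
  by (cases "x = 0") (auto simp: pE_iff nu_mult)

lemma pE_mult_iff': "u \<noteq> 0 \<Longrightarrow> x * u \<in> \<P> n \<longleftrightarrow> x \<in> \<P> (n - nu S u)"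
  using pE_mult_iff[of u x n] by (simp add: mult.commute)

lemma pE_divide_iff: "u \<noteq> 0 \<Longrightarrow> x / u \<in> \<P> n \<longleftrightarrow> x \<in> \<P> (n + nu S u)"
  by (cases "x = 0") (auto simp: pE_iff nu_divide)

lemma pE_square: "x ^ 2 \<in> \<P> n \<Longrightarrow> n \<ge> 2 * m - 1 \<Longrightarrow> x \<in> \<P> m"
  by (cases "x = 0") (auto simp: pE_iff nu_power)

lemma pE_power2: "x \<in> \<P> m \<Longrightarrow> n \<le> 2 * m \<Longrightarrow> x ^ 2 \<in> \<P> n"
  by (cases "x = 0") (auto simp: pE_iff nu_power)

lemma pE_all_zero: "(\<And>n. x \<in> \<P> n) \<Longrightarrow> x = 0"
  using pE_iff[of x "nu S x + 1"] by force

lemma pE_cancel: "x + y \<in> \<P> n \<Longrightarrow> x \<in> \<P> n \<longleftrightarrow> y \<in> \<P> n"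
  using pE_diff[of "x + y" n x] pE_diff[of "x + y" n y] by auto

lemma pE_add_dominant:
  assumes "x + y \<in> \<P> n" "x \<noteq> 0" "y \<in> \<P> (nu S x + 1)"
  shows "n \<le> nu S x"
proof (rule ccontr)
  assume "\<not> n \<le> nu S x"
  then have "x + y \<in> \<P> (nu S x + 1)"
    using assms(1) pE_mono by force
  then have "x \<in> \<P> (nu S x + 1)"
    using assms(3) pE_cancel by blast
  then show False
    using assms(2) by (simp add: pE_iff)
qed

text \<open>If 2 lay in the maximal ideal, the least positive integer lying there would be at most
  2. It is not 1, which is a unit, so the residue characteristic would be 2.\<close>

lemma two_unit [simp]: "(2::'e) \<noteq> 0" "nu S 2 = 0"
proof -
  have one: "(1::'e) \<notin> \<P> 1"
    by (simp add: pE_iff)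
  have "(2::'e) \<notin> \<P> 1"
  proof
    let ?Q = "\<lambda>n. 0 < n \<and> of_nat n \<in> pF S 1"
    assume "(2::'e) \<in> \<P> 1"
    then have 2: "?Q 2"
      by (simp add: pF_def)
    then have "?Q (LEAST n. ?Q n)" "(LEAST n. ?Q n) \<le> 2"
      by (rule LeastI, rule Least_le)
    then have "?Q (residue_char S)" "residue_char S \<le> 2"
      by (simp_all add: residue_char_def)
    moreover have "residue_char S \<noteq> 1"
      using calculation(1) one by (auto simp: pF_def)
    ultimately show False
      using residue_char_odd by linarith
  qed
  then show 2: "(2::'e) \<noteq> 0" and "nu S 2 = 0"
    using pE_add[of 1 0 1] by (auto simp: pE_def)
qed

lemma four_nonzero [simp]: "(4::'e) \<noteq> 0"
proof -
  have "(4::'e) = 2 * 2" by simp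
  then show ?thesis by (metis mult_eq_0_iff two_unit(1))
qed

lemma rt_facts [simp]: "rt \<noteq> 0" "nu S rt = 0" "rt\<^sup>2 \<in> F"
  using eps_unit nu_power[of rt 2] by auto

lemma pE_half: "x / 2 \<in> \<P> n \<longleftrightarrow> x \<in> \<P> n"
  by (simp add: pE_divide_iff)

lemma pE_double: "2 * x \<in> \<P> n \<longleftrightarrow> x \<in> \<P> n"
  by (simp add: pE_mult_iff)

lemma pE_rt: "x * rt \<in> \<P> n \<longleftrightarrow> x \<in> \<P> n" "rt * x \<in> \<P> n \<longleftrightarrow> x \<in> \<P> n"
  by (simp_all add: pE_mult_iff pE_mult_iff')

text \<open>Hensel's lemma by iteration: a fixed point of z -> (x - z^2) / 2 solves the equation,
  and the map contracts \<open>\<P> n\<close> because 2 is a unit and \<open>n \<ge> 1\<close>. The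
  iterates stay in \<open>F\<close>, where completeness is available.\<close>

lemma sqrt_one_plus:
  assumes x: "x \<in> F" "x \<in> \<P> n" and n: "n \<ge> 1"
  obtains z where "z \<in> F" "z \<in> \<P> n" "(1 + z)\<^sup>2 = 1 + x"
proof -
  define Z where "Z = rec_nat (0::'e) (\<lambda>_ z. (x - z\<^sup>2) / 2)"
  have Z0: "Z 0 = 0" and ZS: "Z (Suc i) = (x - (Z i)\<^sup>2) / 2" for i
    by (simp_all add: Z_def)
  have ZF: "Z i \<in> F" for i
    by (induction i) (use x in \<open>auto simp: Z0 ZS\<close>)
  have Zn: "Z i \<in> \<P> n" for i
  proof (induction i)
    case (Suc i)
    then have "(Z i)\<^sup>2 \<in> \<P> n"
      using n by (auto intro: pE_power2)
    then show ?case
      using x by (simp add: ZS pE_half pE_diff)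
  qed (simp add: Z0)
  have step: "Z (Suc i) - Z i \<in> \<P> (n + int i)" for i
  proof (induction i)
    case 0
    then show ?case using Zn[of "Suc 0"] by (simp add: Z0)
  next
    case (Suc i)
    have "Z (Suc (Suc i)) - Z (Suc i) = (x - (Z (Suc i))\<^sup>2) / 2 - (x - (Z i)\<^sup>2) / 2"
      by (metis ZS)
    also have "\<dots> = - ((Z (Suc i) - Z i) * ((Z (Suc i) + Z i) / 2))"
      by (simp add: field_simps power2_eq_square)
    finally have "Z (Suc (Suc i)) - Z (Suc i) = - ((Z (Suc i) - Z i) * ((Z (Suc i) + Z i) / 2))" .
    moreover have "(Z (Suc i) - Z i) * ((Z (Suc i) + Z i) / 2) \<in> \<P> (n + int (Suc i))"
      by (rule pE_mult'[OF Suc, of _ n]) (use n Zn pE_add pE_half in auto)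
    ultimately show ?case by simp
  qed
  have tail: "Z (i + k) - Z i \<in> \<P> (n + int i)" for i k
  proof (induction k)
    case (Suc k)
    have "Z (Suc (i + k)) - Z (i + k) \<in> \<P> (n + int i)"
      using step[of "i + k"] by (auto intro: pE_mono)
    from pE_add[OF this Suc] show ?case by simp
  qed simp
  have "\<exists>m. \<forall>i\<ge>m. \<forall>j\<ge>m. Z i - Z j \<in> pF S N" for N
  proof (intro exI[of _ "nat N"] allI impI)
    fix i j assume ij: "nat N \<le> i" "nat N \<le> j"
    have "Z i - Z (nat N) \<in> \<P> N" "Z j - Z (nat N) \<in> \<P> N"
      using tail[of "nat N" "i - nat N"] tail[of "nat N" "j - nat N"] ij n
      by (auto intro!: pE_mono[of _ "n + int (nat N)" N])
    from pE_diff[OF this] show "Z i - Z j \<in> pF S N"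
      using ZF by (simp add: pF_def)
  qed
  then obtain l where l: "l \<in> F" "\<And>N. \<exists>m::nat. \<forall>i\<ge>m. Z i - l \<in> pF S N"
    using complete[of Z] ZF by blast
  have ln: "l \<in> \<P> n"
  proof -
    obtain i where "Z i - l \<in> \<P> n"
      using l(2)[of n] by (auto simp: pF_def)
    from pE_diff[OF Zn[of i] this] show ?thesis by simp
  qed
  have "(1 + l)\<^sup>2 - (1 + x) \<in> \<P> N" for N
  proof -
    obtain m where m: "\<forall>i\<ge>m. Z i - l \<in> pF S (max N 0)"
      using l(2) by blast
    then have d: "Z m - l \<in> \<P> (max N 0)" "Z (Suc m) - l \<in> \<P> (max N 0)"
      by (auto simp: pF_def)
    have "(Z m - l) * (Z m + l) \<in> \<P> (max N 0)"
      by (rule pE_mult'[OF d(1), of _ n]) (use n Zn ln pE_add in auto)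
    \<comment> \<open>The defect of the limit is expressed through the errors of two consecutive
      iterates, which \<open>d\<close> makes arbitrarily small.\<close>
    moreover have e: "(1 + l)\<^sup>2 - (1 + x) = - (2 * (Z (Suc m) - l)) - (Z m - l) * (Z m + l)"
      unfolding ZS by (simp add: field_simps power2_eq_square)
    ultimately have "(1 + l)\<^sup>2 - (1 + x) \<in> \<P> (max N 0)"
      unfolding e by (intro pE_diff) (use d(2) in \<open>simp_all only: pE_minus pE_double\<close>)
    then show ?thesis
      by (rule pE_mono) simp
  qed
  then have "(1 + l)\<^sup>2 = 1 + x"
    using pE_all_zero by fastforce
  then show thesis
    using that l(1) ln by blast
qed

text \<open>This is the norm form of the unramified extension. With distinct valuations the dominant
  term decides. With equal ones, cancellation would make \<open>rt\<^sup>2 / t\<^sup>2\<close>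
  congruent to 1, hence a square by \<open>sqrt_one_plus\<close>, and \<epsilon> would be a square
  in \<open>F\<close>.\<close>

lemma anisotropic_rt:
  assumes "a \<in> F" "b \<in> F" "a\<^sup>2 - rt\<^sup>2 * b\<^sup>2 \<in> \<P> n"
  shows "a\<^sup>2 \<in> \<P> n" "b\<^sup>2 \<in> \<P> n"
proof -
  have key: "b\<^sup>2 \<in> \<P> n"
  proof (cases "a = 0 \<or> b = 0")
    case True
    then show ?thesis
      using assms by (auto simp: pE_mult_iff eps_unit)
  next
    case False
    then have [simp]: "a \<noteq> 0" "b \<noteq> 0" by auto
    consider "nu S a < nu S b" | "nu S b < nu S a" | "nu S a = nu S b" by linarith
    then show ?thesis
    proof cases
      case 1
      have "n \<le> nu S (a\<^sup>2)"
        by (rule pE_add_dominant[of _ "- (rt\<^sup>2 * b\<^sup>2)"])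
          (use assms 1 in \<open>auto simp: pE_iff nu_mult nu_power\<close>)
      then show ?thesis
        using 1 by (simp add: pE_iff nu_power)
    next
      case 2
      have "n \<le> nu S (- (rt\<^sup>2 * b\<^sup>2))"
        by (rule pE_add_dominant[of _ "a\<^sup>2"])
          (use assms 2 in \<open>auto simp: pE_iff nu_mult nu_power\<close>)
      then show ?thesis
        by (simp add: pE_iff nu_power nu_mult)
    next
      case 3
      define t where "t = a / b"
      have t: "t \<in> F" "t \<noteq> 0" "nu S t = 0"
        using assms 3 by (auto simp: t_def nu_divide)
      have "rt\<^sup>2 / t\<^sup>2 - 1 \<notin> \<P> 1"
      proof
        assume "rt\<^sup>2 / t\<^sup>2 - 1 \<in> \<P> 1"
        then obtain z where "z \<in> F" "(1 + z)\<^sup>2 = 1 + (rt\<^sup>2 / t\<^sup>2 - 1)"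
          using sqrt_one_plus[of "rt\<^sup>2 / t\<^sup>2 - 1" 1] t by (metis F_closed(2) F_diff F_divide F_power order_refl rt_facts(3))
        then have "((1 + z) * t)\<^sup>2 = rt\<^sup>2" "(1 + z) * t \<in> F"
          using t by (auto simp: power_mult_distrib)
        then show False
          using eps_nonsquare by blast
      qed
      moreover have "a\<^sup>2 - rt\<^sup>2 * b\<^sup>2 = - (a\<^sup>2 * (rt\<^sup>2 / t\<^sup>2 - 1))"
        by (simp add: t_def field_simps)
      then have "rt\<^sup>2 / t\<^sup>2 - 1 \<in> \<P> (n - 2 * nu S a)"
        using assms(3) by (simp add: pE_mult_iff nu_power)
      ultimately have "n - 2 * nu S a < 1"
        by (meson not_less pE_mono)
      then show ?thesis
        using 3 by (simp add: pE_iff nu_power)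
    qed
  qed
  then have "rt\<^sup>2 * b\<^sup>2 \<in> \<P> n"
    by (simp add: pE_mult_iff eps_unit)
  then show "a\<^sup>2 \<in> \<P> n" "b\<^sup>2 \<in> \<P> n"
    using key assms(3) pE_add by fastforce+
qed

section \<open>Conjugation and integral coordinates over \<open>F\<close>\<close>

lemma E_decomp: obtains a b where "a \<in> F" "b \<in> F" "x = a + b * rt"
  using quadratic by blast

lemma bar_F [simp]: "a \<in> F \<Longrightarrow> bar S a = a"
  using bar[of a 0] by simp

lemma bar_rt [simp]: "bar S rt = - rt"
  using bar[of 0 1] by simp

lemma bar_add [simp]: "bar S (x + y) = bar S x + bar S y"
proof -
  obtain a b c d where *: "a \<in> F" "b \<in> F" "x = a + b * rt" "c \<in> F" "d \<in> F" "y = c + d * rt"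
    by (metis E_decomp)
  have e: "x + y = (a + c) + (b + d) * rt"
    using * by (simp add: algebra_simps)
  show ?thesis
    unfolding e using * by (subst bar) (auto simp: bar algebra_simps)
qed

lemma bar_mult [simp]: "bar S (x * y) = bar S x * bar S y"
proof -
  obtain a b c d where *: "a \<in> F" "b \<in> F" "x = a + b * rt" "c \<in> F" "d \<in> F" "y = c + d * rt"
    by (metis E_decomp)
  have e: "x * y = (a * c + rt\<^sup>2 * (b * d)) + (a * d + b * c) * rt"
    using * by (simp add: algebra_simps power2_eq_square)
  have "bar S (x * y) = (a * c + rt\<^sup>2 * (b * d)) - (a * d + b * c) * rt"
    unfolding e using * by (intro bar) auto
  moreover have "bar S x = a - b * rt" "bar S y = c - d * rt"
    using * bar by blast+
  ultimately show ?thesis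
    by (simp only:) (simp add: algebra_simps power2_eq_square)
qed

lemma bar_minus [simp]: "bar S (- x) = - bar S x"
  using bar_mult[of "-1" x] by simp

lemma bar_diff [simp]: "bar S (x - y) = bar S x - bar S y"
  using bar_add[of x "-y"] by simp

lemma bar_bar [simp]: "bar S (bar S x) = x"
proof -
  obtain a b where "a \<in> F" "b \<in> F" "x = a + b * rt" by (rule E_decomp)
  then show ?thesis by simp
qed

lemma bar_eq_0 [simp]: "bar S x = 0 \<longleftrightarrow> x = 0"
  by (metis bar_F bar_bar ground_subfield(1))

lemma bar_inverse [simp]: "bar S (inverse x) = inverse (bar S x)"
proof (cases "x = 0")
  case False
  then have "bar S x * bar S (inverse x) = 1"
    by (simp add: bar_mult[symmetric] del: bar_mult)
  then show ?thesis
    by (simp add: inverse_unique)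
qed simp

lemma bar_divide [simp]: "bar S (x / y) = bar S x / bar S y"
  by (simp add: divide_inverse)

lemma bar_fixed: "bar S x = x \<longleftrightarrow> x \<in> F"
proof
  assume *: "bar S x = x"
  obtain a b where ab: "a \<in> F" "b \<in> F" "x = a + b * rt" by (rule E_decomp)
  have "x - bar S x = 2 * (b * rt)"
    unfolding ab(3) using ab(1,2) by (simp add: algebra_simps)
  then have "2 * (b * rt) = 0"
    unfolding * by simp
  then show "x \<in> F"
    using ab by auto
qed auto

lemma norm_F [simp]: "x * bar S x \<in> F"
  by (metis bar_fixed bar_bar bar_mult mult.commute)

text \<open>By anisotropy the norm has valuation at most twice the smaller coordinate valuation. The
  conjugate factor takes at least that smaller valuation, which leaves at most as much for the
  element itself. The invariance of \<open>nu\<close> under \<open>bar\<close> is deduced from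
  this.\<close>

lemma pE_decomp:
  assumes "a \<in> F" "b \<in> F"
  shows "a + b * rt \<in> \<P> n \<longleftrightarrow> a \<in> \<P> n \<and> b \<in> \<P> n"
proof
  assume *: "a + b * rt \<in> \<P> n"
  show "a \<in> \<P> n \<and> b \<in> \<P> n"
  proof (cases "a = 0 \<or> b = 0")
    case True
    then show ?thesis using * by (auto simp: pE_rt)
  next
    case False
    then have [simp]: "a \<noteq> 0" "b \<noteq> 0" by auto
    define \<mu> where "\<mu> = min (nu S a) (nu S b)"
    have N: "a\<^sup>2 - rt\<^sup>2 * b\<^sup>2 = (a + b * rt) * (a - b * rt)"
      by (simp add: algebra_simps power2_eq_square)
    have "(a / b)\<^sup>2 \<noteq> rt\<^sup>2"
      using eps_nonsquare assms by blast
    then have "a\<^sup>2 - rt\<^sup>2 * b\<^sup>2 \<noteq> 0"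
      by (simp add: field_simps)
    then have nz: "a + b * rt \<noteq> 0" "a - b * rt \<noteq> 0"
      using N by auto
    define m where "m = nu S (a\<^sup>2 - rt\<^sup>2 * b\<^sup>2)"
    have m: "m = nu S (a + b * rt) + nu S (a - b * rt)"
      using nz by (simp add: m_def N nu_mult)
    have "a\<^sup>2 - rt\<^sup>2 * b\<^sup>2 \<in> \<P> m"
      by (simp add: m_def pE_def)
    from anisotropic_rt[OF assms this] have "m \<le> 2 * \<mu>"
      by (auto simp: pE_iff nu_power \<mu>_def)
    moreover have "a \<in> \<P> \<mu>" "b * rt \<in> \<P> \<mu>"
      by (auto simp: \<mu>_def pE_rt pE_iff)
    then have "a - b * rt \<in> \<P> \<mu>"
      using pE_diff by blast
    then have "\<mu> \<le> nu S (a - b * rt)"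
      using nz by (simp add: pE_iff)
    ultimately have "n \<le> \<mu>"
      using * m nz by (simp add: pE_iff)
    then show ?thesis
      by (auto simp: \<mu>_def pE_iff)
  qed
qed (auto intro!: pE_add simp: pE_rt)

lemma pE_bar [simp]: "bar S x \<in> \<P> n \<longleftrightarrow> x \<in> \<P> n"
proof -
  obtain a b where ab: "a \<in> F" "b \<in> F" "x = a + b * rt" by (rule E_decomp)
  then have "bar S x = a + (-b) * rt" by simp
  then have "bar S x \<in> \<P> n \<longleftrightarrow> a \<in> \<P> n \<and> - b \<in> \<P> n"
    using pE_decomp[of a "-b" n] ab by simp
  then show ?thesis
    unfolding ab(3) using ab by (simp add: pE_decomp)
qed

lemma nu_bar [simp]: "nu S (bar S x) = nu S x"
proof (cases "x = 0")
  case False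
  then show ?thesis
    using pE_bar[of x "nu S x"] pE_bar[of x "nu S (bar S x)"]
    by (simp add: pE_iff del: pE_bar)
qed simp

text \<open>Digit expansion in base \<open>unif S\<close>; it supplies the finiteness that
  compactness of the ring of integers would give.\<close>

lemma finite_approx_F:
  "\<exists>R. finite R \<and> (\<forall>x\<in>pF S 0. \<exists>y\<in>R. x - y \<in> \<P> (int n))"
proof (induction n)
  case 0
  show ?case
    by (rule exI[of _ "{0}"]) (simp add: pF_def)
next
  case (Suc n)
  then obtain R where R: "finite R" "\<And>x. x \<in> pF S 0 \<Longrightarrow> \<exists>y\<in>R. x - y \<in> \<P> (int n)"
    by blast
  let ?E = "{(x, y). x \<in> pF S 0 \<and> y \<in> pF S 0 \<and> x - y \<in> pF S 1}"
  define R0 where "R0 = (\<lambda>X. SOME x. x \<in> X) ` (pF S 0 // ?E)"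
  have "finite R0"
    using finite_residue_field by (simp add: R0_def)
  have R0: "\<exists>y\<in>R0. y \<in> pF S 0 \<and> x - y \<in> pF S 1" if x: "x \<in> pF S 0" for x
  proof -
    let ?y = "SOME y. y \<in> ?E `` {x}"
    have "x \<in> ?E `` {x}"
      using x by (auto simp: pF_def)
    then have "?y \<in> ?E `` {x}"
      by (rule someI)
    moreover have "?E `` {x} \<in> pF S 0 // ?E"
      using x by (rule quotientI)
    then have "?y \<in> R0"
      unfolding R0_def by (rule imageI)
    ultimately show ?thesis by auto
  qed
  define \<pi> where "\<pi> = unif S"
  have pi: "\<pi> \<in> F" "\<pi> \<noteq> 0" "nu S \<pi> = 1"
    using unif by (auto simp: \<pi>_def)
  show ?case
  proof (intro exI conjI ballI)
    show "finite ((\<lambda>(y, z). y + \<pi> * z) ` (R0 \<times> R))"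
      using \<open>finite R0\<close> R by simp
    fix x assume x: "x \<in> pF S 0"
    obtain y where y: "y \<in> R0" "y \<in> pF S 0" "x - y \<in> pF S 1"
      using R0[OF x] by blast
    then have "(x - y) / \<pi> \<in> pF S 0"
      using pi by (auto simp: pF_def pE_divide_iff)
    then obtain z where z: "z \<in> R" "(x - y) / \<pi> - z \<in> \<P> (int n)"
      using R by blast
    have "x - (y + \<pi> * z) = \<pi> * ((x - y) / \<pi> - z)"
      using pi by (simp add: field_simps)
    then have "x - (y + \<pi> * z) \<in> \<P> (int (Suc n))"
      using z pi by (simp add: pE_mult_iff)
    then show "\<exists>y\<in>(\<lambda>(y, z). y + \<pi> * z) ` (R0 \<times> R). x - y \<in> \<P> (int (Suc n))"
      using y z by auto
  qed
qed

lemma finite_approx: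
  "\<exists>R. finite R \<and> (\<forall>x\<in>\<P> 0. \<exists>y\<in>R. x - y \<in> \<P> n)"
proof -
  obtain R where R: "finite R" "\<And>x. x \<in> pF S 0 \<Longrightarrow> \<exists>y\<in>R. x - y \<in> \<P> (int (nat n))"
    using finite_approx_F[of "nat n"] by blast
  show ?thesis
  proof (intro exI conjI ballI)
    show "finite ((\<lambda>(y, z). y + z * rt) ` (R \<times> R))"
      using R by simp
    fix x assume x: "x \<in> \<P> 0"
    obtain a b where ab: "a \<in> F" "b \<in> F" "x = a + b * rt" by (rule E_decomp)
    then have "a \<in> pF S 0" "b \<in> pF S 0"
      using x by (auto simp: pE_decomp pF_def)
    then obtain y z where yz: "y \<in> R" "a - y \<in> \<P> (int (nat n))" "z \<in> R" "b - z \<in> \<P> (int (nat n))"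
      using R by blast
    then have "(a - y) + (b - z) * rt \<in> \<P> (int (nat n))"
      by (intro pE_add) (auto simp: pE_rt)
    then have "(a - y) + (b - z) * rt \<in> \<P> n"
      by (rule pE_mono) simp
    moreover have "(a - y) + (b - z) * rt = x - (y + z * rt)"
      unfolding ab(3) by (simp add: algebra_simps)
    ultimately have "x - (y + z * rt) \<in> \<P> n"
      by metis
    then show "\<exists>y\<in>(\<lambda>(y, z). y + z * rt) ` (R \<times> R). x - y \<in> \<P> n"
      using yz by auto
  qed
qed

end

section \<open>The unitary group\<close>

lemma mat2_nth [simp]:
  "mat2 a b c d $ 1 $ 1 = a" "mat2 a b c d $ 1 $ 2 = b"
  "mat2 a b c d $ 2 $ 1 = c" "mat2 a b c d $ 2 $ 2 = d"
  by (simp_all add: mat2_def)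

lemma mat2_eta: "mat2 (X $ 1 $ 1) (X $ 1 $ 2) (X $ 2 $ 1) (X $ 2 $ 2) = X"
  by (simp add: vec_eq_iff forall_2)

lemma mat2_cases: obtains a b c d where "X = mat2 a b c d"
  using mat2_eta by metis

lemma mat2_eq_iff: "mat2 a b c d = mat2 a' b' c' d' \<longleftrightarrow> a = a' \<and> b = b' \<and> c = c' \<and> d = d'"
  by (auto simp: vec_eq_iff forall_2)

lemma mat2_mult: "mat2 a b c d ** mat2 a' b' c' d' =
    mat2 (a * a' + b * c') (a * b' + b * d') (c * a' + d * c') (c * b' + d * d')"
  by (simp add: vec_eq_iff forall_2 matrix_matrix_mult_def sum_2)

lemma mat2_diff: "mat2 a b c d - mat2 a' b' c' d' = mat2 (a - a') (b - b') (c - c') (d - d')"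
  by (simp add: vec_eq_iff forall_2)

lemma mat2_add: "mat2 a b c d + mat2 a' b' c' d' = mat2 (a + a') (b + b') (c + c') (d + d')"
  by (simp add: vec_eq_iff forall_2)

lemma mat_1_mat2: "mat 1 = mat2 1 0 0 1"
  by (simp add: vec_eq_iff forall_2 mat_def)

lemma det_mat2: "det (mat2 a b c d) = a * d - b * c"
  by (simp add: det_2)

lemma trace_mat2: "trace (mat2 a b c d) = a + d"
  by (simp add: trace_def sum_2)

context unitary_setting
begin

text \<open>
  By Hilbert 90 every element of the group is a unit \<open>l\<close> of \<open>E\<close> times a matrix with entries
  \<open>a, b \<surd>\<epsilon>, c \<surd>\<epsilon>, d\<close>, where \<open>a, b, c, d \<in> F\<close>; \<open>dt\<close> is the determinant of the latter.
\<close>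

definition elt :: "'e \<Rightarrow> 'e \<Rightarrow> 'e \<Rightarrow> 'e \<Rightarrow> 'e \<Rightarrow> 'e mat2" where
  "elt l a b c d = mat2 (l * a) (l * (b * rt)) (l * (c * rt)) (l * d)"

definition dt :: "'e \<Rightarrow> 'e \<Rightarrow> 'e \<Rightarrow> 'e \<Rightarrow> 'e" where
  "dt a b c d = a * d - rt\<^sup>2 * (b * c)"

lemma U_simps [simp]: "mult (U S) = (**)" "one (U S) = mat 1"
  by (simp_all add: U_def)

lemma U_iff: "mat2 A B C D \<in> carrier (U S) \<longleftrightarrow>
   bar S C * A + bar S A * C = 0 \<and> bar S C * B + bar S A * D = 1 \<and>
   bar S D * A + bar S B * C = 1 \<and> bar S D * B + bar S B * D = 0"
proof -
  have "transpose (\<chi> i j. bar S (mat2 A B C D $ i $ j)) = mat2 (bar S A) (bar S C) (bar S B) (bar S D)"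
    by (simp add: vec_eq_iff forall_2 transpose_def)
  then show ?thesis
    by (simp add: U_def mat2_mult mat2_eq_iff)
qed

lemma elt_mult: "elt l a b c d ** elt l' a' b' c' d' =
    elt (l * l') (a * a' + rt\<^sup>2 * (b * c')) (a * b' + b * d') (c * a' + d * c') (rt\<^sup>2 * (c * b') + d * d')"
  by (simp add: elt_def mat2_mult mat2_eq_iff algebra_simps power2_eq_square)

lemma dt_mult: "dt (a * a' + rt\<^sup>2 * (b * c')) (a * b' + b * d') (c * a' + d * c') (rt\<^sup>2 * (c * b') + d * d')
    = dt a b c d * dt a' b' c' d'"
  by (simp add: dt_def algebra_simps power2_eq_square)

lemma elt_scale: "k \<noteq> 0 \<Longrightarrow> elt (l * k) (a / k) (b / k) (c / k) (d / k) = elt l a b c d"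
  by (simp add: elt_def)

lemma elt_in_U:
  assumes "a \<in> F" "b \<in> F" "c \<in> F" "d \<in> F" "l * bar S l * dt a b c d = 1"
  shows "elt l a b c d \<in> carrier (U S)"
  unfolding elt_def U_iff using assms
  by (simp add: dt_def algebra_simps power2_eq_square)

text \<open>Hilbert 90 made explicit: after division by a nonzero entry of the first column, the
  unitary relations make all ratios conjugation-fixed, once a factor \<open>rt\<close> is set aside
  off the diagonal. A power of the uniformizer then moves the valuation of \<open>l\<close> into the
  coordinates.\<close>

lemma elt_obtain:
  assumes "g \<in> carrier (U S)"
  obtains l a b c d where "a \<in> F" "b \<in> F" "c \<in> F" "d \<in> F" "l \<noteq> 0" "nu S l = 0"
    "l * bar S l * dt a b c d = 1" "g = elt l a b c d"
proof -
  obtain A B C D where g: "g = mat2 A B C D" by (rule mat2_cases)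
  have eqs: "bar S C * A + bar S A * C = 0" "bar S C * B + bar S A * D = 1"
    "bar S D * A + bar S B * C = 1" "bar S D * B + bar S B * D = 0"
    using assms unfolding g U_iff by auto
  have rat: "y / x \<in> F" if "bar S y * x = bar S x * y" "x \<noteq> 0" for x y
    using that by (intro bar_fixed[THEN iffD1]) (simp add: field_simps)
  have "\<exists>l a b c d. a \<in> F \<and> b \<in> F \<and> c \<in> F \<and> d \<in> F \<and> l \<noteq> 0 \<and> g = elt l a b c d"
  proof (cases "A = 0")
    case True
    then have "bar S C * B = 1" using eqs by simp
    then have [simp]: "C \<noteq> 0" "B \<noteq> 0" by auto
    have BC: "bar S B * C = 1" using True eqs by simp
    have 1: "B / C \<in> F"
      using \<open>bar S C * B = 1\<close> BC by (intro rat) (simp_all add: mult.commute)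
    have 2: "D / (C / rt) \<in> F"
    proof (rule rat)
      have "C * (bar S D * B) = - C * (bar S B * D)"
        using eqs(4) by (simp add: add_eq_0_iff2)
      then have "bar S C * (C * (bar S D * B)) = bar S C * (- C * (bar S B * D))"
        by simp
      then have "C * bar S D * (bar S C * B) = - (bar S C * D) * (bar S B * C)"
        by (simp add: mult_ac)
      then have "C * bar S D = - (bar S C * D)"
        by (simp only: \<open>bar S C * B = 1\<close> BC mult_1_right)
      then show "bar S D * (C / rt) = bar S (C / rt) * D"
        by (simp add: field_simps)
    qed simp
    have "g = elt (C / rt) 0 (B / C) 1 (D / (C / rt))"
      using True by (simp add: g elt_def mat2_eq_iff)
    moreover have "C / rt \<noteq> 0" by simp
    ultimately show ?thesis
      using 1 2 ground_subfield(1,2) by blast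
  next
    case False
    have "bar S C * A = - (bar S A * C)"
      using eqs(1) by (simp add: add_eq_0_iff2)
    then have "bar S C * A * rt = - (bar S A * C) * rt"
      by (rule arg_cong)
    then have 1: "C / (A * rt) \<in> F"
      using False by (intro rat) (simp_all add: mult_ac)
    define c where "c = C / (A * rt)"
    have C: "C = A * (c * rt)" using False by (simp add: c_def)
    have c: "c \<in> F" using 1 by (simp add: c_def)
    have D: "D = 1 / bar S A + c * rt * B"
    proof -
      have "bar S A * D = 1 + bar S A * (c * rt) * B"
        using eqs(2) c by (simp add: C algebra_simps)
      then show ?thesis
        using False by (simp add: field_simps)
    qed
    have B: "B / (A * rt) \<in> F"
    proof (rule rat)
      have "bar S D = 1 / A - c * rt * bar S B"
        using c by (simp add: D)
      then have "B / A + bar S B / bar S A = 0"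
        using eqs(4) False c by (simp add: D algebra_simps)
      then have "bar S B * A = - (bar S A * B)"
        using False by (simp add: add_eq_0_iff field_simps)
      then have "bar S B * A * rt = - (bar S A * B) * rt"
        by (rule arg_cong)
      then show "bar S B * (A * rt) = bar S (A * rt) * B"
        by (simp add: mult_ac)
    qed (use False in simp)
    define b where "b = B / (A * rt)"
    have Bb: "B = A * (b * rt)" using False by (simp add: b_def)
    have b: "b \<in> F" using B by (simp add: b_def)
    have d: "inverse (A * bar S A) + c * b * rt\<^sup>2 \<in> F"
      by (intro ground_subfield(3) ground_subfield(6) norm_F)
        (use b c in \<open>simp add: ground_subfield(4)\<close>)
    have "D = A * (inverse (A * bar S A) + c * b * rt\<^sup>2)"
      unfolding D Bb using False by (simp add: field_simps power2_eq_square)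
    then have "g = elt A 1 b c (inverse (A * bar S A) + c * b * rt\<^sup>2)"
      by (simp add: g elt_def mat2_eq_iff C Bb)
    then show ?thesis
      using b c d False ground_subfield(2) by blast
  qed
  then obtain l a b c d where F: "a \<in> F" "b \<in> F" "c \<in> F" "d \<in> F" and l: "l \<noteq> 0" and g': "g = elt l a b c d"
    by blast
  define k where "k = unif S powi (- nu S l)"
  have nu_nat: "nu S (unif S ^ n) = int n" for n
    using unif by (simp add: nu_power)
  have k: "k \<in> F" "k \<noteq> 0" "nu S k = - nu S l"
    using unif nu_nat by (auto simp: k_def power_int_def nu_inverse nu_power intro: F_power)
  define a' where "a' = a / k"
  define b' where "b' = b / k"
  define c' where "c' = c / k"
  define d' where "d' = d / k"
  have F': "a' \<in> F" "b' \<in> F" "c' \<in> F" "d' \<in> F"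
    using F k by (auto simp: a'_def b'_def c'_def d'_def)
  have g'': "g = elt (l * k) a' b' c' d'"
    using k by (simp add: g' elt_scale a'_def b'_def c'_def d'_def)
  have "(l * k) * bar S (l * k) * dt a' b' c' d' = 1"
    using eqs(2) F' g'' unfolding g elt_def mat2_eq_iff
    by (simp add: dt_def algebra_simps power2_eq_square)
  moreover have "nu S (l * k) = 0"
    using l k by (simp add: nu_mult)
  ultimately show thesis
    using that[of a' b' c' d' "l * k"] F' g'' l k by simp
qed

lemma elt_mult_in_U:
  assumes "l * bar S l * dt a b c d = 1" "l' * bar S l' * dt a' b' c' d' = 1"
  shows "(l * l') * bar S (l * l') * dt (a * a' + rt\<^sup>2 * (b * c')) (a * b' + b * d') (c * a' + d * c') (rt\<^sup>2 * (c * b') + d * d') = 1"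
proof -
  have "(l * l') * bar S (l * l') * (dt a b c d * dt a' b' c' d') =
      (l * bar S l * dt a b c d) * (l' * bar S l' * dt a' b' c' d')"
    by simp
  then show ?thesis
    by (simp only: dt_mult assms mult_1)
qed

lemma elt_inverse:
  assumes "l * bar S l * dt a b c d = 1"
  shows "elt (bar S l) d (-b) (-c) a ** elt l a b c d = mat 1"
proof -
  have "l * (bar S l * (a * d)) = 1 + l * (bar S l * (rt\<^sup>2 * (b * c)))"
    using assms by (simp add: dt_def algebra_simps)
  then show ?thesis
    by (simp add: elt_mult) (simp add: elt_def mat_1_mat2 mat2_eq_iff algebra_simps)
qed

lemma one_in_U [simp]: "mat 1 \<in> carrier (U S)"
  by (simp add: mat_1_mat2 U_iff)

lemma group_U: "group (U S)"
proof (rule groupI)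
  fix x y assume xy: "x \<in> carrier (U S)" "y \<in> carrier (U S)"
  obtain l a b c d where x: "a \<in> F" "b \<in> F" "c \<in> F" "d \<in> F"
    "l * bar S l * dt a b c d = 1" "x = elt l a b c d"
    using elt_obtain[OF xy(1)] by metis
  obtain l' a' b' c' d' where y: "a' \<in> F" "b' \<in> F" "c' \<in> F" "d' \<in> F"
    "l' * bar S l' * dt a' b' c' d' = 1" "y = elt l' a' b' c' d'"
    using elt_obtain[OF xy(2)] by metis
  show "x \<otimes>\<^bsub>U S\<^esub> y \<in> carrier (U S)"
    unfolding U_simps x(6) y(6) elt_mult using x y
    by (intro elt_in_U elt_mult_in_U) auto
next
  fix x assume xy: "x \<in> carrier (U S)"
  obtain l a b c d where x: "a \<in> F" "b \<in> F" "c \<in> F" "d \<in> F"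
    "l * bar S l * dt a b c d = 1" "x = elt l a b c d"
    using elt_obtain[OF xy(1)] by metis
  have "elt (bar S l) d (-b) (-c) a \<in> carrier (U S)"
    using x by (intro elt_in_U) (auto simp: dt_def algebra_simps)
  then show "\<exists>y\<in>carrier (U S). y \<otimes>\<^bsub>U S\<^esub> x = \<one>\<^bsub>U S\<^esub>"
    using elt_inverse[OF x(5)] x(6) by auto
qed (auto simp: matrix_mul_assoc)

sublocale G: group "U S"
  by (rule group_U)

abbreviation "iv g \<equiv> inv\<^bsub>U S\<^esub> g"

lemma U_mult [simp, intro]: "g \<in> carrier (U S) \<Longrightarrow> h \<in> carrier (U S) \<Longrightarrow> g ** h \<in> carrier (U S)"
  using G.m_closed by simp

lemma iv_mult: "g \<in> carrier (U S) \<Longrightarrow> h \<in> carrier (U S) \<Longrightarrow> iv (g ** h) = iv h ** iv g"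
  using G.inv_mult_group by simp

lemma iv_left [simp]: "g \<in> carrier (U S) \<Longrightarrow> iv g ** g = mat 1"
  using G.l_inv by simp

lemma iv_right [simp]: "g \<in> carrier (U S) \<Longrightarrow> g ** iv g = mat 1"
  using G.r_inv by simp

lemma iv_cancel [simp]:
  "g \<in> carrier (U S) \<Longrightarrow> X ** iv g ** g = X" "g \<in> carrier (U S) \<Longrightarrow> X ** g ** iv g = X"
  by (simp_all add: matrix_mul_assoc[symmetric])

lemma iv_one [simp]: "iv (mat 1) = mat 1"
  using G.inv_one by simp

lemma iv_elt:
  assumes "a \<in> F" "b \<in> F" "c \<in> F" "d \<in> F" "l * bar S l * dt a b c d = 1"
  shows "iv (elt l a b c d) = elt (bar S l) d (-b) (-c) a"
proof -
  have "elt (bar S l) d (-b) (-c) a \<in> carrier (U S)"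
    using assms by (intro elt_in_U) (auto simp: dt_def algebra_simps)
  then show ?thesis
    using elt_inverse[OF assms(5)] elt_in_U[OF assms] G.inv_equality by auto
qed

lemma Kmax_elt:
  assumes "elt l a b c d \<in> carrier (U S)" "l \<noteq> 0" "nu S l = 0"
  shows "elt l a b c d \<in> Kmax S \<longleftrightarrow> a \<in> \<P> 0 \<and> b \<in> \<P> 0 \<and> c \<in> \<P> 0 \<and> d \<in> \<P> 0"
  using assms by (auto simp: Kmax_def forall_2 elt_def pE_mult_iff pE_rt)

lemma elt_nth [simp]: "elt l a b c d $ 1 $ 1 = l * a" "elt l a b c d $ 1 $ 2 = l * (b * rt)"
  "elt l a b c d $ 2 $ 1 = l * (c * rt)" "elt l a b c d $ 2 $ 2 = l * d"
  by (simp_all add: elt_def)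

text \<open>The inverse is the conjugate transpose, conjugated by the antidiagonal matrix. So
  inversion preserves bounds on the valuations of entries that treat the two diagonal places
  alike.\<close>

lemma iv_nth:
  assumes "g \<in> carrier (U S)"
  shows "iv g $ 1 $ 1 = bar S (g $ 2 $ 2)" "iv g $ 1 $ 2 = bar S (g $ 1 $ 2)"
    "iv g $ 2 $ 1 = bar S (g $ 2 $ 1)" "iv g $ 2 $ 2 = bar S (g $ 1 $ 1)"
proof -
  obtain l a b c d where x: "a \<in> F" "b \<in> F" "c \<in> F" "d \<in> F"
    "l * bar S l * dt a b c d = 1" "g = elt l a b c d"
    using elt_obtain[OF assms] by metis
  then show "iv g $ 1 $ 1 = bar S (g $ 2 $ 2)" "iv g $ 1 $ 2 = bar S (g $ 1 $ 2)"
    "iv g $ 2 $ 1 = bar S (g $ 2 $ 1)" "iv g $ 2 $ 2 = bar S (g $ 1 $ 1)"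
    by (simp_all add: iv_elt)
qed

end

section \<open>Congruence subgroups and Mackey's criterion\<close>

lemma matrix_add_rdistrib: "(A + B) ** C = A ** C + B ** (C :: 'a::semiring_1^'n^'n)"
  by (simp add: vec_eq_iff matrix_matrix_mult_def distrib_right sum.distrib)

lemma matrix_diff_ldistrib: "A ** (B - C) = A ** B - A ** (C :: 'a::ring_1^'n^'n)"
  by (simp add: vec_eq_iff matrix_matrix_mult_def right_diff_distrib sum_subtractf)

lemma matrix_diff_rdistrib: "(A - B) ** C = A ** C - B ** (C :: 'a::ring_1^'n^'n)"
  by (simp add: vec_eq_iff matrix_matrix_mult_def left_diff_distrib sum_subtractf)

lemma sum_fun_apply: "sum f A x = (\<Sum>a\<in>A. f a x)"
  by (induction A rule: infinite_finite_induct) auto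

lemma vector_space_fun_scale:
  assumes "vector_space sc"
  shows "vector_space (fun_scale sc :: complex \<Rightarrow> ('x \<Rightarrow> 'v) \<Rightarrow> 'x \<Rightarrow> 'v::ab_group_add)"
proof -
  interpret vector_space sc by fact
  show ?thesis
    by unfold_locales
      (auto simp: fun_scale_def scale_right_distrib scale_left_distrib fun_eq_iff)
qed

context unitary_setting
begin

definition MP :: "int \<Rightarrow> 'e mat2 set" where
  "MP n = {X. \<forall>i j. X $ i $ j \<in> \<P> n}"

text \<open>The principal congruence subgroup of level \<open>n\<close>. For
  \<open>n \<le> 0\<close> it is all of \<open>Kmax S\<close>, so that levels can be arbitrary
  integers.\<close>

definition Kc :: "int \<Rightarrow> 'e mat2 set" where
  "Kc n = {g \<in> Kmax S. g - mat 1 \<in> MP n}"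

lemma MP_mult: "X \<in> MP m \<Longrightarrow> Y \<in> MP n \<Longrightarrow> X ** Y \<in> MP (m + n)"
  by (simp add: MP_def forall_2 matrix_matrix_mult_def sum_2 pE_add pE_mult)

lemma MP_add: "X \<in> MP n \<Longrightarrow> Y \<in> MP n \<Longrightarrow> X + Y \<in> MP n"
  by (simp add: MP_def pE_add)

lemma MP_zero [simp]: "0 \<in> MP n"
  by (simp add: MP_def)

lemma MP_mono: "X \<in> MP n \<Longrightarrow> m \<le> n \<Longrightarrow> X \<in> MP m"
  unfolding MP_def using pE_mono by blast

lemma Kmax_iff: "g \<in> Kmax S \<longleftrightarrow> g \<in> carrier (U S) \<and> g \<in> MP 0"
  by (simp add: Kmax_def MP_def)

lemma Kmax_MP: "g \<in> Kmax S \<Longrightarrow> g \<in> MP 0"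
  by (simp add: Kmax_iff)

lemma Kmax_entry: "g \<in> Kmax S \<Longrightarrow> g $ i $ j \<in> \<P> 0"
  by (simp add: Kmax_def)

lemma Kmax_one [simp]: "mat 1 \<in> Kmax S"
  by (simp add: Kmax_iff) (simp add: MP_def forall_2 mat_1_mat2)

lemma Kmax_mult [simp]: "g \<in> Kmax S \<Longrightarrow> h \<in> Kmax S \<Longrightarrow> g ** h \<in> Kmax S"
  using MP_mult[of g 0 h 0] by (simp add: Kmax_iff)

lemma Kmax_iv [simp]: "g \<in> Kmax S \<Longrightarrow> iv g \<in> Kmax S"
  by (simp add: Kmax_iff MP_def forall_2 iv_nth)

lemma Kmax_U [simp]: "g \<in> Kmax S \<Longrightarrow> g \<in> carrier (U S)"
  by (simp add: Kmax_iff)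

lemma Kc_Kmax [intro]: "g \<in> Kc n \<Longrightarrow> g \<in> Kmax S"
  by (simp add: Kc_def)

lemma Kc_one [simp]: "mat 1 \<in> Kc n"
  by (simp add: Kc_def)

lemma Kc_mono: "g \<in> Kc n \<Longrightarrow> m \<le> n \<Longrightarrow> g \<in> Kc m"
  using MP_mono by (auto simp: Kc_def)

lemma Kc_conj:
  assumes "k \<in> Kc n" "x \<in> Kmax S"
  shows "x ** k ** iv x \<in> Kc n"
proof -
  have "x ** (k - mat 1) ** iv x \<in> MP (0 + n + 0)"
    using assms by (intro MP_mult) (auto simp: Kc_def Kmax_MP)
  moreover have "x ** (k - mat 1) ** iv x = x ** k ** iv x - mat 1"
    using assms by (simp add: matrix_diff_ldistrib matrix_diff_rdistrib)
  ultimately show ?thesis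
    using assms by (simp add: Kc_def)
qed

lemma Kc_quotient:
  assumes "x \<in> Kmax S" "y \<in> Kmax S" "x - y \<in> MP n"
  shows "x ** iv y \<in> Kc n" "iv y ** x \<in> Kc n"
proof -
  have "(x - y) ** iv y \<in> MP (n + 0)" "iv y ** (x - y) \<in> MP (0 + n)"
    using assms by (intro MP_mult; simp add: Kmax_MP)+
  then show "x ** iv y \<in> Kc n" "iv y ** x \<in> Kc n"
    using assms by (auto simp: Kc_def matrix_diff_rdistrib matrix_diff_ldistrib)
qed

lemma openin_mat_top: "openin (mat_top S) A \<longleftrightarrow> (\<forall>x\<in>A. \<exists>n. {z. z - x \<in> MP n} \<subseteq> A)"
  unfolding mat_top_def by (subst topology_inverse'[OF istopology_mat_top]) (simp add: MP_def)

lemma topspace_mat_top [simp]: "topspace (mat_top S) = UNIV"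
  using openin_subset[of "mat_top S" UNIV] by (auto simp: openin_mat_top)

text \<open>Balls of \<open>H\<close> alone suffice: the union of the corresponding balls of the
  whole matrix space is open, since every point of an ultrametric ball is a centre of it.\<close>

lemma openin_sub_iff:
  assumes "A \<subseteq> H"
  shows "openin (subtopology (mat_top S) H) A \<longleftrightarrow> (\<forall>a\<in>A. \<exists>n. \<forall>z\<in>H. z - a \<in> MP n \<longrightarrow> z \<in> A)"
proof
  assume "openin (subtopology (mat_top S) H) A"
  then obtain T where "openin (mat_top S) T" "A = T \<inter> H"
    by (auto simp: openin_subtopology)
  then show "\<forall>a\<in>A. \<exists>n. \<forall>z\<in>H. z - a \<in> MP n \<longrightarrow> z \<in> A"
    unfolding openin_mat_top by blast
next
  assume *: "\<forall>a\<in>A. \<exists>n. \<forall>z\<in>H. z - a \<in> MP n \<longrightarrow> z \<in> A"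
  define T where "T = {z. \<exists>a\<in>A. \<exists>n. (\<forall>z\<in>H. z - a \<in> MP n \<longrightarrow> z \<in> A) \<and> z - a \<in> MP n}"
  have "openin (mat_top S) T"
    unfolding openin_mat_top
  proof
    fix z assume "z \<in> T"
    then obtain a n where a: "a \<in> A" "\<forall>z\<in>H. z - a \<in> MP n \<longrightarrow> z \<in> A" "z - a \<in> MP n"
      by (auto simp: T_def)
    have "z' - a \<in> MP n" if "z' - z \<in> MP n" for z'
      using MP_add[OF that a(3)] by simp
    then show "\<exists>n. {x. x - z \<in> MP n} \<subseteq> T"
      using a unfolding T_def by blast
  qed
  moreover have "A = T \<inter> H"
  proof
    show "A \<subseteq> T \<inter> H"
    proof
      fix a assume a: "a \<in> A"
      then obtain n where "\<forall>z\<in>H. z - a \<in> MP n \<longrightarrow> z \<in> A"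
        using * by blast
      moreover have "a - a \<in> MP n" by simp
      ultimately show "a \<in> T \<inter> H"
        using a assms unfolding T_def by blast
    qed
  qed (auto simp: T_def)
  ultimately show "openin (subtopology (mat_top S) H) A"
    by (auto simp: openin_subtopology)
qed

lemma compactin_translate:
  assumes "compactin (mat_top S) C" "k \<in> Kmax S"
  shows "compactin (mat_top S) ((\<lambda>x. x ** k) ` C)"
proof (rule image_compactin[OF assms(1)])
  have "openin (mat_top S) {x. x ** k \<in> A}" if A: "openin (mat_top S) A" for A
    unfolding openin_mat_top
  proof
    fix x assume "x \<in> {x. x ** k \<in> A}"
    then obtain n where n: "{z. z - x ** k \<in> MP n} \<subseteq> A"
      using A by (auto simp: openin_mat_top)
    have "z ** k - x ** k \<in> MP n" if "z - x \<in> MP n" for z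
      using MP_mult[OF that, of k 0] assms(2) by (simp add: Kmax_MP matrix_diff_rdistrib)
    then show "\<exists>n. {z. z - x \<in> MP n} \<subseteq> {x. x ** k \<in> A}"
      using n by blast
  qed
  then show "continuous_map (mat_top S) (mat_top S) (\<lambda>x. x ** k)"
    by (auto simp: continuous_map_def)
qed

text \<open>Finite index of \<open>Kc n\<close>, phrased through a map with finite range whose
  fibres lie in single cosets. Both sides are recorded: the averaging compares
  \<open>iv y ** x\<close>, the coset decomposition compares \<open>x ** iv y\<close>.\<close>

lemma finite_Kmax_approx:
  "\<exists>ap :: 'e mat2 \<Rightarrow> 'e mat2. finite (ap ` Kmax S) \<and>
    (\<forall>x\<in>Kmax S. \<forall>y\<in>Kmax S. ap x = ap y \<longrightarrow> x ** iv y \<in> Kc n \<and> iv y ** x \<in> Kc n)"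
proof -
  obtain R where R: "finite R" "\<forall>x\<in>\<P> 0. \<exists>y\<in>R. x - y \<in> \<P> n"
    using finite_approx[of n] by (elim exE conjE)
  define q where "q x = (SOME y. y \<in> R \<and> x - y \<in> \<P> n)" for x
  have q: "q x \<in> R" "x - q x \<in> \<P> n" if "x \<in> \<P> 0" for x
    using someI_ex[of "\<lambda>y. y \<in> R \<and> x - y \<in> \<P> n"] bspec[OF R(2) that] unfolding q_def by blast+
  define ap where "ap X = mat2 (q (X $ 1 $ 1)) (q (X $ 1 $ 2)) (q (X $ 2 $ 1)) (q (X $ 2 $ 2))" for X :: "'e mat2"
  show ?thesis
  proof (intro exI[of _ ap] conjI ballI impI)
    have "ap ` Kmax S \<subseteq> (\<lambda>(a, b, c, d). mat2 a b c d) ` (R \<times> R \<times> R \<times> R)"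
    proof (rule image_subsetI)
      fix X assume X: "X \<in> Kmax S"
      show "ap X \<in> (\<lambda>(a, b, c, d). mat2 a b c d) ` (R \<times> R \<times> R \<times> R)"
        by (rule image_eqI[of _ _ "(q (X $ 1 $ 1), q (X $ 1 $ 2), q (X $ 2 $ 1), q (X $ 2 $ 2))"])
          (simp_all add: ap_def q Kmax_entry[OF X])
    qed
    then show "finite (ap ` Kmax S)"
      by (rule finite_subset) (simp add: R)
  next
    fix x y assume xy: "x \<in> Kmax S" "y \<in> Kmax S" "ap x = ap y"
    have "x $ i $ j - y $ i $ j \<in> \<P> n" for i j
    proof -
      have e: "q (x $ i $ j) = q (y $ i $ j)"
        using xy(3) exhaust_2[of i] exhaust_2[of j] by (auto simp: ap_def mat2_eq_iff)
      have "x $ i $ j \<in> \<P> 0" "y $ i $ j \<in> \<P> 0"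
        using xy by (auto simp: Kmax_entry)
      from pE_diff[OF q(2)[OF this(1)] q(2)[OF this(2)]] show ?thesis
        by (simp add: e)
    qed
    then have "x - y \<in> MP n"
      by (simp add: MP_def)
    from Kc_quotient[OF xy(1,2) this] show "x ** iv y \<in> Kc n" "iv y ** x \<in> Kc n"
      by simp_all
  qed
qed

end

text \<open>\<open>separated\<close> is the disjointness half of Mackey's criterion: an operator
  intertwining \<sigma> with its conjugate by \<open>x\<close> would have to carry one scalar into a
  different one, so it vanishes. \<open>H_open\<close> makes the index of \<open>H\<close> in
  \<open>Kmax S\<close> finite.\<close>

locale mackey_setting = unitary_setting S
  for S :: "'e::field u11_data" +
  fixes H :: "'e mat2 set" and sc :: "complex \<Rightarrow> 'v \<Rightarrow> 'v::ab_group_add" and W :: "'v set"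
    and \<sigma> :: "'e mat2 \<Rightarrow> 'v \<Rightarrow> 'v" and N :: int
  assumes H_Kmax: "H \<subseteq> Kmax S"
    and H_mult: "x \<in> H \<Longrightarrow> y \<in> H \<Longrightarrow> x ** y \<in> H"
    and H_iv: "x \<in> H \<Longrightarrow> iv x \<in> H"
    and H_open: "Kc N \<subseteq> H"
    and rep: "lin_rep sc ((U S)\<lparr>carrier := H\<rparr>) W \<sigma>"
    and smooth: "w \<in> W \<Longrightarrow> \<exists>n. \<forall>h\<in>Kc n \<inter> H. \<sigma> h w = w"
    and W_nonzero: "W \<noteq> {0}"
    and irreducible: "module.subspace sc W' \<Longrightarrow> W' \<subseteq> W \<Longrightarrow> (\<And>h v. h \<in> H \<Longrightarrow> v \<in> W' \<Longrightarrow> \<sigma> h v \<in> W')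
        \<Longrightarrow> W' = {0} \<or> W' = W"
    and separated: "x \<in> Kmax S \<Longrightarrow> x \<notin> H \<Longrightarrow> \<exists>n\<in>H. x ** n ** iv x \<in> H \<and>
        (\<exists>c c'. c \<noteq> c' \<and> (\<forall>w\<in>W. \<sigma> n w = sc c w) \<and> (\<forall>w\<in>W. \<sigma> (x ** n ** iv x) w = sc c' w))"
begin

sublocale V: vector_space sc
  using rep by (simp add: lin_rep_def)

sublocale FV: vector_space "fun_scale sc :: complex \<Rightarrow> ('e mat2 \<Rightarrow> 'v) \<Rightarrow> 'e mat2 \<Rightarrow> 'v"
  by (rule vector_space_fun_scale) unfold_locales

lemma H_U [simp]: "x \<in> H \<Longrightarrow> x \<in> carrier (U S)" and H_K [simp]: "x \<in> H \<Longrightarrow> x \<in> Kmax S"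
  using H_Kmax by auto

lemma H_one [simp]: "mat 1 \<in> H"
  using H_open Kc_one by blast

lemma W_sub: "V.subspace W"
  using rep by (simp add: lin_rep_def)

lemma W_closed [simp]: "0 \<in> W" "v \<in> W \<Longrightarrow> w \<in> W \<Longrightarrow> v + w \<in> W" "v \<in> W \<Longrightarrow> sc c v \<in> W"
  using W_sub by (auto simp: V.subspace_def)

lemma rep_closed [simp]: "h \<in> H \<Longrightarrow> v \<in> W \<Longrightarrow> \<sigma> h v \<in> W"
  and rep_add: "h \<in> H \<Longrightarrow> v \<in> W \<Longrightarrow> w \<in> W \<Longrightarrow> \<sigma> h (v + w) = \<sigma> h v + \<sigma> h w"
  and rep_scale: "h \<in> H \<Longrightarrow> v \<in> W \<Longrightarrow> \<sigma> h (sc c v) = sc c (\<sigma> h v)"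
  and rep_one [simp]: "v \<in> W \<Longrightarrow> \<sigma> (mat 1) v = v"
  and rep_mult: "g \<in> H \<Longrightarrow> h \<in> H \<Longrightarrow> v \<in> W \<Longrightarrow> \<sigma> (g ** h) v = \<sigma> g (\<sigma> h v)"
  using rep by (auto simp: lin_rep_def)

lemma rep_zero [simp]: "h \<in> H \<Longrightarrow> \<sigma> h 0 = 0"
  using rep_scale[of h 0 0] by simp

lemma H_mult_iff [simp]: "h \<in> H \<Longrightarrow> x ** h \<in> H \<longleftrightarrow> x \<in> H"
  using H_mult[of "x ** h" "iv h"] H_mult[of x h] by (auto simp: H_iv)

lemma Kmax_mult_iff [simp]: "k \<in> Kmax S \<Longrightarrow> x ** k \<in> Kmax S \<longleftrightarrow> x \<in> Kmax S"
  using Kmax_mult[of "x ** k" "iv k"] Kmax_mult[of x k] by auto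

section \<open>The induced space as a representation of \<open>Kmax S\<close>\<close>

abbreviation "I \<equiv> cInd_space S (Kmax S) H W \<sigma>"

text \<open>The set is a subgroup of \<open>Kmax S\<close>, so it is open as soon as it contains a
  neighbourhood of the identity.\<close>

lemma open_stabilizer_iff:
  "openin (subtopology (mat_top S) (Kmax S)) {k \<in> Kmax S. \<forall>x\<in>Kmax S. f (x ** k) = f x}
    \<longleftrightarrow> (\<exists>n. \<forall>k\<in>Kc n. \<forall>x\<in>Kmax S. f (x ** k) = f x)" (is "openin _ ?A \<longleftrightarrow> ?R")
proof -
  have "openin (subtopology (mat_top S) (Kmax S)) ?A \<longleftrightarrow>
    (\<forall>a\<in>?A. \<exists>n. \<forall>z\<in>Kmax S. z - a \<in> MP n \<longrightarrow> z \<in> ?A)"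
    by (rule openin_sub_iff) auto
  also have "\<dots> \<longleftrightarrow> ?R"
  proof
    assume "\<forall>a\<in>?A. \<exists>n. \<forall>z\<in>Kmax S. z - a \<in> MP n \<longrightarrow> z \<in> ?A"
    then obtain n where "\<forall>z\<in>Kmax S. z - mat 1 \<in> MP n \<longrightarrow> z \<in> ?A"
      by (force dest: bspec[of _ _ "mat 1"])
    then show ?R
      by (auto simp: Kc_def)
  next
    assume ?R
    then obtain n where n: "\<And>k x. k \<in> Kc n \<Longrightarrow> x \<in> Kmax S \<Longrightarrow> f (x ** k) = f x" by blast
    have "z \<in> ?A" if a: "a \<in> ?A" and z: "z \<in> Kmax S" "z - a \<in> MP n" for a z
    proof -
      have "f (x ** z) = f x" if x: "x \<in> Kmax S" for x
      proof -
        have "iv a ** z \<in> Kc n"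
          using a z by (intro Kc_quotient) auto
        then have "f ((x ** a) ** (iv a ** z)) = f (x ** a)"
          using x a by (intro n) auto
        then show ?thesis
          using x a by (simp add: matrix_mul_assoc)
      qed
      then show ?thesis using z by simp
    qed
    then show "\<forall>a\<in>?A. \<exists>n. \<forall>z\<in>Kmax S. z - a \<in> MP n \<longrightarrow> z \<in> ?A"
      by blast
  qed
  finally show ?thesis .
qed

lemma I_iff: "f \<in> I \<longleftrightarrow>
     (\<forall>x. x \<notin> Kmax S \<longrightarrow> f x = 0) \<and> (\<forall>x\<in>Kmax S. f x \<in> W) \<and>
     (\<forall>h\<in>H. \<forall>x\<in>Kmax S. f (h ** x) = \<sigma> h (f x)) \<and>
     (\<exists>n. \<forall>k\<in>Kc n. \<forall>x\<in>Kmax S. f (x ** k) = f x) \<and>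
     (\<exists>C\<subseteq>Kmax S. compactin (mat_top S) C \<and> {x. f x \<noteq> 0} \<subseteq> H <#>\<^bsub>U S\<^esub> C)"
  using open_stabilizer_iff[of f] by (auto simp: cInd_space_def)

lemma subspace_I: "FV.subspace I"
  unfolding FV.subspace_def
proof (intro conjI ballI allI)
  show "0 \<in> I"
    unfolding I_iff by (auto intro!: exI[of _ "{}"])
next
  fix f g assume fg: "f \<in> I" "g \<in> I"
  obtain n where n: "\<And>k x. k \<in> Kc n \<Longrightarrow> x \<in> Kmax S \<Longrightarrow> f (x ** k) = f x"
    using fg(1) unfolding I_iff by blast
  obtain m where m: "\<And>k x. k \<in> Kc m \<Longrightarrow> x \<in> Kmax S \<Longrightarrow> g (x ** k) = g x"
    using fg(2) unfolding I_iff by blast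
  obtain C where C: "C \<subseteq> Kmax S" "compactin (mat_top S) C" "{x. f x \<noteq> 0} \<subseteq> H <#>\<^bsub>U S\<^esub> C"
    using fg(1) unfolding I_iff by blast
  obtain D where D: "D \<subseteq> Kmax S" "compactin (mat_top S) D" "{x. g x \<noteq> 0} \<subseteq> H <#>\<^bsub>U S\<^esub> D"
    using fg(2) unfolding I_iff by blast
  have "{x. (f + g) x \<noteq> 0} \<subseteq> {x. f x \<noteq> 0} \<union> {x. g x \<noteq> 0}"
    by auto
  also have "\<dots> \<subseteq> H <#>\<^bsub>U S\<^esub> (C \<union> D)"
    using C(3) D(3) unfolding set_mult_def by blast
  finally have "\<exists>C\<subseteq>Kmax S. compactin (mat_top S) C \<and> {x. (f + g) x \<noteq> 0} \<subseteq> H <#>\<^bsub>U S\<^esub> C"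
    using C(1,2) D(1,2) by (intro exI[of _ "C \<union> D"]) (auto intro: compactin_Un)
  moreover have "\<exists>n. \<forall>k\<in>Kc n. \<forall>x\<in>Kmax S. (f + g) (x ** k) = (f + g) x"
    using n m Kc_mono[of _ "max n m"] by (intro exI[of _ "max n m"]) auto
  ultimately show "f + g \<in> I"
    using fg unfolding I_iff by (auto simp: rep_add)
next
  fix c f assume f: "f \<in> I"
  obtain n where n: "\<And>k x. k \<in> Kc n \<Longrightarrow> x \<in> Kmax S \<Longrightarrow> f (x ** k) = f x"
    using f unfolding I_iff by blast
  have "{x. fun_scale sc c f x \<noteq> 0} \<subseteq> {x. f x \<noteq> 0}"
    by (auto simp: fun_scale_def)
  then have "\<exists>C\<subseteq>Kmax S. compactin (mat_top S) C \<and> {x. fun_scale sc c f x \<noteq> 0} \<subseteq> H <#>\<^bsub>U S\<^esub> C"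
    using f unfolding I_iff by blast
  moreover have "\<exists>n. \<forall>k\<in>Kc n. \<forall>x\<in>Kmax S. fun_scale sc c f (x ** k) = fun_scale sc c f x"
    using n by (intro exI[of _ n]) (auto simp: fun_scale_def)
  ultimately show "fun_scale sc c f \<in> I"
    using f unfolding I_iff by (auto simp: rep_scale fun_scale_def)
qed

lemma I_transl:
  assumes f: "f \<in> I" and k: "k \<in> Kmax S"
  shows "right_transl k f \<in> I"
proof -
  obtain n where n: "\<And>k x. k \<in> Kc n \<Longrightarrow> x \<in> Kmax S \<Longrightarrow> f (x ** k) = f x"
    using f unfolding I_iff by blast
  obtain C where C: "C \<subseteq> Kmax S" "compactin (mat_top S) C" "{x. f x \<noteq> 0} \<subseteq> H <#>\<^bsub>U S\<^esub> C"
    using f unfolding I_iff by blast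
  have "f (x ** k' ** k) = f (x ** k)" if "k' \<in> Kc n" "x \<in> Kmax S" for k' x
  proof -
    have "iv k ** k' ** iv (iv k) \<in> Kc n"
      using that k by (intro Kc_conj) auto
    then have "f ((x ** k) ** (iv k ** k' ** k)) = f (x ** k)"
      using that k by (intro n) auto
    then show ?thesis
      using that k by (simp add: matrix_mul_assoc)
  qed
  then have 1: "\<exists>n. \<forall>k'\<in>Kc n. \<forall>x\<in>Kmax S. right_transl k f (x ** k') = right_transl k f x"
    unfolding right_transl_def by blast
  have "{x. right_transl k f x \<noteq> 0} \<subseteq> H <#>\<^bsub>U S\<^esub> ((\<lambda>x. x ** iv k) ` C)"
  proof
    fix x assume "x \<in> {x. right_transl k f x \<noteq> 0}"
    then obtain h c where "h \<in> H" "c \<in> C" "x ** k = h ** c"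
      using C(3) by (auto simp: right_transl_def set_mult_def)
    moreover from this have "x = h ** (c ** iv k)"
      using k by (metis iv_cancel(2) matrix_mul_assoc Kmax_U)
    ultimately show "x \<in> H <#>\<^bsub>U S\<^esub> ((\<lambda>x. x ** iv k) ` C)"
      by (auto simp: set_mult_def)
  qed
  moreover have "compactin (mat_top S) ((\<lambda>x. x ** iv k) ` C)"
    using C k by (intro compactin_translate) auto
  moreover have "(\<lambda>x. x ** iv k) ` C \<subseteq> Kmax S"
    using C k by auto
  ultimately have 2: "\<exists>C\<subseteq>Kmax S. compactin (mat_top S) C \<and> {x. right_transl k f x \<noteq> 0} \<subseteq> H <#>\<^bsub>U S\<^esub> C"
    by blast
  have 3: "right_transl k f x = 0" if "x \<notin> Kmax S" for x
    using f k that unfolding I_iff by (auto simp: right_transl_def)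
  have 4: "right_transl k f x \<in> W" if "x \<in> Kmax S" for x
    using f k that unfolding I_iff by (auto simp: right_transl_def)
  have 5: "right_transl k f (h ** x) = \<sigma> h (right_transl k f x)" if "x \<in> Kmax S" "h \<in> H" for x h
    using f k that unfolding I_iff by (auto simp: right_transl_def matrix_mul_assoc[symmetric])
  show ?thesis
    unfolding I_iff using 1 2 3 4 5 by blast
qed

text \<open>The embedding of \<open>W\<close> into the induced space by functions supported on
  \<open>H\<close>; evaluation at the identity recovers \<open>w\<close>.\<close>

definition bump :: "'v \<Rightarrow> 'e mat2 \<Rightarrow> 'v" where
  "bump w = (\<lambda>x. if x \<in> H then \<sigma> x w else 0)"

lemma bump_in_I:
  assumes "w \<in> W"
  shows "bump w \<in> I"
proof -
  obtain n where n: "\<forall>h\<in>Kc n \<inter> H. \<sigma> h w = w"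
    using smooth assms by blast
  \<comment> \<open>Level \<open>N\<close> keeps \<open>k\<close> inside \<open>H\<close>, level
    \<open>n\<close> makes it fix \<open>w\<close>.\<close>
  have "bump w (x ** k) = bump w x" if "k \<in> Kc (max n N)" for k x
  proof -
    have "k \<in> H" "k \<in> Kc n"
      using that H_open Kc_mono[of k "max n N"] by auto
    then show ?thesis
      using n assms by (auto simp: bump_def rep_mult)
  qed
  then have 1: "\<exists>n. \<forall>k\<in>Kc n. \<forall>x\<in>Kmax S. bump w (x ** k) = bump w x"
    by blast
  have "{x. bump w x \<noteq> 0} \<subseteq> H <#>\<^bsub>U S\<^esub> {mat 1}"
    by (auto simp: bump_def set_mult_def)
  then have 2: "\<exists>C\<subseteq>Kmax S. compactin (mat_top S) C \<and> {x. bump w x \<noteq> 0} \<subseteq> H <#>\<^bsub>U S\<^esub> C"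
    by (intro exI[of _ "{mat 1}"]) auto
  have 3: "bump w (h ** x) = \<sigma> h (bump w x)" if "h \<in> H" "x \<in> Kmax S" for h x
  proof -
    have "h ** x \<in> H \<longleftrightarrow> x \<in> H"
      using that H_mult[of h x] H_mult[of "iv h" "h ** x"] by (auto simp: H_iv matrix_mul_assoc)
    then show ?thesis
      using that assms by (auto simp: bump_def rep_mult)
  qed
  show ?thesis
    unfolding I_iff using 1 2 3 assms by (auto simp: bump_def)
qed

lemma I_H: "f \<in> I \<Longrightarrow> h \<in> H \<Longrightarrow> f h = \<sigma> h (f (mat 1))"
  unfolding I_iff by (metis Kmax_one matrix_mul_rid)

lemma scalar_nonzero:
  assumes "n \<in> H" "\<forall>w\<in>W. \<sigma> n w = sc c w"
  shows "c \<noteq> 0"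
proof
  assume "c = 0"
  obtain w where w: "w \<in> W" "w \<noteq> 0"
    using W_nonzero W_closed(1) by blast
  have "\<sigma> (iv n ** n) w = \<sigma> (iv n) (\<sigma> n w)"
    using assms w by (intro rep_mult) (auto simp: H_iv)
  then show False
    using assms w \<open>c = 0\<close> by (simp add: H_iv)
qed

text \<open>
  The sum over the finite orbit of \<open>f\<close> under the elements of \<open>H\<close> acting by scalars on \<open>W\<close>, each
  translate being divided by the scalar, projects \<open>f\<close> onto the functions supported on \<open>H\<close>.
\<close>

lemma bump_in_invariant:
  assumes W': "FV.subspace W'" "W' \<subseteq> I" "\<And>k v. k \<in> Kmax S \<Longrightarrow> v \<in> W' \<Longrightarrow> right_transl k v \<in> W'"
    and f: "f \<in> W'"
  shows "bump (f (mat 1)) \<in> W'"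
proof -
  have fI: "f \<in> I" using f W'(2) by blast
  define Z where "Z = {(n, c). n \<in> H \<and> (\<forall>w\<in>W. \<sigma> n w = sc c w)}"
  have Zm: "(n ** n', c * c') \<in> Z" if "(n, c) \<in> Z" "(n', c') \<in> Z" for n n' c c'
    using that by (auto simp: Z_def H_mult rep_mult)
  have Z0: "c \<noteq> 0" if "(n, c) \<in> Z" for n c
    using that scalar_nonzero by (auto simp: Z_def)
  define G where "G = (\<lambda>(n, c). fun_scale sc (inverse c) (right_transl n f))"
  define Orb where "Orb = G ` Z"
  have G: "G (n, c) x = sc (inverse c) (f (x ** n))" for n c x
    by (simp add: G_def fun_scale_def right_transl_def)
  \<comment> \<open>A nonzero vector reads the scalar off the operator, so elements of
    \<open>Z\<close> that differ by a small factor carry the same scalar.\<close>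
  obtain w0 where w0: "w0 \<in> W" "w0 \<noteq> 0"
    using W_nonzero W_closed(1) by blast
  obtain m1 where m1: "\<And>h. h \<in> Kc m1 \<Longrightarrow> h \<in> H \<Longrightarrow> \<sigma> h w0 = w0"
    using smooth[OF w0(1)] by blast
  obtain m2 where m2: "\<And>k x. k \<in> Kc m2 \<Longrightarrow> x \<in> Kmax S \<Longrightarrow> f (x ** k) = f x"
    using fI unfolding I_iff by blast
  obtain ap :: "'e mat2 \<Rightarrow> 'e mat2" where ap: "finite (ap ` Kmax S)"
    "\<forall>x\<in>Kmax S. \<forall>y\<in>Kmax S. ap x = ap y \<longrightarrow>
        x ** iv y \<in> Kc (max m1 m2) \<and> iv y ** x \<in> Kc (max m1 m2)"
    using finite_Kmax_approx[of "max m1 m2"] by (elim exE conjE)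
  \<comment> \<open>The scaled translate depends only on the class of \<open>n\<close> modulo a
    congruence subgroup that fixes \<open>f\<close> and whose elements in \<open>H\<close> fix
    \<open>w0\<close>. So the orbit is finite even where \<open>Z\<close> is not.\<close>
  have Geq: "G (n, c) = G (n', c')" if Z: "(n, c) \<in> Z" "(n', c') \<in> Z" "ap n = ap n'" for n c n' c'
  proof -
    have H: "n \<in> H" "n' \<in> H" using Z by (auto simp: Z_def)
    define k where "k = iv n ** n'"
    have "k \<in> Kc (max m1 m2)"
      unfolding k_def using H Z(3) by (intro ap(2)[rule_format, THEN conjunct2]) auto
    then have k: "k \<in> Kc m1" "k \<in> Kc m2" "k \<in> H"
      using Kc_mono H by (auto simp: k_def H_mult H_iv)
    have n': "n' = n ** k"
      using H by (simp add: k_def matrix_mul_assoc)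
    have "sc c' w0 = \<sigma> n' w0"
      using Z w0 by (auto simp: Z_def)
    also have "\<dots> = \<sigma> n (\<sigma> k w0)"
      unfolding n' using H k w0 by (intro rep_mult) auto
    also have "\<dots> = sc c w0"
      using m1 k Z w0 by (auto simp: Z_def)
    finally have "c = c'"
      using w0 by simp
    moreover have "f (x ** n') = f (x ** n)" for x
    proof (cases "x \<in> Kmax S")
      case True
      then show ?thesis
        unfolding n' matrix_mul_assoc using H k by (intro m2) auto
    next
      case False
      then show ?thesis
        using fI H unfolding I_iff by simp
    qed
    ultimately show ?thesis
      by (auto simp: G fun_eq_iff)
  qed
  have "finite Orb"
  proof -
    have "Orb \<subseteq> (\<lambda>q. G (SOME z. z \<in> Z \<and> ap (fst z) = q)) ` (ap ` Kmax S)"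
    proof
      fix g assume "g \<in> Orb"
      then obtain n c where nc: "(n, c) \<in> Z" "g = G (n, c)" by (auto simp: Orb_def)
      let ?z = "SOME z. z \<in> Z \<and> ap (fst z) = ap n"
      have "?z \<in> Z \<and> ap (fst ?z) = ap n"
        by (rule someI[of _ "(n, c)"]) (use nc in auto)
      then have "G ?z = g"
        using Geq[of "fst ?z" "snd ?z" n c] nc by auto
      moreover have "n \<in> Kmax S" using nc by (auto simp: Z_def)
      ultimately show "g \<in> (\<lambda>q. G (SOME z. z \<in> Z \<and> ap (fst z) = q)) ` (ap ` Kmax S)"
        by force
    qed
    then show ?thesis
      using ap(1) finite_surj by blast
  qed
  have "(mat 1, 1) \<in> Z"
    by (auto simp: Z_def)
  then have Orb_ne: "card Orb \<noteq> 0"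
    using \<open>finite Orb\<close> by (auto simp: Orb_def)
  define E where "E = sum (\<lambda>g. g) Orb"
  have OW: "g \<in> W'" if "g \<in> Orb" for g
    using that f W'(3) FV.subspace_scale[OF W'(1)] by (auto simp: Orb_def G_def Z_def)
  have EW: "E \<in> W'"
    unfolding E_def using OW by (intro FV.subspace_sum W')
  then have EI: "E \<in> I" using W'(2) by blast
  have fH: "f (mat 1) \<in> W" using fI unfolding I_iff by simp
  \<comment> \<open>On \<open>H\<close> every member of the orbit agrees with
    \<open>bump (f (mat 1))\<close>: the scalar by which \<open>n\<close> acts is cancelled by the
    division.\<close>
  have EH: "E x = sc (of_nat (card Orb)) (\<sigma> x (f (mat 1)))" if x: "x \<in> H" for x
  proof -
    have "g x = \<sigma> x (f (mat 1))" if g: "g \<in> Orb" for g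
    proof -
      obtain n c where nc: "(n, c) \<in> Z" "g = G (n, c)"
        using g unfolding Orb_def by (metis imageE surj_pair)
      then have "f (x ** n) = \<sigma> x (\<sigma> n (f (mat 1)))"
        using x fH by (subst I_H[OF fI]) (auto simp: Z_def H_mult rep_mult)
      also have "\<dots> = sc c (\<sigma> x (f (mat 1)))"
        using nc x fH by (auto simp: Z_def rep_scale)
      finally show ?thesis
        using Z0[OF nc(1)] by (simp add: nc(2) G)
    qed
    then have "E x = (\<Sum>g\<in>Orb. \<sigma> x (f (mat 1)))"
      by (simp add: E_def sum_fun_apply)
    then show ?thesis
      by (simp add: V.sum_constant_scale)
  qed
  \<comment> \<open>Translation by \<open>n\<close> permutes the orbit up to the factor
    \<open>c\<close>; reading \<open>x ** n\<close> as \<open>(x ** n ** iv x) ** x\<close> gives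
    the factor \<open>c'\<close> instead. Hence the value vanishes.\<close>
  have E0: "E x = 0" if x: "x \<in> Kmax S" "x \<notin> H" for x
  proof -
    obtain n c c' where n: "n \<in> H" "x ** n ** iv x \<in> H" "c \<noteq> c'"
      "\<forall>w\<in>W. \<sigma> n w = sc c w" "\<forall>w\<in>W. \<sigma> (x ** n ** iv x) w = sc c' w"
      using separated[OF x] by blast
    have nZ: "(n, c) \<in> Z" using n by (simp add: Z_def)
    define T where "T g = fun_scale sc (inverse c) (right_transl n g)" for g
    have "T g \<in> Orb" if g: "g \<in> Orb" for g
    proof -
      obtain n' c' where nc: "(n', c') \<in> Z" "g = G (n', c')"
        using g unfolding Orb_def by (metis imageE surj_pair)
      have "T g = G (n ** n', c * c')"
        by (auto simp: T_def nc(2) fun_eq_iff G fun_scale_def right_transl_def matrix_mul_assoc)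
      then show ?thesis
        using Zm[OF nZ nc(1)] by (simp add: Orb_def)
    qed
    moreover have "inj_on T Orb"
    proof (rule inj_onI)
      fix g g' assume "T g = T g'"
      then have "T g (x ** iv n) = T g' (x ** iv n)" for x by simp
      then show "g = g'"
        using n Z0[OF nZ] by (auto simp: T_def fun_eq_iff fun_scale_def right_transl_def)
    qed
    ultimately have "T ` Orb = Orb"
      using \<open>finite Orb\<close> by (intro endo_inj_surj) auto
    then have "E x = (\<Sum>g\<in>Orb. T g x)"
      using sum.reindex[OF \<open>inj_on T Orb\<close>, of "\<lambda>g. g x"] by (simp add: E_def sum_fun_apply)
    also have "\<dots> = sc (inverse c) (E (x ** n))"
      by (simp add: E_def sum_fun_apply T_def fun_scale_def right_transl_def V.scale_sum_right)
    finally have "E (x ** n) = sc c (E x)"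
      using Z0[OF nZ] by simp
    moreover have "E ((x ** n ** iv x) ** x) = \<sigma> (x ** n ** iv x) (E x)"
      using EI n x unfolding I_iff by blast
    then have "E (x ** n) = sc c' (E x)"
      using EI n x unfolding I_iff by simp
    ultimately show ?thesis
      using \<open>c \<noteq> c'\<close> by simp
  qed
  have "bump (f (mat 1)) = fun_scale sc (inverse (of_nat (card Orb))) E"
  proof
    fix x
    show "bump (f (mat 1)) x = fun_scale sc (inverse (of_nat (card Orb))) E x"
    proof (cases "x \<in> H")
      case True
      then show ?thesis
        using Orb_ne EH[OF True] by (simp add: bump_def fun_scale_def)
    next
      case False
      then have "E x = 0"
        using E0 EI unfolding I_iff by blast
      then show ?thesis
        using False by (simp add: bump_def fun_scale_def)
    qed
  qed
  then show ?thesis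
    using FV.subspace_scale[OF W'(1) EW] by simp
qed

text \<open>\<open>Kmax S\<close> is a finite union of cosets \<open>H d\<close>, and the
  restriction of \<open>f\<close> to such a coset is a translate of \<open>bump (f d)\<close>.
  \<open>cut D\<close> is the restriction of \<open>f\<close> to the cosets met by
  \<open>D\<close>.\<close>

lemma bumps_generate:
  assumes W': "FV.subspace W'" "\<And>k v. k \<in> Kmax S \<Longrightarrow> v \<in> W' \<Longrightarrow> right_transl k v \<in> W'"
    and bumps: "\<And>w. w \<in> W \<Longrightarrow> bump w \<in> W'" and f: "f \<in> I"
  shows "f \<in> W'"
proof -
  define cut where "cut D = (\<lambda>x. if \<exists>d\<in>D. x ** iv d \<in> H then f x else 0)" for D
  have cutW: "cut D \<in> W'" if "finite D" "D \<subseteq> Kmax S" for D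
    using that
  proof (induction D)
    case empty
    then show ?case
      using FV.subspace_0[OF W'(1)] by (simp add: cut_def zero_fun_def)
  next
    case (insert d D)
    then have d: "d \<in> Kmax S" and IH: "cut D \<in> W'" by auto
    show ?case
    proof (cases "\<exists>e\<in>D. d ** iv e \<in> H")
      case True
      then obtain e where e: "e \<in> D" "d ** iv e \<in> H" by blast
      have "x ** iv e \<in> H" if "x ** iv d \<in> H" for x
        using H_mult[OF that e(2)] d by (simp add: matrix_mul_assoc)
      then have "cut (insert d D) = cut D"
        using e by (auto simp: cut_def fun_eq_iff)
      then show ?thesis using IH by simp
    next
      case False
      have fd: "f d \<in> W" using f d unfolding I_iff by blast
      have eq: "cut (insert d D) = cut D + right_transl (iv d) (bump (f d))"
      proof
        fix x
        show "cut (insert d D) x = (cut D + right_transl (iv d) (bump (f d))) x"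
        proof (cases "x ** iv d \<in> H")
          case True
          have "x ** iv e \<notin> H" if "e \<in> D" for e
          proof
            assume "x ** iv e \<in> H"
            then have "iv (x ** iv d) ** (x ** iv e) \<in> H"
              using True H_mult H_iv by blast
            moreover have "x \<in> carrier (U S)"
              using True d by (metis H_U U_mult iv_cancel(1) Kmax_U)
            then have "iv (x ** iv d) ** (x ** iv e) = d ** iv e"
              using d by (simp add: iv_mult matrix_mul_assoc)
            ultimately show False
              using False that by simp
          qed
          moreover have "f x = \<sigma> (x ** iv d) (f d)"
          proof -
            have "f ((x ** iv d) ** d) = \<sigma> (x ** iv d) (f d)"
              using f True d unfolding I_iff by blast
            then show ?thesis using d by simp
          qed
          ultimately show ?thesis
            using True by (auto simp: cut_def right_transl_def bump_def)
        next
          case False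
          then show ?thesis
            by (auto simp: cut_def right_transl_def bump_def)
        qed
      qed
      moreover have "right_transl (iv d) (bump (f d)) \<in> W'"
        using d fd by (intro W' bumps) auto
      ultimately show ?thesis
        unfolding eq using FV.subspace_add[OF W'(1) IH] by blast
    qed
  qed
  obtain ap :: "'e mat2 \<Rightarrow> 'e mat2" where ap: "finite (ap ` Kmax S)"
    "\<forall>x\<in>Kmax S. \<forall>y\<in>Kmax S. ap x = ap y \<longrightarrow> x ** iv y \<in> Kc N \<and> iv y ** x \<in> Kc N"
    using finite_Kmax_approx[of N] by (elim exE conjE)
  define rep where "rep q = (SOME x. x \<in> Kmax S \<and> ap x = q)" for q
  have rep: "rep (ap x) \<in> Kmax S" "ap (rep (ap x)) = ap x" if "x \<in> Kmax S" for x
    using someI[of "\<lambda>y. y \<in> Kmax S \<and> ap y = ap x" x] that by (auto simp: rep_def)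
  have "cut (rep ` ap ` Kmax S) = f"
  proof
    fix x
    show "cut (rep ` ap ` Kmax S) x = f x"
    proof (cases "x \<in> Kmax S")
      case True
      then have "x ** iv (rep (ap x)) \<in> H"
        using ap(2)[rule_format, of x "rep (ap x)"] rep[OF True] H_open by auto
      then show ?thesis
        using True by (auto simp: cut_def)
    next
      case False
      then have "f x = 0" using f unfolding I_iff by blast
      then show ?thesis by (simp add: cut_def)
    qed
  qed
  moreover have "cut (rep ` ap ` Kmax S) \<in> W'"
    using ap(1) rep by (intro cutW) auto
  ultimately show ?thesis by simp
qed

text \<open>For an invariant subspace, the vectors whose bump lies in it form an invariant subspace
  of \<open>W\<close>. Translating a nonzero function so that it does not vanish at the identity,
  and then projecting, shows that this space is nonzero. So it is all of \<open>W\<close>, and the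
  bumps generate.\<close>

theorem irreducible_cInd: "irreducible_rep S (fun_scale sc) (Kmax S) I right_transl"
  unfolding irreducible_rep_def smooth_rep_def
proof (intro conjI allI impI ballI)
  show "lin_rep (fun_scale sc) ((U S)\<lparr>carrier := Kmax S\<rparr>) I right_transl"
    unfolding lin_rep_def
    using subspace_I I_transl FV.vector_space_axioms
    by (auto simp: right_transl_def fun_eq_iff fun_scale_def matrix_mul_assoc)
next
  fix f assume f: "f \<in> I"
  obtain n where n: "\<And>k x. k \<in> Kc n \<Longrightarrow> x \<in> Kmax S \<Longrightarrow> f (x ** k) = f x"
    using f unfolding I_iff by blast
  have "{h \<in> Kmax S. right_transl h f = f} = {k \<in> Kmax S. \<forall>x\<in>Kmax S. f (x ** k) = f x}"
  proof -
    have "f (x ** k) = f x" if "k \<in> Kmax S" "x \<notin> Kmax S" for x k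
      using f that unfolding I_iff by simp
    then show ?thesis
      by (auto simp: right_transl_def fun_eq_iff)
  qed
  then show "openin (subtopology (mat_top S) (Kmax S)) {h \<in> Kmax S. right_transl h f = f}"
    using f by (simp add: cInd_space_def)
next
  obtain w where w: "w \<in> W" "w \<noteq> 0"
    using W_nonzero W_closed(1) by blast
  have "bump w (mat 1) \<noteq> 0"
    using w by (simp add: bump_def)
  then show "I \<noteq> {0}"
    using bump_in_I[OF w(1)] by (metis singletonD zero_fun_apply)
next
  fix W'
  assume *: "FV.subspace W' \<and> W' \<subseteq> I \<and> (\<forall>h\<in>Kmax S. \<forall>v\<in>W'. right_transl h v \<in> W')"
  then have W': "FV.subspace W'" "W' \<subseteq> I" "\<And>k v. k \<in> Kmax S \<Longrightarrow> v \<in> W' \<Longrightarrow> right_transl k v \<in> W'"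
    by auto
  show "W' = {0} \<or> W' = I"
  proof (cases "W' = {0}")
    case False
    then obtain f where f: "f \<in> W'" "f \<noteq> 0"
      using FV.subspace_0[OF W'(1)] by blast
    then obtain x where x: "f x \<noteq> 0"
      by (auto simp: fun_eq_iff)
    have fI: "f \<in> I" using f W'(2) by blast
    then have xK: "x \<in> Kmax S"
      using x unfolding I_iff by blast
    define W1 where "W1 = {w \<in> W. bump w \<in> W'}"
    have "V.subspace W1"
      unfolding V.subspace_def
    proof (intro conjI ballI allI)
      have "bump 0 = 0"
        by (auto simp: bump_def fun_eq_iff)
      then show "0 \<in> W1"
        using FV.subspace_0[OF W'(1)] by (simp add: W1_def)
    next
      fix v w assume vw: "v \<in> W1" "w \<in> W1"
      then have "bump (v + w) = bump v + bump w"
        by (auto simp: bump_def fun_eq_iff W1_def rep_add)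
      then show "v + w \<in> W1"
        using vw FV.subspace_add[OF W'(1)] by (simp add: W1_def)
    next
      fix c w assume w: "w \<in> W1"
      then have "bump (sc c w) = fun_scale sc c (bump w)"
        by (auto simp: bump_def fun_eq_iff W1_def rep_scale fun_scale_def)
      then show "sc c w \<in> W1"
        using w FV.subspace_scale[OF W'(1)] by (simp add: W1_def)
    qed
    moreover have "\<sigma> h w \<in> W1" if "h \<in> H" "w \<in> W1" for h w
    proof -
      have "bump (\<sigma> h w) = right_transl h (bump w)"
        using that by (auto simp: bump_def fun_eq_iff W1_def rep_mult right_transl_def)
      then show ?thesis
        using that W'(3) by (simp add: W1_def)
    qed
    ultimately have "W1 = {0} \<or> W1 = W"
      by (intro irreducible) (auto simp: W1_def)
    moreover have "f x \<in> W1"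
    proof -
      have "right_transl x f \<in> W'"
        using W'(3) xK f by blast
      from bump_in_invariant[OF W' this] have "bump (f x) \<in> W'"
        by (simp add: right_transl_def)
      moreover have "f x \<in> W"
        using fI xK unfolding I_iff by blast
      ultimately show ?thesis
        by (simp add: W1_def)
    qed
    ultimately have "W1 = W"
      using x by blast
    then have "I \<subseteq> W'"
      using bumps_generate[OF W'(1,3)] by (auto simp: W1_def)
    then show ?thesis
      using W'(2) by blast
  qed simp
qed

end

section \<open>The torus and the filtration\<close>

context unitary_setting
begin

lemma mat_lattice_mult:
  assumes "X \<in> mat_lattice S y a" "Y \<in> mat_lattice S y b"
  shows "X ** Y \<in> mat_lattice S y (a + b)"
proof -
  have c: "\<lceil>a + b\<rceil> \<le> \<lceil>a\<rceil> + \<lceil>b\<rceil>" "\<lceil>a + b\<rceil> \<le> \<lceil>a - y\<rceil> + \<lceil>b + y\<rceil>" "\<lceil>a + b\<rceil> \<le> \<lceil>a + y\<rceil> + \<lceil>b - y\<rceil>"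
    "\<lceil>a + b - y\<rceil> \<le> \<lceil>a\<rceil> + \<lceil>b - y\<rceil>" "\<lceil>a + b - y\<rceil> \<le> \<lceil>a - y\<rceil> + \<lceil>b\<rceil>"
    "\<lceil>a + b + y\<rceil> \<le> \<lceil>a\<rceil> + \<lceil>b + y\<rceil>" "\<lceil>a + b + y\<rceil> \<le> \<lceil>a + y\<rceil> + \<lceil>b\<rceil>"
    by linarith+
  then show ?thesis
    using assms unfolding mat_lattice_def
    by (auto simp: matrix_matrix_mult_def sum_2 intro!: pE_add intro: pE_mult')
qed

lemma mat_lattice_add: "X \<in> mat_lattice S y a \<Longrightarrow> Y \<in> mat_lattice S y a \<Longrightarrow> X + Y \<in> mat_lattice S y a"
  by (simp add: mat_lattice_def pE_add)

lemma mat_lattice_mono: "X \<in> mat_lattice S y b \<Longrightarrow> a \<le> b \<Longrightarrow> X \<in> mat_lattice S y a"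
  unfolding mat_lattice_def using pE_mono
  by (smt (verit, best) ceiling_mono mem_Collect_eq)

lemma Gfil_U: "g \<in> Gfil S y a \<Longrightarrow> g \<in> carrier (U S)"
  by (simp add: Gfil_def)

lemma Gfil_one [simp]: "mat 1 \<in> Gfil S y a"
  by (simp add: Gfil_def mat_lattice_def)

lemma Gfil_mult:
  assumes "g \<in> Gfil S y a" "h \<in> Gfil S y a" "a \<ge> 0"
  shows "g ** h \<in> Gfil S y a"
proof -
  have "(g - mat 1) ** (h - mat 1) \<in> mat_lattice S y (a + a)"
    using assms by (intro mat_lattice_mult) (auto simp: Gfil_def)
  then have "(g - mat 1) ** (h - mat 1) + (g - mat 1) + (h - mat 1) \<in> mat_lattice S y a"
    using assms by (intro mat_lattice_add) (auto simp: Gfil_def intro: mat_lattice_mono)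
  moreover have "(g - mat 1) ** (h - mat 1) + (g - mat 1) + (h - mat 1) = g ** h - mat 1"
    by (simp add: matrix_diff_ldistrib matrix_diff_rdistrib)
  ultimately show ?thesis
    using assms by (simp add: Gfil_def)
qed

lemma Gfil_iv:
  assumes "g \<in> Gfil S y a"
  shows "iv g \<in> Gfil S y a"
proof -
  have g: "g \<in> carrier (U S)" using assms by (rule Gfil_U)
  have "bar S x - 1 \<in> \<P> n \<longleftrightarrow> x - 1 \<in> \<P> n" for x n
    using pE_bar[of "x - 1" n] by simp
  then show ?thesis
    using assms g by (simp add: Gfil_def mat_lattice_def iv_nth[OF g] mat_1_mat2)
qed

lemma Gfil_conj:
  assumes "g \<in> Gfil S y a" "t \<in> carrier (U S)" "t \<in> mat_lattice S y 0" "iv t \<in> mat_lattice S y 0"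
  shows "t ** g ** iv t \<in> Gfil S y a"
proof -
  have "t ** (g - mat 1) ** iv t \<in> mat_lattice S y (0 + a + 0)"
    using assms by (intro mat_lattice_mult) (auto simp: Gfil_def)
  moreover have "t ** (g - mat 1) ** iv t = t ** g ** iv t - mat 1"
    using assms by (simp add: matrix_diff_ldistrib matrix_diff_rdistrib)
  ultimately show ?thesis
    using assms by (simp add: Gfil_def)
qed

lemma Gfil_plus_iff: "g \<in> Gfil_plus S y a \<longleftrightarrow> g \<in> carrier (U S) \<and>
    (g - mat 1) $ 1 $ 1 \<in> \<P> (\<lfloor>a\<rfloor> + 1) \<and> (g - mat 1) $ 1 $ 2 \<in> \<P> (\<lfloor>a - y\<rfloor> + 1) \<and>
    (g - mat 1) $ 2 $ 1 \<in> \<P> (\<lfloor>a + y\<rfloor> + 1) \<and> (g - mat 1) $ 2 $ 2 \<in> \<P> (\<lfloor>a\<rfloor> + 1)" (is "?L \<longleftrightarrow> ?R")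
proof
  assume ?L
  then obtain b where b: "a < b" "g \<in> Gfil S y b" by (auto simp: Gfil_plus_def)
  have "\<lfloor>a\<rfloor> + 1 \<le> \<lceil>b\<rceil>" "\<lfloor>a - y\<rfloor> + 1 \<le> \<lceil>b - y\<rceil>" "\<lfloor>a + y\<rfloor> + 1 \<le> \<lceil>b + y\<rceil>"
    using b by linarith+
  then show ?R
    using b pE_mono unfolding Gfil_def mat_lattice_def by blast
next
  assume R: ?R
  \<comment> \<open>The least of the next jumps after \<open>a\<close> in the three kinds of
    entries: up to \<open>b\<close>, each entry has reached only its first integer exponent beyond
    that of \<open>a\<close>.\<close>
  define b where "b = min (of_int (\<lfloor>a\<rfloor> + 1)) (min (of_int (\<lfloor>a - y\<rfloor> + 1) + y) (of_int (\<lfloor>a + y\<rfloor> + 1) - y))"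
  have "a < b"
    unfolding b_def by linarith
  moreover have "\<lceil>b\<rceil> \<le> \<lfloor>a\<rfloor> + 1" "\<lceil>b - y\<rceil> \<le> \<lfloor>a - y\<rfloor> + 1" "\<lceil>b + y\<rceil> \<le> \<lfloor>a + y\<rfloor> + 1"
    unfolding ceiling_le_iff b_def by linarith+
  then have "g \<in> Gfil S y b"
    using R pE_mono unfolding Gfil_def mat_lattice_def by blast
  ultimately show ?L
    by (auto simp: Gfil_plus_def)
qed

text \<open>Conjugation contributes the scalar \<open>m * bar S m\<close>, a norm and therefore in
  \<open>F\<close>, while \<open>l\<close> is central. So one set of new coordinates serves all
  \<open>l\<close>.\<close>

lemma conj_elt:
  assumes "g \<in> carrier (U S)" "a \<in> F" "b \<in> F" "c \<in> F" "d \<in> F"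
  obtains A B C D where "A \<in> F" "B \<in> F" "C \<in> F" "D \<in> F"
    "\<And>l. g ** elt l a b c d ** iv g = elt l A B C D"
proof -
  obtain m p q r t where g: "p \<in> F" "q \<in> F" "r \<in> F" "t \<in> F" "m * bar S m * dt p q r t = 1" "g = elt m p q r t"
    using elt_obtain[OF assms(1)] by metis
  define n where "n = m * bar S m"
  have n: "n \<in> F" by (simp add: n_def)
  have scale: "elt (m * l * bar S m) A B C D = elt l (n * A) (n * B) (n * C) (n * D)" for l A B C D
    by (simp add: elt_def n_def mult_ac)
  define A where "A = p * a + rt\<^sup>2 * (q * c)"
  define B where "B = p * b + q * d"
  define C where "C = r * a + t * c"
  define D where "D = rt\<^sup>2 * (r * b) + t * d"
  have F: "A \<in> F" "B \<in> F" "C \<in> F" "D \<in> F"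
    using g assms by (simp_all add: A_def B_def C_def D_def)
  have "g ** elt l a b c d ** iv g = elt l (n * (A * t + rt\<^sup>2 * (B * - r))) (n * (A * - q + B * p))
      (n * (C * t + D * - r)) (n * (rt\<^sup>2 * (C * - q) + D * p))" for l
    unfolding g(6) iv_elt[OF g(1-5)] elt_mult A_def[symmetric] B_def[symmetric] C_def[symmetric] D_def[symmetric] scale ..
  then show thesis
    by (intro that) (use F g n in \<open>simp_all\<close>)
qed

end

text \<open>
  Here \<open>g1 = v \<gamma>\<^sub>1\<close> and \<open>g2 = v \<gamma>\<^sub>2\<close> for \<open>\<Gamma> = \<Gamma>\<^sub>u\<^sub>,\<^sub>v\<close>, and \<open>\<rho> = 2 r\<close>.  In the coordinates of \<open>elt\<close>, the group
  \<open>G\<^sub>y\<^sub>,\<^sub>s\<close> is given by the exponent \<open>e\<close> for the diagonal entries minus 1 and the exponent \<open>f\<close> for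
  \<open>g2 b\<close> and \<open>g1 c\<close>; the exponents \<open>ep\<close> and \<open>fp\<close> are those of \<open>G\<^sub>y\<^sub>,\<^sub>s\<^sub>+\<close>.  The assumption \<open>dual\<close> reflects
  that \<open>\<g>\<^sub>y\<^sub>,\<^sub>-\<^sub>s\<close> is the dual lattice of \<open>\<g>\<^sub>y\<^sub>,\<^sub>s\<^sub>+\<close>.  The quantity in \<open>near\<close> is 0 for an unramified
  torus and \<open>\<plusminus>1\<close> for a ramified one.
\<close>

locale torus_setting = unitary_setting S for S :: "'e::field u11_data" +
  fixes g1 g2 :: 'e and y s :: real and e ep f fp \<rho> :: int
  assumes g12 [simp]: "g1 \<in> F" "g2 \<in> F" "g1 \<noteq> 0" "g2 \<noteq> 0"
    and nu_y: "real_of_int (nu S g1 - nu S g2) = - 2 * y"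
    and nu_rho: "nu S g1 + nu S g2 = - \<rho>"
    and e_def: "e = \<lceil>s\<rceil>" and ep_def: "ep = \<lfloor>s\<rfloor> + 1" and s_pos: "s > 0"
    and f_def: "\<lceil>s - y\<rceil> + nu S g2 = f" "\<lceil>s + y\<rceil> + nu S g1 = f"
    and fp_def: "\<lfloor>s - y\<rfloor> + 1 + nu S g2 = fp" "\<lfloor>s + y\<rfloor> + 1 + nu S g1 = fp"
    and dual: "f = 1 - ep" "fp = 1 - e"
    and near: "\<rho> + 2 - 2 * e - 2 * ep \<in> {-1, 0, 1}"
    and anisotropic: "x \<in> F \<Longrightarrow> z \<in> F \<Longrightarrow> rt\<^sup>2 * x\<^sup>2 - g1 * g2 * z\<^sup>2 \<in> \<P> n \<Longrightarrow> x\<^sup>2 \<in> \<P> n \<and> g1 * g2 * z\<^sup>2 \<in> \<P> n"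
begin

definition T :: "'e mat2 set" where
  "T = {mat2 a (b * g1) (b * g2) a | a b. True} \<inter> carrier (U S)"

definition J :: "'e mat2 set" where
  "J = Gfil S y s <#>\<^bsub>U S\<^esub> T"

text \<open>\<Gamma> without its scalar part, which cannot distinguish elements of equal
  trace.\<close>

definition \<Gamma>0 :: "'e mat2" where
  "\<Gamma>0 = elt 1 0 g1 g2 0"

lemma e_pos: "e \<ge> 1" "ep \<ge> 1"
  using s_pos by (auto simp: e_def ep_def)

lemma nu_g1g2: "nu S (g1 * g2) = - \<rho>"
  by (simp add: nu_mult nu_rho)

lemma T_U: "t \<in> T \<Longrightarrow> t \<in> carrier (U S)"
  by (simp add: T_def)

lemma T_one: "mat 1 \<in> T"
  unfolding T_def by (auto simp: mat_1_mat2[symmetric]) (auto simp: mat_1_mat2 mat2_eq_iff intro!: exI[of _ 0])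

lemma T_mult: 
  assumes "t \<in> T" "t' \<in> T"
  shows "t ** t' \<in> T"
proof -
  obtain a b a' b' where t: "t = mat2 a (b * g1) (b * g2) a" "t' = mat2 a' (b' * g1) (b' * g2) a'"
    using assms by (auto simp: T_def)
  have "t ** t' = mat2 (a * a' + b * b' * g1 * g2) ((a * b' + b * a') * g1) ((a * b' + b * a') * g2) (a * a' + b * b' * g1 * g2)"
    by (simp add: t mat2_mult mat2_eq_iff algebra_simps)
  then show ?thesis
    using T_U[OF assms(1)] T_U[OF assms(2)] U_mult unfolding T_def by blast
qed

lemma T_iv:
  assumes "t \<in> T"
  shows "iv t \<in> T"
proof -
  obtain a b where t: "t = mat2 a (b * g1) (b * g2) a"
    using assms by (auto simp: T_def)
  have tU: "t \<in> carrier (U S)" using assms by (rule T_U)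
  have "iv t = mat2 (bar S a) (bar S b * g1) (bar S b * g2) (bar S a)"
    using iv_nth[OF tU] mat2_eta[of "iv t"] by (simp add: t)
  moreover have "iv t \<in> carrier (U S)" using tU by simp
  ultimately show ?thesis
    unfolding T_def by blast
qed

text \<open>The torus is anisotropic: its norm condition, multiplied by \<open>- (g1 * g2)\<close>,
  bounds a value of the anisotropic form and thereby every entry. This is why \<open>T\<close>
  normalizes the filtration.\<close>

lemma T_lattice:
  assumes "t \<in> T"
  shows "t \<in> mat_lattice S y 0"
proof -
  obtain a b where t: "t = mat2 a (b * g1) (b * g2) a"
    using assms by (auto simp: T_def)
  obtain l p q r d where *: "p \<in> F" "q \<in> F" "r \<in> F" "d \<in> F" "l \<noteq> 0" "nu S l = 0"
    "l * bar S l * dt p q r d = 1" "t = elt l p q r d"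
    by (rule elt_obtain[OF T_U[OF assms]])
  have "t $ 1 $ 1 = t $ 2 $ 2"
    using t by simp
  then have d: "d = p"
    using *(5) by (simp add: *(8))
  have qr: "l * (q * rt) = b * g1" "l * (r * rt) = b * g2"
    using *(8) t by (simp_all add: elt_def mat2_eq_iff)
  then have "l * rt * (q * g2) = l * rt * (r * g1)"
    by (metis mult.assoc mult.commute)
  then have qr': "q * g2 = r * g1"
    using *(5) by simp
  have "dt p q r d \<in> \<P> 0"
  proof -
    have n0: "l * bar S l \<noteq> 0" using *(5) by simp
    have "l * bar S l * dt p q r d \<in> \<P> 0"
      unfolding *(7) by simp
    then show ?thesis
      using *(5,6) by (simp only: pE_mult_iff[OF n0]) (simp add: nu_mult)
  qed
  then have "- (g1 * g2) * dt p q r d \<in> \<P> (- \<rho>)"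
    using nu_g1g2 by (subst pE_mult_iff) auto
  moreover have "- (g1 * g2) * dt p q r d = rt\<^sup>2 * (q * g2)\<^sup>2 - g1 * g2 * p\<^sup>2"
  proof -
    have sq: "(q * g2)\<^sup>2 = q * g2 * (r * g1)"
      by (metis power2_eq_square qr')
    show ?thesis
      unfolding sq by (simp add: dt_def d algebra_simps power2_eq_square)
  qed
  ultimately have "rt\<^sup>2 * (q * g2)\<^sup>2 - g1 * g2 * p\<^sup>2 \<in> \<P> (- \<rho>)"
    by (simp only:)
  then have 1: "(q * g2)\<^sup>2 \<in> \<P> (- \<rho>)" "g1 * g2 * p\<^sup>2 \<in> \<P> (- \<rho>)"
    using anisotropic[of "q * g2" p "-\<rho>"] * by auto
  have "p\<^sup>2 \<in> \<P> 0"
    using 1(2) pE_mult_iff[of "g1 * g2" "p\<^sup>2" "-\<rho>"] nu_g1g2 by simp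
  then have p: "p \<in> \<P> 0"
    by (rule pE_square) simp
  \<comment> \<open>Halves the exponent of a square and rounds up. The bound is a real number
    because \<open>y\<close> is half-integral for the ramified tori.\<close>
  have key: "x \<in> \<P> \<lceil>z\<rceil>" if "x\<^sup>2 \<in> \<P> n" "2 * z \<le> of_int n" for x and z :: real and n
  proof (cases "x = 0")
    case False
    then have "n \<le> 2 * nu S x"
      using that(1) by (simp add: pE_iff nu_power)
    then have "z \<le> of_int (nu S x)"
      using that(2) by linarith
    then show ?thesis
      using False by (simp add: pE_iff ceiling_le_iff)
  qed simp
  have "q\<^sup>2 \<in> \<P> (- \<rho> - 2 * nu S g2)"
    using 1(1) by (simp add: power_mult_distrib pE_mult_iff' nu_power)
  then have q: "q \<in> \<P> \<lceil>- y\<rceil>"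
    by (rule key) (use nu_y nu_rho in linarith)
  have "r\<^sup>2 \<in> \<P> (- \<rho> - 2 * nu S g1)"
    using 1(1) unfolding qr' by (simp add: power_mult_distrib pE_mult_iff' nu_power)
  then have r: "r \<in> \<P> \<lceil>y\<rceil>"
    by (rule key) (use nu_y nu_rho in linarith)
  show ?thesis
    using *(5,6) p q r d by (simp add: *(8) mat_lattice_def pE_mult_iff pE_rt)
qed

lemma Gfil_conj_T: "g \<in> Gfil S y a \<Longrightarrow> t \<in> T \<Longrightarrow> t ** g ** iv t \<in> Gfil S y a"
  by (intro Gfil_conj) (auto simp: T_U T_lattice T_iv)

lemma J_iff: "h \<in> J \<longleftrightarrow> (\<exists>g\<in>Gfil S y s. \<exists>t\<in>T. h = g ** t)"
  by (auto simp: J_def set_mult_def)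

lemma Gfil_J: "g \<in> Gfil S y s \<Longrightarrow> g \<in> J"
  unfolding J_iff using T_one by (metis matrix_mul_rid)

lemma T_J: "t \<in> T \<Longrightarrow> t \<in> J"
  unfolding J_iff using Gfil_one by (metis matrix_mul_lid)

lemma J_mult:
  assumes "h \<in> J" "h' \<in> J"
  shows "h ** h' \<in> J"
proof -
  obtain g t g' t' where *: "g \<in> Gfil S y s" "t \<in> T" "h = g ** t" "g' \<in> Gfil S y s" "t' \<in> T" "h' = g' ** t'"
    using assms unfolding J_iff by blast
  have "h ** h' = (g ** (t ** g' ** iv t)) ** (t ** t')"
    using * by (simp add: matrix_mul_assoc T_U)
  moreover have "g ** (t ** g' ** iv t) \<in> Gfil S y s"
    using * s_pos by (intro Gfil_mult Gfil_conj_T) auto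
  ultimately show ?thesis
    using T_mult[OF *(2,5)] unfolding J_iff by blast
qed

lemma J_iv:
  assumes "h \<in> J"
  shows "iv h \<in> J"
proof -
  obtain g t where *: "g \<in> Gfil S y s" "t \<in> T" "h = g ** t"
    using assms unfolding J_iff by blast
  have "iv h = iv t ** iv g"
    using * by (simp add: iv_mult Gfil_U T_U)
  then show ?thesis
    using J_mult T_J Gfil_J * T_iv Gfil_iv by simp
qed

lemma J_Gfil_plus: "g \<in> Gfil_plus S y s \<Longrightarrow> g \<in> J"
proof -
  assume "g \<in> Gfil_plus S y s"
  then obtain b where "s < b" "g \<in> Gfil S y b" by (auto simp: Gfil_plus_def)
  then have "g \<in> Gfil S y s"
    using mat_lattice_mono by (auto simp: Gfil_def)
  then show ?thesis by (rule Gfil_J)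
qed

lemma Gfil_elt:
  assumes "elt l a b c d \<in> carrier (U S)" "l \<noteq> 0" "nu S l = 0"
  shows "elt l a b c d \<in> Gfil S y s \<longleftrightarrow> l * a - 1 \<in> \<P> e \<and> l * d - 1 \<in> \<P> e \<and> g2 * b \<in> \<P> f \<and> g1 * c \<in> \<P> f"
proof -
  have "\<lceil>s - y\<rceil> = f - nu S g2" "\<lceil>s + y\<rceil> = f - nu S g1"
    using f_def by linarith+
  then show ?thesis
    using assms by (auto simp: Gfil_def mat_lattice_def mat_1_mat2 pE_mult_iff pE_rt e_def)
qed

lemma Gfil_plus_elt:
  assumes "elt l a b c d \<in> carrier (U S)" "l \<noteq> 0" "nu S l = 0"
  shows "elt l a b c d \<in> Gfil_plus S y s \<longleftrightarrow> l * a - 1 \<in> \<P> ep \<and> l * d - 1 \<in> \<P> ep \<and> g2 * b \<in> \<P> fp \<and> g1 * c \<in> \<P> fp"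
proof -
  have "\<lfloor>s - y\<rfloor> + 1 = fp - nu S g2" "\<lfloor>s + y\<rfloor> + 1 = fp - nu S g1"
    using fp_def by linarith+
  then show ?thesis
    using assms by (auto simp: Gfil_plus_iff mat_1_mat2 pE_mult_iff pE_rt ep_def)
qed

text \<open>By \<open>near\<close> and \<open>dual\<close> the exponents \<open>2 * F'\<close> and
  \<open>2 * E' - \<rho>\<close> differ by at most one. As squares have even valuation, the smaller
  of the two still forces both bounds after rounding.\<close>

lemma filter_square:
  assumes "x \<in> F" "z \<in> F" "(E', F') \<in> {(e, f), (ep, fp)}"
  shows "x \<in> \<P> F' \<and> z \<in> \<P> E' \<longleftrightarrow> rt\<^sup>2 * x\<^sup>2 - g1 * g2 * z\<^sup>2 \<in> \<P> (min (2 * F') (2 * E' - \<rho>))"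
    (is "_ \<longleftrightarrow> ?q \<in> \<P> ?m")
proof
  assume "x \<in> \<P> F' \<and> z \<in> \<P> E'"
  then have "rt\<^sup>2 * x\<^sup>2 \<in> \<P> ?m" "g1 * g2 * z\<^sup>2 \<in> \<P> ?m"
    using nu_g1g2 by (auto simp: pE_mult_iff eps_unit pE_mult_iff[of "g1 * g2"] intro!: pE_power2)
  then show "?q \<in> \<P> ?m"
    by (rule pE_diff)
next
  assume "?q \<in> \<P> ?m"
  then have 1: "x\<^sup>2 \<in> \<P> ?m" "g1 * g2 * z\<^sup>2 \<in> \<P> ?m"
    using anisotropic[OF assms(1,2)] by auto
  have m: "?m \<ge> 2 * F' - 1" "?m + \<rho> \<ge> 2 * E' - 1"
    using assms(3) near dual by auto
  have "z\<^sup>2 \<in> \<P> (?m + \<rho>)"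
    using 1(2) nu_g1g2 pE_mult_iff[of "g1 * g2" "z\<^sup>2" ?m] by simp
  then show "x \<in> \<P> F' \<and> z \<in> \<P> E'"
    using pE_square[OF 1(1) m(1)] pE_square[OF _ m(2)] by blast
qed

text \<open>A normal form for representatives in which \<beta> and \<gamma> replace
  \<open>g1\<close> and \<open>g2\<close>; the product condition is the equality of
  determinants.\<close>

definition straight :: "'e mat2 \<Rightarrow> 'e \<Rightarrow> 'e \<Rightarrow> bool" where
  "straight g \<beta> \<gamma> \<longleftrightarrow> g \<in> carrier (U S) \<and> \<beta> \<in> F \<and> \<gamma> \<in> F \<and> \<beta> * \<gamma> = g1 * g2 \<and>
     g ** \<Gamma>0 ** iv g = elt 1 0 \<beta> \<gamma> 0"

text \<open>The commutator with \<open>\<Gamma>0\<close> kills the coordinates seen by the two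
  traces, and its determinant is \<open>- rt\<^sup>2\<close> times the form of
  \<open>filter_square\<close> in the other two. Each side of the last equivalence is thus a bound
  on one and the same number.\<close>

lemma conj_invariants:
  assumes g: "straight g \<beta> \<gamma>" and F: "a \<in> F" "b \<in> F" "c \<in> F" "d \<in> F"
    and F': "A \<in> F" "B \<in> F" "C \<in> F" "D \<in> F"
    and eq: "g ** elt 1 a b c d ** iv g = elt 1 A B C D"
  shows "A + D = a + d" "\<beta> * C + \<gamma> * B = g1 * c + g2 * b"
    "(E', F') \<in> {(e, f), (ep, fp)} \<Longrightarrow>
       \<beta> * C - \<gamma> * B \<in> \<P> F' \<and> A - D \<in> \<P> E' \<longleftrightarrow> g1 * c - g2 * b \<in> \<P> F' \<and> a - d \<in> \<P> E'"
proof -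
  have gU: "g \<in> carrier (U S)" and bF: "\<beta> \<in> F" "\<gamma> \<in> F" and bg: "\<beta> * \<gamma> = g1 * g2"
    and gG: "g ** \<Gamma>0 ** iv g = elt 1 0 \<beta> \<gamma> 0"
    using g by (auto simp: straight_def)
  have tr: "trace (g ** X ** iv g) = trace X" for X
    using trace_mul_sym[of "g ** X" "iv g"] gU by (simp add: matrix_mul_assoc)
  have dg: "det g * det (iv g) = 1"
    using det_mul[of g "iv g"] gU by simp
  have dt': "det (g ** X ** iv g) = det X" for X
    using dg by (simp add: det_mul)
  have prod: "g ** (X ** Y) ** iv g = (g ** X ** iv g) ** (g ** Y ** iv g)" for X Y
    using gU by (simp add: matrix_mul_assoc)
  show "A + D = a + d"
    using tr[of "elt 1 a b c d"] by (simp add: eq) (simp add: elt_def trace_mat2)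
  have "trace (elt 1 0 \<beta> \<gamma> 0 ** elt 1 A B C D) = trace (\<Gamma>0 ** elt 1 a b c d)"
    using tr[of "\<Gamma>0 ** elt 1 a b c d"] by (simp add: prod eq gG)
  moreover have "trace (elt 1 0 \<beta> \<gamma> 0 ** elt 1 A B C D) = rt\<^sup>2 * (\<beta> * C + \<gamma> * B)"
    by (simp add: elt_mult) (simp add: elt_def trace_mat2 algebra_simps)
  moreover have "trace (\<Gamma>0 ** elt 1 a b c d) = rt\<^sup>2 * (g1 * c + g2 * b)"
    by (simp add: \<Gamma>0_def elt_mult) (simp add: elt_def trace_mat2 algebra_simps)
  ultimately have "rt\<^sup>2 * (\<beta> * C + \<gamma> * B) = rt\<^sup>2 * (g1 * c + g2 * b)"
    by (simp only:)
  then show "\<beta> * C + \<gamma> * B = g1 * c + g2 * b"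
    by simp
  assume EF: "(E', F') \<in> {(e, f), (ep, fp)}"
  have "det (elt 1 0 \<beta> \<gamma> 0 ** elt 1 A B C D - elt 1 A B C D ** elt 1 0 \<beta> \<gamma> 0) =
      det (\<Gamma>0 ** elt 1 a b c d - elt 1 a b c d ** \<Gamma>0)"
    using dt'[of "\<Gamma>0 ** elt 1 a b c d - elt 1 a b c d ** \<Gamma>0"]
    by (simp add: matrix_diff_ldistrib matrix_diff_rdistrib prod eq gG)
  moreover have "det (elt 1 0 x z 0 ** elt 1 a b c d - elt 1 a b c d ** elt 1 0 x z 0) =
      - (rt\<^sup>2 * (rt\<^sup>2 * (x * c - z * b)\<^sup>2 - x * z * (a - d)\<^sup>2))" for x z a b c d
    by (simp add: elt_mult)
      (simp add: elt_def mat2_diff det_mat2 algebra_simps power2_eq_square)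
  ultimately have "- (rt\<^sup>2 * (rt\<^sup>2 * (\<beta> * C - \<gamma> * B)\<^sup>2 - \<beta> * \<gamma> * (A - D)\<^sup>2)) =
      - (rt\<^sup>2 * (rt\<^sup>2 * (g1 * c - g2 * b)\<^sup>2 - g1 * g2 * (a - d)\<^sup>2))"
    by (simp only: \<Gamma>0_def)
  then have "rt\<^sup>2 * (\<beta> * C - \<gamma> * B)\<^sup>2 - g1 * g2 * (A - D)\<^sup>2 =
      rt\<^sup>2 * (g1 * c - g2 * b)\<^sup>2 - g1 * g2 * (a - d)\<^sup>2"
    by (simp add: bg)
  moreover have "\<beta> * C - \<gamma> * B \<in> F" "A - D \<in> F" "g1 * c - g2 * b \<in> F" "a - d \<in> F"
    using F F' bF by auto
  ultimately show "\<beta> * C - \<gamma> * B \<in> \<P> F' \<and> A - D \<in> \<P> E' \<longleftrightarrow> g1 * c - g2 * b \<in> \<P> F' \<and> a - d \<in> \<P> E'"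
    using filter_square[OF _ _ EF] by metis
qed

text \<open>The matrix is split into the part \<open>a0\<close>, \<open>a1\<close> commuting with
  \<open>\<Gamma>0\<close> and the anticommuting part \<open>Xd\<close>, \<open>Yd\<close>. The
  first, rescaled to norm one, is the torus factor; the second is small enough to be absorbed by
  \<open>Gfil S y s\<close>.\<close>

lemma J_elt:
  assumes F: "a \<in> F" "b \<in> F" "c \<in> F" "d \<in> F" and l: "l \<noteq> 0" "nu S l = 0"
    and norm: "l * bar S l * dt a b c d = 1"
    and X: "g1 * c - g2 * b \<in> \<P> f" and Y: "a - d \<in> \<P> e"
  shows "elt l a b c d \<in> J"
proof -
  let ?h = "elt l a b c d"
  define n where "n = l * bar S l"
  have n: "n \<in> F" "n \<noteq> 0" "nu S n = 0"
    using l by (auto simp: n_def nu_mult)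
  define Xd where "Xd = (g1 * c - g2 * b) / 2"
  define Yd where "Yd = (a - d) / 2"
  define a0 where "a0 = (a + d) / 2"
  define a1 where "a1 = (g1 * c + g2 * b) / (2 * g1 * g2)"
  have XY: "Xd \<in> F" "Yd \<in> F" "Xd \<in> \<P> f" "Yd \<in> \<P> e"
    using F X Y by (auto simp: Xd_def Yd_def pE_half)
  have aF: "a0 \<in> F" "a1 \<in> F"
    using F by (auto simp: a0_def a1_def)
  have coords: "a = a0 + Yd" "d = a0 - Yd" "b = a1 * g1 - Xd / g2" "c = a1 * g2 + Xd / g1"
    by (simp_all add: a0_def Yd_def a1_def Xd_def field_simps)
  \<comment> \<open>The change of the determinant when the anticommuting part is dropped; its
    smallness yields the square root \<open>1 + z\<close> used for the rescaling.\<close>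
  define \<delta> where "\<delta> = Yd\<^sup>2 - rt\<^sup>2 * Xd\<^sup>2 / (g1 * g2)"
  have dt: "dt a0 (a1 * g1) (a1 * g2) a0 = dt a b c d + \<delta>"
    unfolding coords dt_def \<delta>_def by (simp add: field_simps power2_eq_square)
  have "Yd\<^sup>2 \<in> \<P> e" 
    using XY e_pos by (auto intro: pE_power2)
  moreover have "Xd\<^sup>2 \<in> \<P> (e - \<rho>)"
    using XY near dual e_pos by (intro pE_power2[of _ f]) auto
  then have "rt\<^sup>2 * Xd\<^sup>2 / (g1 * g2) \<in> \<P> e"
    using nu_g1g2 by (simp add: pE_divide_iff pE_mult_iff eps_unit)
  ultimately have "\<delta> \<in> \<P> e"
    unfolding \<delta>_def by (rule pE_diff)
  then have "n * \<delta> \<in> \<P> e"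
    using n by (simp add: pE_mult_iff)
  moreover have "n * \<delta> \<in> F"
    using n XY by (simp add: \<delta>_def)
  ultimately obtain z where z: "z \<in> F" "z \<in> \<P> e" "(1 + z)\<^sup>2 = 1 + n * \<delta>"
    using sqrt_one_plus e_pos by metis
  have z1: "1 + z \<noteq> 0"
  proof
    assume "1 + z = 0"
    then have "z = - 1" by (simp add: add_eq_0_iff)
    then show False using z(2) e_pos by (simp add: pE_iff)
  qed
  define t where "t = elt (l / (1 + z)) a0 (a1 * g1) (a1 * g2) a0"
  have "l / (1 + z) * bar S (l / (1 + z)) * dt a0 (a1 * g1) (a1 * g2) a0 = n * (dt a b c d + \<delta>) / (1 + z)\<^sup>2"
    using z by (simp add: dt n_def power2_eq_square)
  also have "\<dots> = (1 + n * \<delta>) / (1 + z)\<^sup>2"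
    using norm by (simp add: n_def distrib_left)
  also have "\<dots> = 1"
    using z1 by (simp flip: z(3))
  finally have tU: "t \<in> carrier (U S)"
    unfolding t_def using aF by (intro elt_in_U) auto
  have "t = mat2 (l / (1 + z) * a0) ((l / (1 + z) * a1 * rt) * g1) ((l / (1 + z) * a1 * rt) * g2) (l / (1 + z) * a0)"
    by (simp add: t_def elt_def mat2_eq_iff)
  then have tT: "t \<in> T"
    unfolding T_def using tU by blast
  have hU: "?h \<in> carrier (U S)"
    using F norm by (rule elt_in_U)
  \<comment> \<open>The commuting part of \<open>?h\<close> is \<open>1 + z\<close> times
    \<open>t\<close>, so \<open>?h - t\<close> is the anticommuting part \<open>D1\<close> plus
    \<open>z\<close> times \<open>t\<close>.\<close>
  define D1 where "D1 = mat2 (l * Yd) (- (l * rt * (Xd / g2))) (l * rt * (Xd / g1)) (- (l * Yd))"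
  have "D1 \<in> mat_lattice S y s"
    using XY l f_def by (auto simp: D1_def mat_lattice_def pE_mult_iff pE_divide_iff e_def nu_mult)
  moreover have "mat2 z 0 0 z \<in> mat_lattice S y s"
    using z by (simp add: mat_lattice_def e_def)
  then have "mat2 z 0 0 z ** t \<in> mat_lattice S y (s + 0)"
    using T_lattice[OF tT] by (rule mat_lattice_mult)
  ultimately have "D1 + mat2 z 0 0 z ** t \<in> mat_lattice S y s"
    by (intro mat_lattice_add) auto
  moreover have "D1 + mat2 z 0 0 z ** t = ?h - t"
  proof -
    show ?thesis
      unfolding D1_def t_def elt_def mat2_mult mat2_diff mat2_add mat2_eq_iff coords
      using z1 by (simp add: field_simps)
  qed
  ultimately have "(?h - t) ** iv t \<in> mat_lattice S y (s + 0)"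
    using T_lattice[OF T_iv[OF tT]] by (metis mat_lattice_mult)
  moreover have "(?h - t) ** iv t = ?h ** iv t - mat 1"
    using tU by (simp add: matrix_diff_rdistrib)
  ultimately have "?h ** iv t \<in> Gfil S y s"
    using hU tU by (simp add: Gfil_def)
  moreover have "?h = (?h ** iv t) ** t"
    using tU by simp
  ultimately show ?thesis
    unfolding J_iff using tT by blast
qed

end

section \<open>Intertwining\<close>

context unitary_setting
begin

lemma pE_sum_diff:
  assumes "a + b \<in> \<P> n" "a - b \<in> \<P> n"
  shows "a \<in> \<P> n" "b \<in> \<P> n"
proof -
  have "2 * a = (a + b) + (a - b)" "2 * b = (a + b) - (a - b)"
    by (simp_all add: algebra_simps)
  then have "2 * a \<in> \<P> n" "2 * b \<in> \<P> n"
    using assms pE_add pE_diff by metis+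
  then show "a \<in> \<P> n" "b \<in> \<P> n"
    by (simp_all only: pE_double)
qed

lemma psi_add: "psi S (a + b) = psi S a * psi S b"
proof -
  have F: "(c + bar S c) / 2 \<in> F" for c
    by (intro F_divide F_2) (simp flip: bar_fixed add: add.commute)
  have "(a + b + bar S (a + b)) / 2 = (a + bar S a) / 2 + (b + bar S b) / 2"
    by (simp add: field_simps)
  then show ?thesis
    unfolding psi_def using addchar(1)[OF F F] by metis
qed

lemma psi_nonzero [simp]: "psi S a \<noteq> 0"
  unfolding psi_def by (intro addchar(2) F_divide F_2) (simp flip: bar_fixed add: add.commute)

lemma psi_F: "a \<in> F \<Longrightarrow> psi S a = addchar S a"
  unfolding psi_def by (simp add: mult_2[symmetric])

text \<open>On \<open>F\<close> the character is trivial on the maximal ideal but not on the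
  integers. An integer with nontrivial value, divided by \<open>z\<close>, lies in
  \<open>\<P> k\<close> as soon as \<open>nu S z \<le> - k\<close>.\<close>

lemma psi_trivial_imp:
  assumes "z \<in> F" "\<And>w. w \<in> F \<Longrightarrow> w \<in> \<P> k \<Longrightarrow> psi S (z * w) = 1"
  shows "z \<in> \<P> (1 - k)"
proof (rule ccontr)
  assume *: "z \<notin> \<P> (1 - k)"
  then have z: "z \<noteq> 0" "nu S z \<le> - k"
    by (auto simp: pE_def)
  obtain x where x: "x \<in> pF S 0" "addchar S x \<noteq> 1"
    using addchar(4) by blast
  then have "x / z \<in> F" "x / z \<in> \<P> k"
    using z assms(1) by (auto simp: pF_def pE_divide_iff intro: pE_mono)
  then have "psi S (z * (x / z)) = 1"
    by (rule assms(2))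
  then show False
    using x z by (simp add: psi_F pF_def)
qed

text \<open>Solves \<alpha> - 1/\<alpha> = w by adding w/2 to a square root of 1 + (w/2)^2. Under
  the trace form these diagonal elements detect the diagonal entry of a traceless matrix.\<close>

lemma diagonal_with_difference:
  assumes "w \<in> F" "w \<in> \<P> n" "n \<ge> 1"
  obtains \<alpha> \<alpha>' where "\<alpha> \<in> F" "\<alpha>' \<in> F" "\<alpha> * \<alpha>' = 1" "\<alpha> - \<alpha>' = w" "\<alpha> - 1 \<in> \<P> n" "\<alpha>' - 1 \<in> \<P> n"
proof -
  have "(w / 2)\<^sup>2 \<in> \<P> n"
    using assms by (intro pE_power2[of _ n]) (auto simp: pE_half)
  then obtain z where z: "z \<in> F" "z \<in> \<P> n" "(1 + z)\<^sup>2 = 1 + (w / 2)\<^sup>2"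
    using sqrt_one_plus[of "(w / 2)\<^sup>2" n] assms by blast
  show thesis
  proof (rule that[of "1 + z + w / 2" "1 + z - w / 2"])
    have "(1 + z + w / 2) * (1 + z - w / 2) = (1 + z)\<^sup>2 - (w / 2)\<^sup>2"
      by (simp add: algebra_simps power2_eq_square)
    then show "(1 + z + w / 2) * (1 + z - w / 2) = 1"
      using z(3) by simp
    have "z + w / 2 \<in> \<P> n" "z - w / 2 \<in> \<P> n"
      using z assms by (auto intro!: pE_add pE_diff simp: pE_half)
    then show "1 + z + w / 2 - 1 \<in> \<P> n" "1 + z - w / 2 - 1 \<in> \<P> n"
      by simp_all
  qed (use z assms in \<open>simp_all add: field_simps\<close>)
qed

lemma iv_unipotent:
  "w \<in> F \<Longrightarrow> elt 1 1 w 0 1 \<in> carrier (U S)" "w \<in> F \<Longrightarrow> iv (elt 1 1 w 0 1) = elt 1 1 (-w) 0 1"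
  "w \<in> F \<Longrightarrow> elt 1 1 0 w 1 \<in> carrier (U S)" "w \<in> F \<Longrightarrow> iv (elt 1 1 0 w 1) = elt 1 1 0 (-w) 1"
  by (auto intro!: elt_in_U simp: dt_def iv_elt)

lemma unipotent_Kmax:
  "w \<in> F \<Longrightarrow> w \<in> \<P> 0 \<Longrightarrow> elt 1 1 w 0 1 \<in> Kmax S"
  "w \<in> F \<Longrightarrow> w \<in> \<P> 0 \<Longrightarrow> elt 1 1 0 w 1 \<in> Kmax S"
  by (auto simp: Kmax_elt iv_unipotent)

lemma swap_Kmax: "mat2 0 1 1 0 \<in> Kmax S" and iv_swap: "iv (mat2 0 1 1 0) = mat2 0 1 1 0"
proof -
  have U: "mat2 0 1 1 0 \<in> carrier (U S)"
    by (simp add: U_iff)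
  then show "mat2 0 1 1 0 \<in> Kmax S"
    by (simp add: Kmax_iff MP_def forall_2 del: Kmax_U)
  show "iv (mat2 0 1 1 0) = mat2 0 1 1 0"
    using U by (intro G.inv_equality) (auto simp: mat2_mult mat_1_mat2)
qed

text \<open>An entry of least valuation is brought to the lower left, where an upper unipotent
  element uses it to clear the diagonal. If only the diagonal attains the least valuation, a lower
  unipotent element first copies it off the diagonal.\<close>

lemma antidiagonalize:
  assumes F: "a \<in> F" "b \<in> F" "c \<in> F" and q: "a\<^sup>2 + rt\<^sup>2 * (b * c) = rt\<^sup>2 * q" "q \<noteq> 0"
  shows "\<exists>k\<in>Kmax S. \<exists>\<beta>\<in>F. \<exists>\<gamma>\<in>F. \<beta> * \<gamma> = q \<and> nu S \<gamma> \<le> nu S \<beta> \<and>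
    k ** elt 1 a b c (-a) ** iv k = elt 1 0 \<beta> \<gamma> 0"
proof -
  let ?P = "\<lambda>X. \<exists>k\<in>Kmax S. \<exists>\<beta>\<in>F. \<exists>\<gamma>\<in>F. \<beta> * \<gamma> = q \<and> nu S \<gamma> \<le> nu S \<beta> \<and>
    k ** X ** iv k = elt 1 0 \<beta> \<gamma> 0"
  have conj: "?P X" if k: "?P (k ** X ** iv k)" "k \<in> Kmax S" for X k
  proof -
    obtain k' \<beta> \<gamma> where k': "k' \<in> Kmax S" "\<beta> \<in> F" "\<gamma> \<in> F" "\<beta> * \<gamma> = q" "nu S \<gamma> \<le> nu S \<beta>"
      "k' ** (k ** X ** iv k) ** iv k' = elt 1 0 \<beta> \<gamma> 0"
      using k(1) by blast
    moreover have "k' ** (k ** X ** iv k) ** iv k' = (k' ** k) ** X ** iv (k' ** k)"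
      using k' k by (simp add: iv_mult matrix_mul_assoc)
    ultimately show ?thesis
      using Kmax_mult[OF k'(1) k(2)] by metis
  qed
  have lower: "?P (elt 1 a b c (-a))"
    if F: "a \<in> F" "b \<in> F" "c \<in> F" and q: "a\<^sup>2 + rt\<^sup>2 * (b * c) = rt\<^sup>2 * q"
      and c: "c \<noteq> 0" "a \<in> \<P> (nu S c)" "b \<in> \<P> (nu S c)" for a b c
  proof -
    \<comment> \<open>Makes the new diagonal entry \<open>a + rt\<^sup>2 * (x * c)\<close> vanish;
      integral because \<open>a\<close> has at least the valuation of \<open>c\<close>.\<close>
    define x where "x = - a / (rt\<^sup>2 * c)"
    have x: "x \<in> F" "x \<in> \<P> 0"
      using F c by (auto simp: x_def pE_divide_iff nu_mult eps_unit)
    have xc: "a + rt\<^sup>2 * (x * c) = 0"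
      using c by (simp add: x_def)
    have "- (c * x * rt\<^sup>2) - a = - (a + rt\<^sup>2 * (x * c))"
      by (simp add: algebra_simps)
    then have xc': "- (c * x * rt\<^sup>2) - a = 0"
      by (simp only: xc minus_zero)
    have "elt 1 1 x 0 1 ** elt 1 a b c (-a) ** iv (elt 1 1 x 0 1) = elt 1 0 (b - x * a) c 0"
      using xc xc' x by (simp add: iv_unipotent elt_mult mult.commute)
    moreover have bg: "(b - x * a) * c = q"
    proof -
      have "rt\<^sup>2 * ((b - x * a) * c) = rt\<^sup>2 * (b * c) - a * (rt\<^sup>2 * (x * c))"
        by (simp add: algebra_simps)
      also have "rt\<^sup>2 * (x * c) = - a"
        using xc by (simp add: add_eq_0_iff)
      finally have "rt\<^sup>2 * ((b - x * a) * c) = rt\<^sup>2 * q"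
        using q by (simp add: power2_eq_square add.commute)
      then show ?thesis by simp
    qed
    moreover have "b - x * a \<in> \<P> (nu S c)"
      using x c by (intro pE_diff pE_mult'[of x 0 a]) auto
    then have "nu S c \<le> nu S (b - x * a)"
      using bg \<open>q \<noteq> 0\<close> by (auto simp: pE_iff)
    ultimately show ?thesis
      using F x unipotent_Kmax(1)[OF x] by blast
  qed
  have upper: "?P (elt 1 a b c (-a))"
    if b: "b \<noteq> 0" "a \<in> \<P> (nu S b)" "c \<in> \<P> (nu S b)"
  proof (rule conj[OF _ swap_Kmax])
    have "mat2 0 1 1 0 ** elt 1 a b c (- a) ** iv (mat2 0 1 1 0) = elt 1 (- a) c b (- (- a))"
      by (simp add: iv_swap elt_def mat2_mult)
    moreover have "?P (elt 1 (- a) c b (- (- a)))"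
      using F q b by (intro lower) (auto simp: mult.commute)
    ultimately show "?P (mat2 0 1 1 0 ** elt 1 a b c (- a) ** iv (mat2 0 1 1 0))"
      by (simp only:)
  qed
  have middle: "?P (elt 1 a b c (-a))"
    if a: "a \<noteq> 0" "b \<in> \<P> (nu S a + 1)" "c \<in> \<P> (nu S a + 1)"
  proof (rule conj)
    show k: "elt 1 1 0 1 1 \<in> Kmax S"
      by (intro unipotent_Kmax) auto
    \<comment> \<open>The new lower left entry. It has the valuation of \<open>a\<close>, since 2 is
      a unit and the other terms have strictly larger valuation.\<close>
    define c' where "c' = 2 * a + (c - rt\<^sup>2 * b)"
    have c1: "c - rt\<^sup>2 * b \<in> \<P> (nu S a + 1)"
      using a by (intro pE_diff) (auto simp: pE_mult_iff eps_unit)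
    then have "c' \<in> \<P> (nu S a)"
      unfolding c'_def using a by (intro pE_add) (auto simp: pE_mult_iff pE_iff nu_mult intro: pE_mono)
    moreover have "c' \<notin> \<P> (nu S a + 1)"
      using a pE_add_dominant[OF _ _ , of "2 * a" "c - rt\<^sup>2 * b" "nu S a + 1"] c1
      by (auto simp: c'_def nu_mult)
    ultimately have c': "c' \<noteq> 0" "nu S c' = nu S a"
      by (auto simp: pE_def)
    have "elt 1 1 0 1 1 ** elt 1 a b c (- a) ** iv (elt 1 1 0 1 1) =
      elt 1 (a - rt\<^sup>2 * b) b c' (- (a - rt\<^sup>2 * b))"
      by (simp add: iv_unipotent elt_mult c'_def)
    moreover have "?P (elt 1 (a - rt\<^sup>2 * b) b c' (- (a - rt\<^sup>2 * b)))"
    proof (rule lower)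
      show "(a - rt\<^sup>2 * b)\<^sup>2 + rt\<^sup>2 * (b * c') = rt\<^sup>2 * q"
        unfolding q(1)[symmetric] c'_def by (simp add: algebra_simps power2_eq_square)
      show "a - rt\<^sup>2 * b \<in> \<P> (nu S c')"
        using a c' by (intro pE_diff) (auto simp: pE_mult_iff pE_iff eps_unit intro: pE_mono)
      show "b \<in> \<P> (nu S c')"
        using a c' by (auto intro: pE_mono)
    qed (use F c' in \<open>auto simp: c'_def\<close>)
    ultimately show "?P (elt 1 1 0 1 1 ** elt 1 a b c (- a) ** iv (elt 1 1 0 1 1))"
      by (simp only:)
  qed
  have bc: "a \<noteq> 0 \<or> b \<noteq> 0 \<and> c \<noteq> 0"
    using q by auto
  consider "c \<noteq> 0" "a \<in> \<P> (nu S c)" "b \<in> \<P> (nu S c)"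
    | "b \<noteq> 0" "a \<in> \<P> (nu S b)" "c \<in> \<P> (nu S b)"
    | "a \<noteq> 0" "b \<in> \<P> (nu S a + 1)" "c \<in> \<P> (nu S a + 1)"
    using bc unfolding pE_def by (cases "a = 0"; cases "b = 0"; cases "c = 0") (auto, linarith+)
  then show ?thesis
  proof cases
    case 1
    then show ?thesis using lower[OF F q(1)] by blast
  qed (use upper middle in blast)+
qed

end

section \<open>Straightened representatives: correction by the torus and the test for
  intertwining\<close>

context torus_setting
begin

text \<open>Trace and determinant of \<open>\<Gamma>0\<close> survive conjugation by
  \<open>g\<close>, so \<open>antidiagonalize\<close> applies with
  \<open>q = g1 * g2\<close>.\<close>

lemma exists_straight:
  assumes "g \<in> carrier (U S)"
  obtains k \<beta> \<gamma> where "k \<in> Kmax S" "straight (k ** g) \<beta> \<gamma>" "nu S \<gamma> \<le> nu S \<beta>"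
proof -
  obtain a b c d where F: "a \<in> F" "b \<in> F" "c \<in> F" "d \<in> F"
    and eq: "\<And>l. g ** elt l 0 g1 g2 0 ** iv g = elt l a b c d"
    by (rule conj_elt[OF assms, of 0 g1 g2 0]) auto
  have tr: "trace (g ** X ** iv g) = trace X" for X
    using trace_mul_sym[of "g ** X" "iv g"] assms by (simp add: matrix_mul_assoc)
  have dg: "det g * det (iv g) = 1"
    using det_mul[of g "iv g"] assms by simp
  have dt': "det (g ** X ** iv g) = det X" for X
    using dg by (simp add: det_mul)
  have "a + d = 0"
    using tr[of "elt 1 0 g1 g2 0"] by (simp add: eq) (simp add: elt_def trace_mat2)
  then have d: "d = - a"
    by (simp add: add_eq_0_iff)
  have "det (elt 1 a b c d) = det (elt 1 0 g1 g2 0)"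
    using dt'[of "elt 1 0 g1 g2 0"] by (simp add: eq)
  then have "a\<^sup>2 + rt\<^sup>2 * (b * c) = rt\<^sup>2 * (g1 * g2)"
    by (simp add: elt_def det_mat2 d algebra_simps power2_eq_square)
  from antidiagonalize[OF F(1-3) this] obtain k \<beta> \<gamma> where
    k: "k \<in> Kmax S" "\<beta> \<in> F" "\<gamma> \<in> F" "\<beta> * \<gamma> = g1 * g2" "nu S \<gamma> \<le> nu S \<beta>"
      "k ** elt 1 a b c (-a) ** iv k = elt 1 0 \<beta> \<gamma> 0"
    by auto
  have "(k ** g) ** \<Gamma>0 ** iv (k ** g) = k ** (g ** \<Gamma>0 ** iv g) ** iv k"
    using k assms by (simp add: iv_mult matrix_mul_assoc)
  also have "\<dots> = elt 1 0 \<beta> \<gamma> 0"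
    unfolding \<Gamma>0_def eq d k(6) ..
  finally show thesis
    using that[of k \<beta> \<gamma>] k assms by (simp add: straight_def)
qed

lemma straight_nonzero: "straight g \<beta> \<gamma> \<Longrightarrow> \<beta> \<noteq> 0 \<and> \<gamma> \<noteq> 0"
  using g12 by (metis mult_eq_0_iff straight_def)

lemma straight_nu: "straight g \<beta> \<gamma> \<Longrightarrow> nu S \<beta> + nu S \<gamma> = - \<rho>"
  using straight_nonzero[of g \<beta> \<gamma>] nu_mult[of \<beta> \<gamma>] nu_g1g2 by (simp add: straight_def)

text \<open>The element \<open>t\<close> is chosen so that the lower left entry of \<open>g X t g\<^sup>-\<^sup>1\<close> vanishes.\<close>

lemma torus_correction_straight:
  assumes g: "straight g \<beta> \<gamma>" "nu S \<gamma> \<le> nu S \<beta>" and X: "X \<in> Gfil S y s"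
  obtains t where "t \<in> T" "t \<in> Gfil S y s" "g ** (X ** t) ** iv g \<in> Kmax S"
proof -
  have gU: "g \<in> carrier (U S)" and bF: "\<beta> \<in> F" "\<gamma> \<in> F" and bg: "\<beta> * \<gamma> = g1 * g2"
    and gG: "g ** \<Gamma>0 ** iv g = elt 1 0 \<beta> \<gamma> 0"
    using g by (auto simp: straight_def)
  have nz: "\<beta> \<noteq> 0" "\<gamma> \<noteq> 0" using straight_nonzero g by auto
  have XU: "X \<in> carrier (U S)" using X by (rule Gfil_U)
  obtain l a b c d where F: "a \<in> F" "b \<in> F" "c \<in> F" "d \<in> F" and l: "l \<noteq> 0" "nu S l = 0"
    and norm: "l * bar S l * dt a b c d = 1" and Xe: "X = elt l a b c d"
    by (rule elt_obtain[OF XU])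
  obtain A B C D where F': "A \<in> F" "B \<in> F" "C \<in> F" "D \<in> F"
    and eq: "\<And>l. g ** elt l a b c d ** iv g = elt l A B C D"
    by (rule conj_elt[OF gU F]) auto
  note inv = conj_invariants[OF g(1) F F' eq]
  have fil: "l * a - 1 \<in> \<P> e" "l * d - 1 \<in> \<P> e" "g2 * b \<in> \<P> f" "g1 * c \<in> \<P> f"
    using X Gfil_elt[of l a b c d] XU l by (auto simp: Xe)
  have "l * (a - d) = (l * a - 1) - (l * d - 1)"
    by (simp add: algebra_simps)
  then have "l * (a - d) \<in> \<P> e"
    using fil pE_diff by metis
  then have "a - d \<in> \<P> e"
    using l by (simp add: pE_mult_iff)
  then have d: "\<beta> * C - \<gamma> * B \<in> \<P> f" and AD: "A - D \<in> \<P> e"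
    using inv(3)[of e f] fil pE_diff by auto
  have "\<beta> * C + \<gamma> * B \<in> \<P> f"
    using inv(2) fil pE_add by metis
  note bC = pE_sum_diff(1)[OF this d] and gB = pE_sum_diff(2)[OF this d]
  have "l * (A + D) / 2 - 1 = ((l * a - 1) + (l * d - 1)) / 2"
    using inv(1) by (simp add: field_simps)
  then have tr: "l * (A + D) / 2 - 1 \<in> \<P> e"
    using fil pE_add pE_half by metis
  have "l * (A - D) / 2 \<in> \<P> e"
    using AD l by (simp add: pE_half pE_mult_iff)
  moreover have "l * A - 1 = (l * (A + D) / 2 - 1) + l * (A - D) / 2"
    "l * D - 1 = (l * (A + D) / 2 - 1) - l * (A - D) / 2"
    by (simp_all add: field_simps)
  ultimately have lA: "l * A - 1 \<in> \<P> e" "l * D - 1 \<in> \<P> e"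
    using tr pE_add pE_diff by metis+
  have unit: "x \<noteq> 0 \<and> nu S x = 0" if "x - 1 \<in> \<P> e" for x
  proof -
    have "x - 1 \<in> \<P> 1" using that e_pos pE_mono by blast
    then have "x \<in> \<P> 0 \<and> x \<notin> \<P> 1"
      using pE_add[of "x - 1" 0 1] pE_mono[of "x - 1" 1 0] pE_diff[of x 1 "x - 1"]
      by (auto simp: pE_iff)
    then show ?thesis
      by (auto simp: pE_def)
  qed
  have D: "D \<noteq> 0" "nu S D = 0"
    using unit[OF lA(2)] l by (auto simp: nu_mult)
  have A0: "A \<in> \<P> 0"
    using unit[OF lA(1)] l by (auto simp: nu_mult pE_iff)
  \<comment> \<open>The torus element is to be proportional to 1 + \<zeta> \<open>\<Gamma>0\<close>,
    and conjugation by \<open>g\<close> turns \<open>g1\<close>, \<open>g2\<close> into \<beta>,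
    \<gamma>. The value solves \<open>C + D * (\<zeta> * \<gamma>) = 0\<close>, with
    \<open>D\<close> a unit.\<close>
  define \<zeta> where "\<zeta> = - C / (D * \<gamma>)"
  have \<zeta>: "\<zeta> \<in> F" using F' bF by (simp add: \<zeta>_def)
  define w where "w = \<zeta> * (\<beta> * \<gamma>)"
  have w: "w \<in> \<P> f"
  proof -
    have "w = - (\<beta> * C) / D"
      using nz D by (simp add: w_def \<zeta>_def)
    then show ?thesis
      using bC D by (simp add: pE_divide_iff)
  qed
  have \<zeta>p: "\<zeta> \<in> \<P> (f + \<rho>)"
    using w pE_mult_iff'[of "g1 * g2" \<zeta> f] nu_g1g2 by (simp add: w_def bg)
  have fr: "2 * f + \<rho> \<ge> e"
    using near dual e_pos by auto
  \<comment> \<open>\<open>1 + x\<close> is \<open>dt 1 (\<zeta> * g1) (\<zeta> * g2) 1\<close>, so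
    division by its square root puts \<open>t\<close> into the unitary group.\<close>
  define x where "x = - (rt\<^sup>2 * (\<zeta> * w))"
  have "x \<in> F" "x \<in> \<P> e"
    using \<zeta> bF pE_mult'[OF \<zeta>p w, of e] fr by (auto simp: x_def w_def pE_mult_iff eps_unit)
  then obtain z where z: "z \<in> F" "z \<in> \<P> e" "(1 + z)\<^sup>2 = 1 + x"
    using sqrt_one_plus e_pos by metis
  have z1: "1 + z \<noteq> 0" "nu S (1 + z) = 0"
    using unit[of "1 + z"] z(2) by auto
  define l' where "l' = 1 / (1 + z)"
  have l': "l' \<in> F" "l' \<noteq> 0" "nu S l' = 0"
    using z z1 by (auto simp: l'_def nu_divide)
  define t where "t = elt l' 1 (\<zeta> * g1) (\<zeta> * g2) 1"
  have "l' * bar S l' * dt 1 (\<zeta> * g1) (\<zeta> * g2) 1 = (1 + x) / (1 + z)\<^sup>2"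
    using z by (simp add: l'_def dt_def x_def w_def bg power2_eq_square mult_ac)
  then have tU: "t \<in> carrier (U S)"
    unfolding t_def using z1 z(3) \<zeta> by (intro elt_in_U) auto
  have "t = mat2 l' ((l' * \<zeta> * rt) * g1) ((l' * \<zeta> * rt) * g2) l'"
    by (simp add: t_def elt_def mat2_eq_iff)
  then have tT: "t \<in> T"
    unfolding T_def using tU by blast
  have "l' - 1 = - (z / (1 + z))"
    using z1 by (simp add: l'_def field_simps)
  then have "l' - 1 \<in> \<P> e"
    using z(2) z1 by (simp add: pE_divide_iff)
  moreover have "g2 * (\<zeta> * g1) = w" "g1 * (\<zeta> * g2) = w"
    by (simp_all add: w_def bg)
  ultimately have tG: "t \<in> Gfil S y s"
    using Gfil_elt[of l' 1 "\<zeta> * g1" "\<zeta> * g2" 1] tU l' w by (simp add: t_def)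
  have gt: "g ** t ** iv g = elt l' 1 (\<zeta> * \<beta>) (\<zeta> * \<gamma>) 1"
  proof -
    have sc: "elt l' 1 (\<zeta> * p) (\<zeta> * q) 1 = mat2 l' 0 0 l' + mat2 (l' * \<zeta>) 0 0 (l' * \<zeta>) ** elt 1 0 p q 0" for p q
      by (simp add: elt_def mat2_mult mat2_add mat2_eq_iff)
    have comm: "X ** mat2 k 0 0 k = mat2 k 0 0 k ** X" for X k
      by (rule mat2_cases[of X]) (simp add: mat2_mult mat2_eq_iff mult.commute)
    have "g ** t ** iv g = g ** mat2 l' 0 0 l' ** iv g + g ** mat2 (l' * \<zeta>) 0 0 (l' * \<zeta>) ** \<Gamma>0 ** iv g"
      unfolding t_def sc \<Gamma>0_def by (simp add: matrix_add_ldistrib matrix_add_rdistrib matrix_mul_assoc)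
    also have "\<dots> = mat2 l' 0 0 l' + mat2 (l' * \<zeta>) 0 0 (l' * \<zeta>) ** (g ** \<Gamma>0 ** iv g)"
      using gU by (simp add: comm[of g] matrix_mul_assoc)
    also have "\<dots> = elt l' 1 (\<zeta> * \<beta>) (\<zeta> * \<gamma>) 1"
      unfolding gG sc ..
    finally show ?thesis .
  qed
  have zC: "C + D * (\<zeta> * \<gamma>) = 0"
    using D nz by (simp add: \<zeta>_def)
  have "g ** (X ** t) ** iv g = (g ** X ** iv g) ** (g ** t ** iv g)"
    using gU by (simp add: matrix_mul_assoc)
  also have "\<dots> = elt (l * l') (A + rt\<^sup>2 * (B * (\<zeta> * \<gamma>))) (A * (\<zeta> * \<beta>) + B) 0 (rt\<^sup>2 * (C * (\<zeta> * \<beta>)) + D)"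
    unfolding gt Xe eq elt_mult using zC by simp
  finally have prod: "g ** (X ** t) ** iv g = \<dots>" .
  \<comment> \<open>Since the valuations of \<beta> and \<gamma> add up to \<open>- \<rho>\<close>,
    the ordering gives \<open>2 * nu S \<gamma> \<le> - \<rho>\<close>. So the upper right entry
    stays integral after division by \<gamma>.\<close>
  have R: "f - nu S \<gamma> \<ge> 0" 
    using straight_nu[OF g(1)] g(2) near dual e_pos by auto
  have f0: "f + (f + \<rho>) \<ge> 0"
    using fr e_pos by simp
  have e1: "B * (\<zeta> * \<gamma>) \<in> \<P> 0"
    using pE_mult'[OF gB \<zeta>p f0] by (simp add: mult_ac)
  have e2: "C * (\<zeta> * \<beta>) \<in> \<P> 0"
    using pE_mult'[OF bC \<zeta>p f0] by (simp add: mult_ac)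
  have e3: "A * (\<zeta> * \<beta>) + B \<in> \<P> 0"
  proof -
    have "A * w \<in> \<P> f"
      using pE_mult[OF A0 w] by simp
    then have "A * w + \<gamma> * B \<in> \<P> f"
      using gB by (rule pE_add)
    moreover have "A * w + \<gamma> * B = \<gamma> * (A * (\<zeta> * \<beta>) + B)"
      by (simp add: w_def algebra_simps)
    ultimately have "A * (\<zeta> * \<beta>) + B \<in> \<P> (f - nu S \<gamma>)"
      using nz by (simp add: pE_mult_iff)
    then show ?thesis
      using R by (rule pE_mono)
  qed
  have "g ** (X ** t) ** iv g \<in> carrier (U S)"
    using gU XU tU by simp
  then have "g ** (X ** t) ** iv g \<in> Kmax S"
    unfolding prod using l l' A0 D e1 e2 e3
    by (subst Kmax_elt) (auto simp: nu_mult pE_iff[OF D(1)] pE_mult_iff eps_unit intro!: pE_add)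
  then show thesis
    using that tT tG by blast
qed

text \<open>Rewritten, \<open>tw\<close> says that \<open>M0 - x ** M0 ** iv x\<close> pairs
  trivially with the test elements. Each family of tests bounds one entry of this difference. The
  bounds are solved for \<open>x0\<close> and \<open>y0\<close>, which decide membership in
  \<open>J\<close> through \<open>conj_invariants\<close> and \<open>J_elt\<close>.\<close>

lemma intertwining_straight:
  assumes g: "straight g \<beta> \<gamma>" "nu S \<gamma> \<le> nu S \<beta>" and x: "x \<in> Kmax S"
    and tw: "\<And>n. n \<in> Gfil_plus S y s \<Longrightarrow> g ** n ** iv g \<in> Kmax S \<Longrightarrow>
      iv g ** x ** g ** n ** iv (iv g ** x ** g) \<in> Gfil_plus S y s \<Longrightarrow>
      psi S (trace (\<Gamma>0 ** n)) = psi S (trace (\<Gamma>0 ** (iv g ** x ** g ** n ** iv (iv g ** x ** g))))"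
  shows "iv g ** x ** g \<in> J"
proof -
  have gU: "g \<in> carrier (U S)" and bF: "\<beta> \<in> F" "\<gamma> \<in> F" and bg: "\<beta> * \<gamma> = g1 * g2"
    and gG: "g ** \<Gamma>0 ** iv g = elt 1 0 \<beta> \<gamma> 0"
    using g by (auto simp: straight_def)
  have nz [simp]: "\<beta> \<noteq> 0" "\<gamma> \<noteq> 0" using straight_nonzero g by auto
  define R where "R = - nu S \<gamma>"
  define d0 where "d0 = nu S \<beta> + R"
  \<comment> \<open>As \<open>fp = 1 - e\<close>, this is the exponent for which
    \<open>B \<in> \<P> k\<close> amounts to \<open>\<gamma> * B \<in> \<P> fp\<close>.\<close>
  define k where "k = R + 1 - e"
  have nus: "nu S \<gamma> = - R" "nu S \<beta> = d0 - R" "d0 \<ge> 0" "2 * R = \<rho> + d0"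
    using g(2) straight_nu[OF g(1)] by (auto simp: R_def d0_def)
  have km: "ep \<le> k" "k - ep \<le> d0" "k \<le> R"
    using near nus(3,4) e_pos by (auto simp: k_def)
  have fk: "fp = k - R" "f = 1 - ep"
    using dual by (simp_all add: k_def)
  \<comment> \<open>Integral elements that conjugation by \<open>iv g\<close> carries into
    \<open>Gfil_plus S y s\<close>. For the lower left entry \<open>ep\<close> is enough, because
    \<open>k - ep \<le> d0\<close>.\<close>
  define NN where "NN = {n \<in> Kmax S. n $ 1 $ 1 - 1 \<in> \<P> ep \<and> n $ 2 $ 2 - 1 \<in> \<P> ep \<and>
    n $ 1 $ 2 \<in> \<P> k \<and> n $ 2 $ 1 \<in> \<P> ep}"
  have ivg: "iv g \<in> carrier (U S)" "iv (iv g) = g" using gU by auto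
  have pull: "\<exists>a\<in>F. \<exists>b\<in>F. \<exists>c\<in>F. \<exists>d\<in>F. (\<forall>l. iv g ** elt l A B C D ** g = elt l a b c d) \<and>
      g ** elt 1 a b c d ** iv g = elt 1 A B C D"
    if ABCD: "A \<in> F" "B \<in> F" "C \<in> F" "D \<in> F" for A B C D
  proof -
    obtain a b c d where *: "a \<in> F" "b \<in> F" "c \<in> F" "d \<in> F"
      "\<And>l. iv g ** elt l A B C D ** iv (iv g) = elt l a b c d"
      by (rule conj_elt[OF ivg(1) ABCD]) auto
    moreover have "g ** elt 1 a b c d ** iv g = elt 1 A B C D"
      unfolding *(5)[symmetric] using gU by (simp add: matrix_mul_assoc)
    ultimately show ?thesis
      unfolding ivg(2) by blast
  qed
  have NN_fil: "iv g ** n ** g \<in> Gfil_plus S y s" if n: "n \<in> NN" for n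
  proof -
    have nU: "n \<in> carrier (U S)" using n by (auto simp: NN_def)
    obtain l A B C D where F': "A \<in> F" "B \<in> F" "C \<in> F" "D \<in> F" and l: "l \<noteq> 0" "nu S l = 0"
      and norm: "l * bar S l * dt A B C D = 1" and ne: "n = elt l A B C D"
      by (rule elt_obtain[OF nU])
    obtain a b c d where F: "a \<in> F" "b \<in> F" "c \<in> F" "d \<in> F"
      and eq: "\<forall>l. iv g ** elt l A B C D ** g = elt l a b c d"
      and eq': "g ** elt 1 a b c d ** iv g = elt 1 A B C D"
      using pull[OF F'] by blast
    note inv = conj_invariants[OF g(1) F F' eq']
    have N: "l * A - 1 \<in> \<P> ep" "l * D - 1 \<in> \<P> ep" "B \<in> \<P> k" "C \<in> \<P> ep"
      using n l by (auto simp: NN_def ne pE_mult_iff pE_rt)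
    have bC: "\<beta> * C \<in> \<P> fp"
      using N(4) km nus fk by (auto simp: pE_mult_iff intro: pE_mono)
    have gB: "\<gamma> * B \<in> \<P> fp"
      using N(3) nus fk by (auto simp: pE_mult_iff)
    have "l * (A - D) = (l * A - 1) - (l * D - 1)"
      by (simp add: algebra_simps)
    then have "l * (A - D) \<in> \<P> ep"
      using N pE_diff by metis
    then have "A - D \<in> \<P> ep"
      using l by (simp add: pE_mult_iff)
    then have cd: "g1 * c - g2 * b \<in> \<P> fp" "a - d \<in> \<P> ep"
      using inv(3)[of ep fp] pE_diff[OF bC gB] by auto
    have sum: "g1 * c + g2 * b \<in> \<P> fp"
      using inv(2) pE_add[OF bC gB] by simp
    note cb = pE_sum_diff[OF sum cd(1)]
    have "l * (a + d) / 2 - 1 = ((l * A - 1) + (l * D - 1)) / 2"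
      unfolding inv(1)[symmetric] by (simp add: field_simps)
    then have tr: "l * (a + d) / 2 - 1 \<in> \<P> ep"
      using N pE_add pE_half by metis
    have "l * (a - d) / 2 \<in> \<P> ep"
      using cd l by (simp add: pE_half pE_mult_iff)
    moreover have "l * a - 1 = (l * (a + d) / 2 - 1) + l * (a - d) / 2"
      "l * d - 1 = (l * (a + d) / 2 - 1) - l * (a - d) / 2"
      by (simp_all add: field_simps)
    ultimately have la: "l * a - 1 \<in> \<P> ep" "l * d - 1 \<in> \<P> ep"
      using tr pE_add pE_diff by metis+
    have "iv g ** n ** g \<in> carrier (U S)"
      using gU nU by simp
    then show ?thesis
      using Gfil_plus_elt[of l a b c d] l la cb by (simp add: ne eq)
  qed
  have Kc_NN: "n \<in> NN" if "n \<in> Kc k" for n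
  proof -
    have "n \<in> Kmax S" and n: "n - mat 1 \<in> MP k" using that by (auto simp: Kc_def)
    then show ?thesis
      using km by (auto simp: NN_def MP_def forall_2 mat_1_mat2 intro: pE_mono)
  qed
  have xU: "x \<in> carrier (U S)" using x by simp
  obtain l A B C D where F: "A \<in> F" "B \<in> F" "C \<in> F" "D \<in> F" and l: "l \<noteq> 0" "nu S l = 0"
    and norm: "l * bar S l * dt A B C D = 1" and xe: "x = elt l A B C D"
    by (rule elt_obtain[OF xU])
  have int: "A \<in> \<P> 0" "B \<in> \<P> 0" "C \<in> \<P> 0" "D \<in> \<P> 0"
    using x xU l Kmax_elt[of l A B C D] by (auto simp: xe)
  define n where "n = l * bar S l"
  have n: "n \<in> F" "n \<noteq> 0" "nu S n = 0"
    using l by (auto simp: n_def nu_mult)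
  have nD: "n * (A * D) = 1 + n * (rt\<^sup>2 * (B * C))"
    using norm by (simp add: n_def dt_def algebra_simps)
  define x0 where "x0 = \<beta> * C - \<gamma> * B"
  define y0 where "y0 = A - D"
  \<comment> \<open>By \<open>Z\<close> these are the entries of
    \<open>M0 - x ** M0 ** iv x\<close>; the relation \<open>nD\<close> makes them linear in
    \<open>x0\<close> and \<open>y0\<close>.\<close>
  define z1 where "z1 = n * (rt\<^sup>2 * (x0 * D + \<beta> * y0 * C))"
  define z2 where "z2 = n * (- \<beta> * A * y0 - rt\<^sup>2 * (B * x0))"
  define z3 where "z3 = n * (\<gamma> * D * y0 + rt\<^sup>2 * (C * x0))"
  define M0 where "M0 = elt 1 0 \<beta> \<gamma> 0"
  have xyF: "x0 \<in> F" "y0 \<in> F"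
    using F bF by (auto simp: x0_def y0_def)
  have zF: "z1 \<in> F" "z2 \<in> F" "z3 \<in> F"
    using F bF n xyF by (auto simp: z1_def z2_def z3_def)
  have Z: "M0 - x ** M0 ** iv x = elt 1 z1 z2 z3 (- z1)"
  proof -
    have ivx: "iv x = elt (bar S l) D (-B) (-C) A"
      unfolding xe using F norm by (rule iv_elt)
    have sc: "elt (l * 1 * bar S l) a b c d = elt 1 (n * a) (n * b) (n * c) (n * d)" for a b c d
      by (simp add: elt_def n_def mult.assoc)
    have "\<beta> - n * (rt\<^sup>2 * (B * \<gamma>) * - B + A * \<beta> * A) = \<beta> * (1 + n * (rt\<^sup>2 * (B * C)) - n * (A * D)) + z2"
      by (simp add: z2_def x0_def y0_def algebra_simps)
    then have 2: "\<beta> - n * (rt\<^sup>2 * (B * \<gamma>) * - B + A * \<beta> * A) = z2"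
      using nD by simp
    have "\<gamma> - n * (D * \<gamma> * D + rt\<^sup>2 * (C * \<beta>) * - C) = \<gamma> * (1 + n * (rt\<^sup>2 * (B * C)) - n * (A * D)) + z3"
      by (simp add: z3_def x0_def y0_def algebra_simps)
    then have 3: "\<gamma> - n * (D * \<gamma> * D + rt\<^sup>2 * (C * \<beta>) * - C) = z3"
      using nD by simp
    show ?thesis
      unfolding M0_def ivx unfolding xe elt_mult sc 2[symmetric] 3[symmetric]
      by (simp add: elt_def mat2_diff mat2_eq_iff z1_def x0_def y0_def algebra_simps)
  qed
  have test: "psi S (trace (elt 1 z1 z2 z3 (- z1) ** n1)) = 1"
    if n1: "n1 \<in> NN" "iv x ** n1 ** x \<in> NN" for n1
  proof -
    have n1U: "n1 \<in> carrier (U S)" using n1 by (auto simp: NN_def)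
    define h where "h = iv g ** x ** g"
    \<comment> \<open>\<open>tw\<close> is applied to the pullback of
      \<open>iv x ** n1 ** x\<close>, so that both elements compared come from
      \<open>NN\<close>.\<close>
    define m where "m = iv g ** (iv x ** n1 ** x) ** g"
    have hm: "h ** m ** iv h = iv g ** n1 ** g"
      using gU xU by (simp add: h_def m_def iv_mult matrix_mul_assoc)
    have "g ** m ** iv g = iv x ** n1 ** x"
      using gU by (simp add: m_def matrix_mul_assoc)
    then have "g ** m ** iv g \<in> Kmax S"
      using n1(2) by (simp add: NN_def)
    then have "psi S (trace (\<Gamma>0 ** m)) = psi S (trace (\<Gamma>0 ** (h ** m ** iv h)))"
      unfolding h_def using NN_fil[OF n1(2)] NN_fil[OF n1(1)] hm
      by (intro tw) (auto simp: m_def h_def)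
    moreover have tr: "trace (\<Gamma>0 ** (iv g ** Y ** g)) = trace (M0 ** Y)" for Y
      using trace_mul_sym[of "\<Gamma>0 ** iv g ** Y" g] by (simp add: M0_def gG[symmetric] matrix_mul_assoc)
    ultimately have "psi S (trace (M0 ** (iv x ** n1 ** x))) = psi S (trace (M0 ** n1))"
      unfolding hm by (simp add: m_def tr)
    moreover have "trace (M0 ** (iv x ** n1 ** x)) = trace (x ** M0 ** iv x ** n1)"
      using trace_mul_sym[of "M0 ** iv x ** n1" x] by (simp add: matrix_mul_assoc)
    moreover have "trace (M0 ** n1) = trace (elt 1 z1 z2 z3 (- z1) ** n1) + trace (x ** M0 ** iv x ** n1)"
      unfolding Z[symmetric] matrix_diff_rdistrib trace_sub by simp
    ultimately show ?thesis
      by (simp add: psi_add)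
  qed
  have testK: "psi S (trace (elt 1 z1 z2 z3 (- z1) ** n1)) = 1" if "n1 \<in> Kc k" for n1
    using test[of n1] Kc_NN[OF that] Kc_NN[OF Kc_conj[OF that, of "iv x"]] x by simp
  have k1: "k \<ge> 1" using km e_pos by linarith
  have Kc_elt: "elt 1 a b c d \<in> Kc k"
    if "elt 1 a b c d \<in> carrier (U S)" "a - 1 \<in> \<P> k" "b \<in> \<P> k" "c \<in> \<P> k" "d - 1 \<in> \<P> k" for a b c d
  proof -
    have "a \<in> \<P> 0" "d \<in> \<P> 0" "b \<in> \<P> 0" "c \<in> \<P> 0"
      using that pE_add[of "a - 1" 0 1] pE_add[of "d - 1" 0 1] k1 pE_mono by force+
    then have "elt 1 a b c d \<in> Kmax S"
      using that by (simp add: Kmax_elt)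
    then show ?thesis
      using that by (simp add: Kc_def MP_def forall_2 mat_1_mat2 pE_rt)
  qed
  have "rt\<^sup>2 * z3 \<in> \<P> (1 - k)"
  proof (rule psi_trivial_imp)
    fix w assume w: "w \<in> F" "w \<in> \<P> k"
    have "psi S (trace (elt 1 z1 z2 z3 (- z1) ** elt 1 1 w 0 1)) = 1"
      using w by (intro testK Kc_elt) (auto simp: iv_unipotent)
    then show "psi S (rt\<^sup>2 * z3 * w) = 1"
      by (simp add: elt_mult) (simp add: elt_def trace_mat2 mult.assoc)
  qed (use zF in auto)
  then have z3: "z3 \<in> \<P> (1 - k)"
    by (simp add: pE_mult_iff eps_unit)
  have "rt\<^sup>2 * z2 \<in> \<P> (1 - k)"
  proof (rule psi_trivial_imp)
    fix w assume w: "w \<in> F" "w \<in> \<P> k"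
    have "psi S (trace (elt 1 z1 z2 z3 (- z1) ** elt 1 1 0 w 1)) = 1"
      using w by (intro testK Kc_elt) (auto simp: iv_unipotent)
    then show "psi S (rt\<^sup>2 * z2 * w) = 1"
      by (simp add: elt_mult) (simp add: elt_def trace_mat2 mult.assoc)
  qed (use zF in auto)
  then have z2: "z2 \<in> \<P> (1 - k)"
    by (simp add: pE_mult_iff eps_unit)
  have diag: "elt 1 \<alpha> 0 0 \<alpha>' \<in> carrier (U S)" if "\<alpha> \<in> F" "\<alpha>' \<in> F" "\<alpha> * \<alpha>' = 1" for \<alpha> \<alpha>'
    using that by (intro elt_in_U) (auto simp: dt_def)
  have trd: "trace (elt 1 z1 z2 z3 (- z1) ** elt 1 \<alpha> 0 0 \<alpha>') = z1 * (\<alpha> - \<alpha>')" for \<alpha> \<alpha>'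
    by (simp add: elt_mult) (simp add: elt_def trace_mat2 algebra_simps)
  have z1: "z1 \<in> \<P> (1 - k)"
  proof (rule psi_trivial_imp)
    fix w assume w: "w \<in> F" "w \<in> \<P> k"
    obtain \<alpha> \<alpha>' where \<alpha>: "\<alpha> \<in> F" "\<alpha>' \<in> F" "\<alpha> * \<alpha>' = 1" "\<alpha> - \<alpha>' = w" "\<alpha> - 1 \<in> \<P> k" "\<alpha>' - 1 \<in> \<P> k"
      by (rule diagonal_with_difference[OF w k1])
    have "psi S (trace (elt 1 z1 z2 z3 (- z1) ** elt 1 \<alpha> 0 0 \<alpha>')) = 1"
      using \<alpha> diag by (intro testK Kc_elt) auto
    then show "psi S (z1 * w) = 1"
      unfolding trd \<alpha>(4) .
  qed (use zF in auto)
  have x0: "x0 \<in> \<P> (1 - k)"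
  proof -
    \<comment> \<open>Eliminates \<open>y0\<close> from the linear system; the bracket on the left
      is 1 by \<open>nD\<close>. The same is done below to eliminate \<open>x0\<close>.\<close>
    have "rt\<^sup>2 * x0 * (n * (A * D) - n * (rt\<^sup>2 * (B * C))) = z1 * A + rt\<^sup>2 * (z2 * C)"
      by (simp add: z1_def z2_def algebra_simps power2_eq_square)
    then have "rt\<^sup>2 * x0 = z1 * A + rt\<^sup>2 * (z2 * C)"
      using nD by simp
    moreover have "z1 * A \<in> \<P> (1 - k)" "rt\<^sup>2 * (z2 * C) \<in> \<P> (1 - k)"
      using pE_mult[OF z1 int(1)] pE_mult[OF z2 int(3)] by (auto simp: pE_mult_iff eps_unit)
    ultimately have "rt\<^sup>2 * x0 \<in> \<P> (1 - k)"
      using pE_add by metis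
    then show ?thesis
      by (simp add: pE_mult_iff eps_unit)
  qed
  have gy: "\<gamma> * y0 \<in> \<P> (1 - k)"
  proof -
    have "\<gamma> * y0 * (n * (A * D) - n * (rt\<^sup>2 * (B * C))) = z3 * A - z1 * C"
      by (simp add: z1_def z3_def x0_def y0_def algebra_simps power2_eq_square)
    then have "\<gamma> * y0 = z3 * A - z1 * C"
      using nD by simp
    moreover have "z3 * A \<in> \<P> (1 - k)" "z1 * C \<in> \<P> (1 - k)"
      using pE_mult[OF z3 int(1)] pE_mult[OF z1 int(3)] by auto
    ultimately show ?thesis
      using pE_diff by metis
  qed
  \<comment> \<open>Here \<open>1 - k + R\<close> is exactly \<open>e\<close>, so this coordinate
    needs no further test.\<close>
  then have y0: "y0 \<in> \<P> e"
    using nus by (simp add: pE_mult_iff k_def)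
  \<comment> \<open>The congruence subgroup only gives the exponent \<open>1 - k\<close>; diagonal elements \<open>diag(\<alpha>, \<alpha>\<^sup>-\<^sup>1)\<close> give
    the missing \<open>k - ep\<close>.\<close>
  have x0': "x0 \<in> \<P> (1 - ep)"
  proof (cases "k = ep")
    case True
    then show ?thesis using x0 by simp
  next
    case False
    then have d0: "d0 \<ge> 1" "k > ep" using km by auto
    \<comment> \<open>In \<open>z1\<close> the term with \<open>y0\<close> is already small, by
      \<open>k - ep \<le> d0\<close>, so a bound on \<open>z1\<close> becomes a bound on
      \<open>x0 * D\<close>.\<close>
    have by0: "\<beta> * y0 * C \<in> \<P> (1 - ep)"
    proof -
      have "\<beta> * y0 \<in> \<P> (d0 - R + e)"
        using y0 nus by (simp add: pE_mult_iff)
      from pE_mult[OF this int(3)] show ?thesis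
        using km by (auto simp: k_def intro: pE_mono)
    qed
    have bC: "\<beta> * C \<in> \<P> (d0 - R)"
      using int(3) nus by (simp add: pE_mult_iff)
    have gB: "\<gamma> * B = \<beta> * C - x0"
      by (simp add: x0_def)
    \<comment> \<open>\<open>d0 \<ge> 1\<close> and \<open>k \<le> R\<close> put both terms into
      \<open>\<P> (1 - R)\<close>. Then \<open>B\<close> lies in the maximal ideal, and
      \<open>D\<close> has to be a unit.\<close>
    have "\<gamma> * B \<in> \<P> (1 - R)"
      unfolding gB using bC x0 d0 km by (intro pE_diff) (auto intro: pE_mono)
    then have B1: "B \<in> \<P> 1"
      using nus by (simp add: pE_mult_iff)
    have D: "D \<noteq> 0" "nu S D = 0"
    proof -
      have "D \<notin> \<P> 1"
      proof
        assume D1: "D \<in> \<P> 1"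
        have "A * D \<in> \<P> 1" "B * C \<in> \<P> 1"
          using pE_mult[OF int(1) D1] pE_mult[OF B1 int(3)] by simp_all
        then have "n * (A * D) - n * (rt\<^sup>2 * (B * C)) \<in> \<P> 1"
          using n by (intro pE_diff) (auto simp: pE_mult_iff eps_unit)
        then show False
          using nD by (simp add: pE_iff)
      qed
      then show "D \<noteq> 0" "nu S D = 0"
        using int(4) by (auto simp: pE_def)
    qed
    \<comment> \<open>The second condition on \<open>\<mu>\<close> keeps the conjugate of \<open>diag(\<alpha>, \<alpha>\<^sup>-\<^sup>1)\<close> by \<open>x\<close> in \<open>NN\<close>.\<close>
    have key: "x0 \<in> \<P> (1 - \<mu>)" if \<mu>: "\<mu> \<ge> ep" "B * D \<in> \<P> (k - \<mu>)" for \<mu>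
    proof -
      have "z1 \<in> \<P> (1 - \<mu>)"
      proof (rule psi_trivial_imp)
        fix w assume w: "w \<in> F" "w \<in> \<P> \<mu>"
        have "\<mu> \<ge> 1" using \<mu> e_pos by linarith
        then obtain \<alpha> \<alpha>' where \<alpha>: "\<alpha> \<in> F" "\<alpha>' \<in> F" "\<alpha> * \<alpha>' = 1" "\<alpha> - \<alpha>' = w" "\<alpha> - 1 \<in> \<P> \<mu>" "\<alpha>' - 1 \<in> \<P> \<mu>"
          using diagonal_with_difference[OF w] by blast
        let ?n1 = "elt 1 \<alpha> 0 0 \<alpha>'"
        have n1U: "?n1 \<in> carrier (U S)" using \<alpha> by (intro diag)
        have \<alpha>ep: "\<alpha> - 1 \<in> \<P> ep" "\<alpha>' - 1 \<in> \<P> ep"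
          using \<alpha> \<mu> pE_mono by blast+
        have \<alpha>0: "\<alpha> \<in> \<P> 0" "\<alpha>' \<in> \<P> 0"
          using pE_add[of "\<alpha> - 1" 0 1] pE_add[of "\<alpha>' - 1" 0 1] \<alpha>ep e_pos pE_mono by force+
        have K1: "?n1 \<in> Kmax S"
          using n1U \<alpha>0 by (simp add: Kmax_elt)
        have N1: "?n1 \<in> NN"
          using K1 \<alpha>ep by (simp add: NN_def)
        have sc: "elt (bar S l * 1 * l) a b c d = elt 1 (n * a) (n * b) (n * c) (n * d)" for a b c d
          by (simp add: elt_def n_def mult_ac)
        have conj: "iv x ** ?n1 ** x = elt 1 (1 + n * (A * D * (\<alpha> - 1) - rt\<^sup>2 * (B * C * (\<alpha>' - 1)))) (n * (B * D * w))
            (n * (- (A * C) * w)) (1 + n * (A * D * (\<alpha>' - 1) - rt\<^sup>2 * (B * C * (\<alpha> - 1))))"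
        proof -
          have ivx: "iv x = elt (bar S l) D (-B) (-C) A"
            unfolding xe using F norm by (rule iv_elt)
          have d1: "n * (D * \<alpha> * A + rt\<^sup>2 * (- B * \<alpha>' * C)) = 1 + n * (A * D * (\<alpha> - 1) - rt\<^sup>2 * (B * C * (\<alpha>' - 1)))"
            using nD by (simp add: algebra_simps)
          have d2: "n * (rt\<^sup>2 * (- C * \<alpha> * B) + A * \<alpha>' * D) = 1 + n * (A * D * (\<alpha>' - 1) - rt\<^sup>2 * (B * C * (\<alpha> - 1)))"
            using nD by (simp add: algebra_simps)
          show ?thesis
            unfolding ivx unfolding xe elt_mult sc
            by (simp add: d1[symmetric] d2[symmetric]) (simp add: \<alpha>(4)[symmetric] algebra_simps)
        qed
        have pr: "p * q * z \<in> \<P> ep" if "p \<in> \<P> 0" "q \<in> \<P> 0" "z \<in> \<P> ep" for p q z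
          using pE_mult[OF pE_mult[OF that(1,2)] that(3)] by simp
        have "iv x ** ?n1 ** x \<in> Kmax S"
          using K1 x by simp
        moreover have "A * D * (\<alpha> - 1) \<in> \<P> ep" "A * D * (\<alpha>' - 1) \<in> \<P> ep"
          "B * C * (\<alpha>' - 1) \<in> \<P> ep" "B * C * (\<alpha> - 1) \<in> \<P> ep" "A * C * w \<in> \<P> ep"
          using int by (auto intro!: pr \<alpha>ep pE_mono[OF w(2) \<mu>(1)])
        moreover have "B * D * w \<in> \<P> k"
          using pE_mult[OF \<mu>(2) w(2)] by simp
        ultimately have N2: "iv x ** ?n1 ** x \<in> NN"
          unfolding NN_def conj using n
          by (auto simp: pE_rt pE_mult_iff eps_unit intro!: pE_diff)
        have "psi S (trace (elt 1 z1 z2 z3 (- z1) ** ?n1)) = 1"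
          using N1 N2 by (rule test)
        then show "psi S (z1 * w) = 1"
          unfolding trd \<alpha>(4) .
      qed (use zF in auto)
      then have "x0 * D + \<beta> * y0 * C \<in> \<P> (1 - \<mu>)"
        using n by (simp add: z1_def pE_mult_iff eps_unit)
      moreover have "\<beta> * y0 * C \<in> \<P> (1 - \<mu>)"
        using by0 \<mu> by (auto intro: pE_mono)
      ultimately have "x0 * D \<in> \<P> (1 - \<mu>)"
        using pE_cancel by blast
      then show ?thesis
        using D by (simp add: pE_mult_iff')
    qed
    \<comment> \<open>Bootstrapping: if \<open>nu S B\<close> were smaller, \<open>key\<close> with
      \<open>\<mu> = k - nu S B\<close> would bound \<open>x0\<close>, and through \<open>gB\<close>
      it would push \<gamma> * B beyond its own valuation. With this bound on \<open>B\<close>,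
      \<open>key\<close> applies to the optimal \<open>\<mu> = ep\<close>.\<close>
    have "B \<in> \<P> (k - ep)"
    proof (rule ccontr)
      assume *: "B \<notin> \<P> (k - ep)"
      then have B: "B \<noteq> 0" "nu S B < k - ep"
        by (auto simp: pE_def)
      have "B * D \<in> \<P> (nu S B)"
        using B D by (simp add: pE_iff nu_mult)
      then have "x0 \<in> \<P> (1 - (k - nu S B))"
        using B by (intro key) auto
      then have "\<gamma> * B \<in> \<P> (nu S B - R + 1)"
        unfolding gB using bC B km by (intro pE_diff) (auto intro: pE_mono)
      then show False
        using B nus by (simp add: pE_iff nu_mult)
    qed
    then have "B * D \<in> \<P> (k - ep)"
      using pE_mult[OF _ int(4)] by fastforce
    then show ?thesis
      by (intro key) auto
  qed
  obtain a b c d where F': "a \<in> F" "b \<in> F" "c \<in> F" "d \<in> F"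
    and eq: "\<forall>l. iv g ** elt l A B C D ** g = elt l a b c d"
    and eq': "g ** elt 1 a b c d ** iv g = elt 1 A B C D"
    using pull[OF F] by blast
  have "g1 * c - g2 * b \<in> \<P> f" "a - d \<in> \<P> e"
    using conj_invariants(3)[OF g(1) F' F eq', of e f] x0' y0 fk by (auto simp: x0_def y0_def)
  moreover have "l * bar S l * dt a b c d = 1"
  proof -
    have "det (iv g) * det g = 1"
      using det_mul[of "iv g" g] gU by simp
    then have "det (iv g ** elt 1 A B C D ** g) = det (elt 1 A B C D)"
      by (simp add: det_mul)
    then have "dt a b c d = dt A B C D"
      by (simp add: eq) (simp add: elt_def det_mat2 dt_def algebra_simps power2_eq_square)
    then show ?thesis using norm by simp
  qed
  ultimately have "elt l a b c d \<in> J"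
    using F' l by (intro J_elt)
  then show ?thesis
    by (simp add: xe eq)
qed

end

section \<open>Irreducibility of the Mackey components\<close>

context unitary_setting
begin

lemma Kmax_conj_iff: "k \<in> Kmax S \<Longrightarrow> k ** X ** iv k \<in> Kmax S \<longleftrightarrow> X \<in> Kmax S"
proof
  assume k: "k \<in> Kmax S" and "k ** X ** iv k \<in> Kmax S"
  then have "iv k ** (k ** X ** iv k) ** k \<in> Kmax S" by simp
  then show "X \<in> Kmax S"
    using k by (simp add: matrix_mul_assoc)
qed simp

lemma conj_set_iff:
  assumes "g \<in> carrier (U S)" "x \<in> carrier (U S)"
  shows "x \<in> conj_set S g A \<longleftrightarrow> iv g ** x ** g \<in> A"
proof
  assume "x \<in> conj_set S g A"
  then obtain h where "h \<in> A" "x = g ** h ** iv g" by (auto simp: conj_set_def)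
  then show "iv g ** x ** g \<in> A"
    using assms by (simp add: matrix_mul_assoc)
next
  assume h: "iv g ** x ** g \<in> A"
  have "x = g ** (iv g ** x ** g) ** iv g"
    using assms by (simp add: matrix_mul_assoc)
  then show "x \<in> conj_set S g A"
    using h unfolding conj_set_def by blast
qed

lemma exists_MP: "\<exists>c. X \<in> MP c"
proof
  let ?c = "min (min (nu S (X $ 1 $ 1)) (nu S (X $ 1 $ 2))) (min (nu S (X $ 2 $ 1)) (nu S (X $ 2 $ 2)))"
  show "X \<in> MP ?c"
    by (auto simp: MP_def forall_2 pE_def)
qed

lemma Kc_conj_small:
  assumes "g \<in> carrier (U S)"
  shows "\<exists>n. \<forall>k\<in>Kc n. iv g ** k ** g - mat 1 \<in> MP m"
proof -
  obtain c d where cd: "g \<in> MP c" "iv g \<in> MP d"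
    using exists_MP by blast
  have "iv g ** k ** g - mat 1 \<in> MP m" if "k \<in> Kc (m - c - d)" for k
  proof -
    have "iv g ** (k - mat 1) ** g \<in> MP (d + (m - c - d) + c)"
      using that cd by (intro MP_mult) (auto simp: Kc_def)
    then show ?thesis
      using assms by (simp add: matrix_diff_ldistrib matrix_diff_rdistrib)
  qed
  then show ?thesis by blast
qed

end

context torus_setting
begin

lemma torus_correction:
  assumes g: "g \<in> carrier (U S)" and X: "X \<in> Gfil S y s"
  obtains t where "t \<in> T" "t \<in> Gfil S y s" "g ** (X ** t) ** iv g \<in> Kmax S"
proof -
  obtain k \<beta> \<gamma> where k: "k \<in> Kmax S" "straight (k ** g) \<beta> \<gamma>" "nu S \<gamma> \<le> nu S \<beta>"
    by (rule exists_straight[OF g])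
  obtain t where t: "t \<in> T" "t \<in> Gfil S y s" "(k ** g) ** (X ** t) ** iv (k ** g) \<in> Kmax S"
    by (rule torus_correction_straight[OF k(2,3) X])
  have "(k ** g) ** (X ** t) ** iv (k ** g) = k ** (g ** (X ** t) ** iv g) ** iv k"
    using k g by (simp add: iv_mult matrix_mul_assoc)
  then show thesis
    using that t k Kmax_conj_iff by metis
qed

text \<open>The straightening element \<open>k\<close> cancels out: replacing \<open>g\<close> by
  \<open>k ** g\<close> and \<open>x\<close> by its conjugate leaves \<open>h\<close> unchanged, and
  conjugation by \<open>k\<close> preserves \<open>Kmax S\<close>.\<close>

lemma not_intertwining:
  assumes g: "g \<in> carrier (U S)" and x: "x \<in> Kmax S" and nJ: "iv g ** x ** g \<notin> J"
  defines "h \<equiv> iv g ** x ** g"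
  obtains n where "n \<in> Gfil_plus S y s" "g ** n ** iv g \<in> Kmax S" "h ** n ** iv h \<in> Gfil_plus S y s"
    "psi S (trace (\<Gamma>0 ** n)) \<noteq> psi S (trace (\<Gamma>0 ** (h ** n ** iv h)))"
proof -
  obtain k \<beta> \<gamma> where k: "k \<in> Kmax S" "straight (k ** g) \<beta> \<gamma>" "nu S \<gamma> \<le> nu S \<beta>"
    by (rule exists_straight[OF g])
  have x': "k ** x ** iv k \<in> Kmax S"
    using k x by simp
  have h: "iv (k ** g) ** (k ** x ** iv k) ** (k ** g) = h"
    using k g x by (simp add: iv_mult matrix_mul_assoc h_def)
  have Kc: "(k ** g) ** n ** iv (k ** g) \<in> Kmax S \<longleftrightarrow> g ** n ** iv g \<in> Kmax S" for n
  proof -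
    have "(k ** g) ** n ** iv (k ** g) = k ** (g ** n ** iv g) ** iv k"
      using k g by (simp add: iv_mult matrix_mul_assoc)
    then show ?thesis
      using k(1) Kmax_conj_iff by metis
  qed
  show thesis
    using intertwining_straight[OF k(2,3) x'] nJ that unfolding h Kc h_def[symmetric] by blast
qed

end

lemma half_cases:
  fixes V :: int
  obtains k where "V = 2 * k" | k where "V = 2 * k + 1"
  by (metis evenE oddE)

section \<open>The four tori satisfy the axioms of \<open>torus_setting\<close>\<close>

context unitary_setting
begin

text \<open>The two terms have valuations of different parity, so they can never cancel.\<close>

lemma anisotropic_odd:
  assumes q: "q \<noteq> 0" "odd (nu S q)" and xz: "rt\<^sup>2 * x\<^sup>2 - q * z\<^sup>2 \<in> \<P> n"
  shows "x\<^sup>2 \<in> \<P> n" "q * z\<^sup>2 \<in> \<P> n"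
proof -
  have "rt\<^sup>2 * x\<^sup>2 \<in> \<P> n \<and> q * z\<^sup>2 \<in> \<P> n"
  proof (cases "x = 0 \<or> z = 0")
    case True
    then show ?thesis using xz by auto
  next
    case False
    then have nz: "rt\<^sup>2 * x\<^sup>2 \<noteq> 0" "- (q * z\<^sup>2) \<noteq> 0" using q by auto
    have nu: "nu S (rt\<^sup>2 * x\<^sup>2) = 2 * nu S x" "nu S (- (q * z\<^sup>2)) = nu S q + 2 * nu S z"
      using False q by (simp_all add: nu_mult nu_power)
    have "nu S (rt\<^sup>2 * x\<^sup>2) \<noteq> nu S (- (q * z\<^sup>2))"
      unfolding nu using q by presburger
    then consider "nu S (rt\<^sup>2 * x\<^sup>2) < nu S (- (q * z\<^sup>2))" | "nu S (- (q * z\<^sup>2)) < nu S (rt\<^sup>2 * x\<^sup>2)"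
      by linarith
    then show ?thesis
    proof cases
      case 1
      have "n \<le> nu S (rt\<^sup>2 * x\<^sup>2)"
        by (rule pE_add_dominant[of _ "- (q * z\<^sup>2)"]) (use xz nz 1 in \<open>auto simp: pE_iff\<close>)
      then show ?thesis
        using 1 nz by (auto simp: pE_iff)
    next
      case 2
      have "n \<le> nu S (- (q * z\<^sup>2))"
        by (rule pE_add_dominant[of _ "rt\<^sup>2 * x\<^sup>2"]) (use xz nz 2 in \<open>auto simp: pE_iff\<close>)
      then show ?thesis
        using 2 nz by (auto simp: pE_iff)
    qed
  qed
  then show "x\<^sup>2 \<in> \<P> n" "q * z\<^sup>2 \<in> \<P> n"
    by (simp_all add: pE_mult_iff eps_unit)
qed

text \<open>Here \<open>g1 * g2\<close> is the square of \<open>v\<close>, so the form is minus the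
  norm form in \<open>v * z\<close> and \<open>x\<close>. As \<open>r\<close> is an integer,
  \<open>r / 2\<close> rounded up and down adds up to \<open>r\<close>; this gives
  \<open>f_def\<close>, \<open>fp_def\<close> and the value 0 in \<open>near\<close>.\<close>

lemma torus_setting_unramified:
  assumes v: "v \<in> F" "v \<noteq> 0" and r: "r > 0"
    and \<gamma>: "\<gamma>1 \<in> F" "\<gamma>2 \<in> F" "\<gamma>1 * \<gamma>2 = 1" "nu S \<gamma>1 = - yi" and y: "y = of_int yi"
    and nv: "real_of_int (nu S (v * \<gamma>1)) = - r - y"
  shows "\<exists>e ep f fp \<rho>. torus_setting S (v * \<gamma>1) (v * \<gamma>2) y (r / 2) e ep f fp \<rho>"
proof -
  have nz: "\<gamma>1 \<noteq> 0" "\<gamma>2 \<noteq> 0" using \<gamma>(3) by auto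
  have n2: "nu S \<gamma>2 = yi"
    using nu_mult[OF nz] \<gamma> by simp
  define V where "V = nu S v"
  have rV: "r = - of_int V"
    using nv y v nz \<gamma> by (simp add: nu_mult V_def)
  have n1': "nu S (v * \<gamma>1) = V - yi" "nu S (v * \<gamma>2) = V + yi"
    using v nz \<gamma> n2 by (simp_all add: nu_mult V_def)
  have cf: "\<lceil>r / 2 - y\<rceil> = \<lceil>r / 2\<rceil> - yi" "\<lceil>r / 2 + y\<rceil> = \<lceil>r / 2\<rceil> + yi"
    "\<lfloor>r / 2 - y\<rfloor> = \<lfloor>r / 2\<rfloor> - yi" "\<lfloor>r / 2 + y\<rfloor> = \<lfloor>r / 2\<rfloor> + yi"
    unfolding y by linarith+
  have sum: "\<lceil>r / 2\<rceil> + \<lfloor>r / 2\<rfloor> = - V"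
  proof (rule half_cases[of V])
    fix k assume "V = 2 * k"
    then have "r / 2 = of_int (- k)" using rV by simp
    then show ?thesis using \<open>V = 2 * k\<close> by (simp only: ceiling_of_int floor_of_int)
  next
    fix k assume k: "V = 2 * k + 1"
    then have "r / 2 = - of_int k - 1 / 2" using rV by (simp add: field_simps)
    then have "\<lceil>r / 2\<rceil> = - k" "\<lfloor>r / 2\<rfloor> = - k - 1" by linarith+
    then show ?thesis using k by simp
  qed
  have gg: "(v * \<gamma>1) * (v * \<gamma>2) = v\<^sup>2"
    using \<gamma>(3) by (simp add: power2_eq_square mult_ac)
  have "torus_setting S (v * \<gamma>1) (v * \<gamma>2) y (r / 2) \<lceil>r / 2\<rceil> (\<lfloor>r / 2\<rfloor> + 1) (- \<lfloor>r / 2\<rfloor>) (1 - \<lceil>r / 2\<rceil>) (- 2 * V)"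
  proof unfold_locales
    fix x z n assume *: "x \<in> F" "z \<in> F" "rt\<^sup>2 * x\<^sup>2 - (v * \<gamma>1) * (v * \<gamma>2) * z\<^sup>2 \<in> \<P> n"
    then have "- (rt\<^sup>2 * x\<^sup>2 - v\<^sup>2 * z\<^sup>2) \<in> \<P> n"
      unfolding gg by (simp only: pE_minus)
    then have "(v * z)\<^sup>2 - rt\<^sup>2 * x\<^sup>2 \<in> \<P> n"
      by (simp add: power_mult_distrib)
    from anisotropic_rt[OF _ _ this] show "x\<^sup>2 \<in> \<P> n \<and> (v * \<gamma>1) * (v * \<gamma>2) * z\<^sup>2 \<in> \<P> n"
      unfolding gg using * v by (auto simp: power_mult_distrib)
  qed (use v nz \<gamma> r sum in \<open>auto simp: n1' cf y\<close>)
  then show ?thesis by blast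
qed

text \<open>\<open>r / 2\<close> is 1/4 or 3/4 modulo 1, so the filtration does not jump there:
  \<open>e = ep\<close> and \<open>f = fp\<close>. The parity of \<open>nu S v\<close> decides the
  sign in \<open>near\<close>.\<close>

lemma torus_setting_ramified:
  assumes v: "v \<in> F" "v \<noteq> 0" and r: "r > 0"
    and \<gamma>: "\<gamma>2 \<in> F" "\<gamma>2 \<noteq> 0" "nu S \<gamma>2 = 1"
    and nv: "real_of_int (nu S v) = - r - 1 / 2"
  shows "\<exists>e ep f fp \<rho>. torus_setting S v (v * \<gamma>2) (1 / 2) (r / 2) e ep f fp \<rho>"
proof -
  define V where "V = nu S v"
  have rV: "r = - of_int V - 1 / 2"
    using nv by (simp add: V_def)
  have n2: "nu S (v * \<gamma>2) = V + 1"
    using v \<gamma> by (simp add: nu_mult V_def)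
  have vals: "\<exists>k. \<lceil>r / 2\<rceil> = - k \<and> \<lfloor>r / 2\<rfloor> + 1 = - k \<and>
     \<lceil>r / 2 - 1 / 2\<rceil> + (V + 1) = k + 1 \<and> \<lceil>r / 2 + 1 / 2\<rceil> + V = k + 1 \<and>
     \<lfloor>r / 2 - 1 / 2\<rfloor> + 1 + (V + 1) = k + 1 \<and> \<lfloor>r / 2 + 1 / 2\<rfloor> + 1 + V = k + 1 \<and>
     (V = 2 * k \<or> V = 2 * k + 1)"
  proof (rule half_cases[of V])
    fix k assume k: "V = 2 * k"
    then have "r / 2 = - of_int k - 1 / 4" using rV by (simp add: field_simps)
    then show ?thesis
      using k by (intro exI[of _ k] conjI) linarith+
  next
    fix k assume k: "V = 2 * k + 1"
    then have "r / 2 = - of_int k - 3 / 4" using rV by (simp add: field_simps)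
    then show ?thesis
      using k by (intro exI[of _ k] conjI) linarith+
  qed
  then obtain k where k: "\<lceil>r / 2\<rceil> = - k" "\<lfloor>r / 2\<rfloor> + 1 = - k"
     "\<lceil>r / 2 - 1 / 2\<rceil> + (V + 1) = k + 1" "\<lceil>r / 2 + 1 / 2\<rceil> + V = k + 1"
     "\<lfloor>r / 2 - 1 / 2\<rfloor> + 1 + (V + 1) = k + 1" "\<lfloor>r / 2 + 1 / 2\<rfloor> + 1 + V = k + 1"
     "V = 2 * k \<or> V = 2 * k + 1"
    by blast
  have "torus_setting S v (v * \<gamma>2) (1 / 2) (r / 2) (- k) (- k) (k + 1) (k + 1) (- 2 * V - 1)"
  proof unfold_locales
    fix x z n assume *: "x \<in> F" "z \<in> F" "rt\<^sup>2 * x\<^sup>2 - v * (v * \<gamma>2) * z\<^sup>2 \<in> \<P> n"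
    have "odd (nu S (v * (v * \<gamma>2)))" "v * (v * \<gamma>2) \<noteq> 0"
      using v \<gamma> by (simp_all add: nu_mult)
    from anisotropic_odd[OF this(2,1) *(3)] show "x\<^sup>2 \<in> \<P> n \<and> v * (v * \<gamma>2) * z\<^sup>2 \<in> \<P> n"
      by simp
  qed (use v \<gamma> r k n2 in \<open>auto simp flip: V_def\<close>)
  then show ?thesis by blast
qed

lemma exists_torus_setting:
  assumes par: "(\<gamma>1, \<gamma>2, y) \<in> torus_params S" and r: "r > 0"
    and v: "v \<in> F" "v \<noteq> 0" "real_of_int (nu S (v * \<gamma>1)) = - r - y"
  shows "\<exists>e ep f fp \<rho>. torus_setting S (v * \<gamma>1) (v * \<gamma>2) y (r / 2) e ep f fp \<rho>"
proof -
  consider "\<gamma>1 = 1" "\<gamma>2 = 1" "y = 0" | "\<gamma>1 = inverse (unif S)" "\<gamma>2 = unif S" "y = 1"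
    | "\<gamma>1 = 1" "\<gamma>2 \<in> F" "\<gamma>2 \<noteq> 0" "nu S \<gamma>2 = 1" "y = 1 / 2"
    using par unif eps_unit by (auto simp: torus_params_def nu_mult nu_inverse)
  then show ?thesis
  proof cases
    case 1
    then show ?thesis
      using v r by (intro torus_setting_unramified[where yi = 0]) auto
  next
    case 2
    then show ?thesis
      using v r unif by (intro torus_setting_unramified[where yi = 1]) (auto simp: nu_inverse)
  next
    case 3
    then show ?thesis
      using torus_setting_ramified[OF v(1,2) r 3(2-4)] v(3) unfolding 3(1,5) by simp
  qed
qed

text \<open>The exponent of \<open>Psi\<close> is the trace form with the traceless part of \<Gamma>
  plus a term depending only on the trace, and conjugate elements have equal traces.\<close>

lemma Psi_cong:
  assumes "trace n = trace n'" "psi S (trace (elt 1 0 (v * \<gamma>1) (v * \<gamma>2) 0 ** n)) \<noteq> psi S (trace (elt 1 0 (v * \<gamma>1) (v * \<gamma>2) 0 ** n'))"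
  shows "Psi S (Gam S \<gamma>1 \<gamma>2 u v) n \<noteq> Psi S (Gam S \<gamma>1 \<gamma>2 u v) n'"
proof -
  let ?G = "Gam S \<gamma>1 \<gamma>2 u v" and ?M = "elt 1 0 (v * \<gamma>1) (v * \<gamma>2) 0"
  have e: "trace (?G ** (m - mat 1)) = (u * rt * trace m - trace ?G) + trace (?M ** m)" for m
  proof -
    obtain a b c d where m: "m = mat2 a b c d" by (rule mat2_cases)
    show ?thesis
      unfolding m Gam_def elt_def mat_1_mat2 mat2_diff mat2_mult trace_mat2
      by (simp add: algebra_simps)
  qed
  show ?thesis
    using assms by (simp add: Psi_def e psi_add)
qed

end

lemma dim_one_subspace:
  assumes "vector_space sc" "module.subspace sc W" "vector_space.dim sc W = 1"
    and "module.subspace sc W'" "W' \<subseteq> W"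
  shows "W \<noteq> {0}" "W' = {0} \<or> W' = W"
proof -
  interpret V: vector_space sc by fact
  obtain B where B: "B \<subseteq> W" "V.independent B" "W \<subseteq> V.span B" "card B = V.dim W"
    using V.basis_exists by blast
  then obtain b where b: "B = {b}"
    using assms(3) by (auto simp: card_1_singleton_iff)
  have b0: "b \<noteq> 0"
    using B(2) unfolding b by (simp add: V.dependent_single)
  then show "W \<noteq> {0}"
    using B(1) b by auto
  show "W' = {0} \<or> W' = W"
  proof (cases "W' \<subseteq> {0}")
    case True
    then show ?thesis
      using V.subspace_0[OF assms(4)] by blast
  next
    case False
    then obtain w where w: "w \<in> W'" "w \<noteq> 0" by blast
    then have "w \<in> V.span {b}"
      using assms(5) B(3) b by blast
    then obtain c where c: "w = sc c b"
      by (auto simp: V.span_singleton)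
    then have "sc (inverse c) w = b"
      using w by auto
    then have "b \<in> W'"
      using V.subspace_scale[OF assms(4) w(1)] by metis
    then have "V.span {b} \<subseteq> W'"
      using assms(4) by (intro V.span_minimal) auto
    then show ?thesis
      using B(3) b assms(5) by blast
  qed
qed

text \<open>\<open>g\<close> is an arbitrary element of the group, so every choice of double coset
  representatives is covered.\<close>

theorem theorem5p7:
  fixes S :: "'e::field u11_data"
    and \<gamma>1 \<gamma>2 :: 'e and y r :: real and \<phi> :: "'e mat2 \<Rightarrow> complex"
    and sc :: "complex \<Rightarrow> 'v \<Rightarrow> 'v::ab_group_add" and W :: "'v set"
    and \<rho> :: "'e mat2 \<Rightarrow> 'v \<Rightarrow> 'v" and g :: "'e mat2"
  assumes "unitary_setting S"
    and "datum S \<gamma>1 \<gamma>2 y r \<phi>"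
    and "is_rho S \<gamma>1 \<gamma>2 y r \<phi> sc W \<rho>"
    and "g \<in> carrier (U S)"
  shows "irreducible_rep S (fun_scale sc) (Kmax S)
           (cInd_space S (Kmax S)
              (Kmax S \<inter> conj_set S g (Gfil S y (r/2) <#>\<^bsub>U S\<^esub> torus S \<gamma>1 \<gamma>2))
              W (conj_rep S g \<rho>))
           right_transl"
proof -
  interpret unitary_setting S by fact
  obtain \<Gamma> \<theta> where gen: "generic_elt S \<gamma>1 \<gamma>2 y r \<Gamma>"
    and hat: "is_phi_hat S \<gamma>1 \<gamma>2 y r \<Gamma> \<phi> \<theta>"
    and cases: "if Gfil S y (r/2) = Gfil_plus S y (r/2)
         then vector_space.dim sc W = 1 \<and>
              (\<forall>x \<in> Gfil S y (r/2) <#>\<^bsub>U S\<^esub> torus S \<gamma>1 \<gamma>2. \<forall>w\<in>W. \<rho> x w = sc (\<theta> x) w)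
         else \<exists>\<eta> A \<omega>.
              heisenberg_rep S \<gamma>1 \<gamma>2 y (r/2) \<theta> sc W \<eta> \<and>
              special_lift S \<gamma>1 \<gamma>2 y (r/2) \<theta> sc W \<eta> A \<and>
              weil_rep S \<gamma>1 \<gamma>2 y (r/2) \<theta> sc W A \<omega> \<and>
              (\<forall>g \<in> Gfil S y (r/2). \<forall>t \<in> torus S \<gamma>1 \<gamma>2. \<forall>w\<in>W.
                 \<rho> (g ** t) w = sc (\<phi> t) (\<eta> g (\<omega> (conj_act S \<gamma>1 \<gamma>2 y (r/2) t) w)))"
    and smooth: "smooth_rep S sc (Gfil S y (r/2) <#>\<^bsub>U S\<^esub> torus S \<gamma>1 \<gamma>2) W \<rho>"
    using assms(3) unfolding is_rho_def by (elim exE conjE)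
  have par: "(\<gamma>1, \<gamma>2, y) \<in> torus_params S" and r: "r > 0" and chr: "smooth_char S (torus S \<gamma>1 \<gamma>2) \<phi>"
    using assms(2) by (auto simp: datum_def generic_char_def)
  obtain u v where uv: "u \<in> F" "v \<in> F" "v \<noteq> 0" "\<Gamma> = Gam S \<gamma>1 \<gamma>2 u v"
    "real_of_int (nu S (v * \<gamma>1)) = - r - y"
    using gen by (auto simp: generic_elt_def)
  obtain e ep f fp d where ts: "torus_setting S (v * \<gamma>1) (v * \<gamma>2) y (r / 2) e ep f fp d"
    using exists_torus_setting[OF par r uv(2,3,5)] by blast
  interpret T: torus_setting S "v * \<gamma>1" "v * \<gamma>2" y "r / 2" e ep f fp d
    by (rule ts)
  \<comment> \<open>Multiplying both parameters by \<open>v\<close> only rescales \<open>b\<close>,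
    so the torus is the same.\<close>
  have Tor: "torus S \<gamma>1 \<gamma>2 = T.T"
  proof -
    have "mat2 a (b * \<gamma>1) (b * \<gamma>2) a = mat2 a (b / v * (v * \<gamma>1)) (b / v * (v * \<gamma>2)) a"
      "mat2 a (b * (v * \<gamma>1)) (b * (v * \<gamma>2)) a = mat2 a (b * v * \<gamma>1) (b * v * \<gamma>2) a" for a b
      using uv(3) by (simp_all add: mult.assoc)
    then show ?thesis
      unfolding torus_def T.T_def by blast
  qed
  have J: "Gfil S y (r/2) <#>\<^bsub>U S\<^esub> torus S \<gamma>1 \<gamma>2 = T.J"
    by (simp add: T.J_def Tor)
  have rep: "lin_rep sc ((U S)\<lparr>carrier := T.J\<rparr>) W \<rho>"
    and opn: "\<And>w. w \<in> W \<Longrightarrow> openin (subtopology (mat_top S) T.J) {h \<in> T.J. \<rho> h w = w}"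
    using smooth unfolding J smooth_rep_def by auto
  interpret V: vector_space sc
    using rep by (simp add: lin_rep_def)
  have Wsub: "V.subspace W"
    using rep by (simp add: lin_rep_def)
  have "\<phi> (mat 1 ** mat 1) = \<phi> (mat 1) * \<phi> (mat 1)" "\<phi> (mat 1) \<noteq> 0"
    using chr T.T_one unfolding smooth_char_def Tor by blast+
  then have \<phi>1: "\<phi> (mat 1) = 1"
    by simp
  have \<theta>: "\<theta> n = Psi S \<Gamma> n" if "n \<in> Gfil_plus S y (r/2)" for n
    using hat that T.T_one \<phi>1 unfolding is_phi_hat_def Tor by (metis matrix_mul_rid mult.right_neutral)
  have Gfilp: "n \<in> Gfil S y (r/2)" if n: "n \<in> Gfil_plus S y (r/2)" for n
    using n mat_lattice_mono by (auto simp: Gfil_plus_def Gfil_def)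
  \<comment> \<open>Both kinds of \<rho> are reduced to what the criterion asks: scalars on
    \<open>Gfil_plus\<close>, and irreducibility under the part of \<open>T.J\<close> that
    \<open>g\<close> conjugates into \<open>Kmax S\<close>.\<close>
  have rho: "W \<noteq> {0} \<and> (\<forall>n\<in>Gfil_plus S y (r/2). \<forall>w\<in>W. \<rho> n w = sc (Psi S \<Gamma> n) w) \<and>
    (\<forall>W'. V.subspace W' \<and> W' \<subseteq> W \<and>
        (\<forall>h\<in>T.J. g ** h ** iv g \<in> Kmax S \<longrightarrow> (\<forall>w\<in>W'. \<rho> h w \<in> W')) \<longrightarrow> W' = {0} \<or> W' = W)"
  proof (cases "Gfil S y (r/2) = Gfil_plus S y (r/2)")
    case True
    then have d: "V.dim W = 1" and sc: "\<And>x w. x \<in> T.J \<Longrightarrow> w \<in> W \<Longrightarrow> \<rho> x w = sc (\<theta> x) w"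
      using cases unfolding J by auto
    have "W \<noteq> {0}"
      by (rule dim_one_subspace(1)[OF _ Wsub d Wsub]) (auto intro: V.vector_space_axioms)
    moreover have "W' = {0} \<or> W' = W" if "V.subspace W'" "W' \<subseteq> W" for W'
      by (rule dim_one_subspace(2)[OF _ Wsub d that]) (rule V.vector_space_axioms)
    ultimately show ?thesis
      using sc \<theta> T.J_Gfil_plus by auto
  next
    case False
    obtain \<eta> A \<omega> where
      heis: "heisenberg_rep S \<gamma>1 \<gamma>2 y (r/2) \<theta> sc W \<eta>" and
      weil: "weil_rep S \<gamma>1 \<gamma>2 y (r/2) \<theta> sc W A \<omega>" and
      eq: "\<forall>g \<in> Gfil S y (r/2). \<forall>t \<in> torus S \<gamma>1 \<gamma>2. \<forall>w\<in>W.
        \<rho> (g ** t) w = sc (\<phi> t) (\<eta> g (\<omega> (conj_act S \<gamma>1 \<gamma>2 y (r/2) t) w))"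
      using cases unfolding if_not_P[OF False] by (elim exE conjE)
    have irr: "irreducible_rep S sc (Gfil S y (r/2)) W \<eta>"
      and Jp: "\<And>j w. j \<in> Jplus S \<gamma>1 \<gamma>2 y (r/2) \<Longrightarrow> w \<in> W \<Longrightarrow> \<eta> j w = sc (\<theta> j) w"
      using heis by (auto simp: heisenberg_rep_def)
    \<comment> \<open>Conjugation by the identity is the neutral element of the automorphism group,
      so \<omega> is trivial there and \<rho> restricts to \<eta> on
      \<open>Gfil S y (r/2)\<close>.\<close>
    have "conj_act S \<gamma>1 \<gamma>2 y (r/2) (mat 1) =
      \<one>\<^bsub>(AutoGroup (Vgrp S \<gamma>1 \<gamma>2 y (r/2)))\<lparr>carrier := SpV S \<gamma>1 \<gamma>2 y (r/2) \<theta>\<rparr>\<^esub>"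
      by (auto simp: conj_act_def conj_set_def AutoGroup_def BijGroup_def)
    then have "\<omega> (conj_act S \<gamma>1 \<gamma>2 y (r/2) (mat 1)) w = w" if "w \<in> W" for w
      using weil that unfolding weil_rep_def lin_rep_def by simp
    then have rho_eta: "\<rho> x w = \<eta> x w" if "x \<in> Gfil S y (r/2)" "w \<in> W" for x w
      using eq[rule_format, of x "mat 1" w] that T.T_one \<phi>1 by (simp add: Tor)
    have lin: "lin_rep sc ((U S)\<lparr>carrier := Gfil S y (r/2)\<rparr>) W \<eta>"
      using irr by (simp add: irreducible_rep_def smooth_rep_def)
    have T_Jp: "t \<in> Jplus S \<gamma>1 \<gamma>2 y (r/2)" if "t \<in> T.T" "t \<in> Gfil S y (r/2)" for t
    proof -
      have "mat 1 \<in> Gfil_plus S y (r/2)"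
        by (simp add: Gfil_plus_iff)
      moreover have "t = mat 1 ** t" by simp
      ultimately show ?thesis
        unfolding Jplus_def Tor set_mult_def U_simps using that by blast
    qed
    have G_Jp: "n \<in> Jplus S \<gamma>1 \<gamma>2 y (r/2)" if "n \<in> Gfil_plus S y (r/2)" for n
    proof -
      have "n = n ** mat 1" by simp
      then show ?thesis
        unfolding Jplus_def Tor set_mult_def U_simps using that T.T_one Gfil_one by blast
    qed
    have "W \<noteq> {0}"
      using irr by (simp add: irreducible_rep_def)
    moreover have "\<rho> n w = sc (Psi S \<Gamma> n) w" if "n \<in> Gfil_plus S y (r/2)" "w \<in> W" for n w
      using that rho_eta[OF Gfilp] Jp[OF G_Jp] \<theta> by simp
    moreover have "W' = {0} \<or> W' = W" if W': "V.subspace W'" "W' \<subseteq> W"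
      "\<forall>h\<in>T.J. g ** h ** iv g \<in> Kmax S \<longrightarrow> (\<forall>w\<in>W'. \<rho> h w \<in> W')" for W'
    proof -
      \<comment> \<open>The element \<open>iv t\<close> lies in \<open>Jplus\<close> and acts by a
        scalar, so \<open>\<eta> X\<close> is a multiple of \<open>\<rho> (X ** t)\<close>, which
        preserves \<open>W'\<close>. Irreducibility of \<eta> then applies.\<close>
      have "\<eta> X w \<in> W'" if X: "X \<in> Gfil S y (r/2)" and w: "w \<in> W'" for X w
      proof -
        obtain t where t: "t \<in> T.T" "t \<in> Gfil S y (r/2)" "g ** (X ** t) ** iv g \<in> Kmax S"
          by (rule T.torus_correction[OF assms(4) X])
        have Xt: "X ** t \<in> Gfil S y (r/2)"
          using X t r by (intro Gfil_mult) auto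
        have it: "iv t \<in> Gfil S y (r/2)" "iv t \<in> T.T"
          using t by (auto intro: Gfil_iv T.T_iv)
        have wW: "w \<in> W" using w W' by blast
        have "\<eta> (X ** t ** iv t) w = \<eta> (X ** t) (\<eta> (iv t) w)"
          using lin Xt it wW by (simp add: lin_rep_def)
        also have "\<eta> (iv t) w = sc (\<theta> (iv t)) w"
          using Jp[OF T_Jp] it wW by blast
        finally have "\<eta> X w = \<eta> (X ** t) (sc (\<theta> (iv t)) w)"
          using T.T_U[OF t(1)] by simp
        also have "\<dots> = \<rho> (X ** t) (sc (\<theta> (iv t)) w)"
          using rho_eta[OF Xt] wW V.subspace_scale[OF Wsub] by simp
        also have "\<dots> \<in> W'"
          using W'(3) T.Gfil_J[OF Xt] t(3) V.subspace_scale[OF W'(1) w] by blast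
        finally show ?thesis .
      qed
      then show ?thesis
        using irr W' unfolding irreducible_rep_def by blast
    qed
    ultimately show ?thesis
      by blast
  qed
  define H where "H = Kmax S \<inter> conj_set S g T.J"
  define \<sigma> where "\<sigma> = conj_rep S g \<rho>"
  note gU = assms(4)
  have H_iff: "x \<in> H \<longleftrightarrow> x \<in> Kmax S \<and> iv g ** x ** g \<in> T.J" for x
    using conj_set_iff[OF gU, of x T.J] by (auto simp: H_def)
  have conj_mult: "iv g ** (x ** z) ** g = (iv g ** x ** g) ** (iv g ** z ** g)" for x z
    using gU by (simp add: matrix_mul_assoc)
  have conj_iv: "iv g ** iv x ** g = iv (iv g ** x ** g)" if "x \<in> carrier (U S)" for x
    using gU that by (simp add: iv_mult matrix_mul_assoc)
  have one: "iv g ** mat 1 ** g = mat 1"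
    using gU by simp
  obtain N where N: "Kc N \<subseteq> H"
  proof -
    obtain n where n: "\<And>k. k \<in> Kc n \<Longrightarrow> iv g ** k ** g - mat 1 \<in> MP (max \<lceil>r/2\<rceil> (max \<lceil>r/2 - y\<rceil> \<lceil>r/2 + y\<rceil>))"
      using Kc_conj_small[OF gU] by blast
    have "k \<in> H" if k: "k \<in> Kc n" for k
    proof -
      have kK: "k \<in> Kmax S" using k by (rule Kc_Kmax)
      have "iv g ** k ** g - mat 1 \<in> mat_lattice S y (r/2)"
        using n[OF k] pE_mono unfolding MP_def mat_lattice_def
        by (smt (verit, del_insts) max.cobounded1 max.cobounded2 mem_Collect_eq)
      then have "iv g ** k ** g \<in> Gfil S y (r/2)"
        using kK gU by (simp add: Gfil_def)
      then show ?thesis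
        using kK T.Gfil_J by (simp add: H_iff)
    qed
    then show thesis using that by blast
  qed
  have \<sigma>: "\<sigma> x = \<rho> (iv g ** x ** g)" for x
    by (simp add: \<sigma>_def conj_rep_def)
  have "mackey_setting S H sc W \<sigma> N"
  proof unfold_locales
    show "H \<subseteq> Kmax S" "Kc N \<subseteq> H"
      using N by (auto simp: H_iff)
    show "x ** z \<in> H" if "x \<in> H" "z \<in> H" for x z
      using that T.J_mult by (simp add: H_iff conj_mult)
    show "iv x \<in> H" if "x \<in> H" for x
      using that T.J_iv by (simp add: H_iff conj_iv)
    show "lin_rep sc ((U S)\<lparr>carrier := H\<rparr>) W \<sigma>"
      using rep unfolding lin_rep_def by (simp add: H_iff \<sigma> conj_mult one gU)
    show "W \<noteq> {0}"
      using rho by blast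
  next
    fix w assume w: "w \<in> W"
    let ?A = "{h \<in> T.J. \<rho> h w = w}"
    have "mat 1 \<in> ?A"
      using rep w T.T_J[OF T.T_one] by (simp add: lin_rep_def)
    moreover have "\<forall>a\<in>?A. \<exists>n. \<forall>z\<in>T.J. z - a \<in> MP n \<longrightarrow> z \<in> ?A"
      using opn[OF w] by (subst (asm) openin_sub_iff) auto
    ultimately obtain m where "\<forall>z\<in>T.J. z - mat 1 \<in> MP m \<longrightarrow> z \<in> ?A"
      by blast
    then have m: "\<And>z. z \<in> T.J \<Longrightarrow> z - mat 1 \<in> MP m \<Longrightarrow> \<rho> z w = w"
      by blast
    obtain n where n: "\<And>k. k \<in> Kc n \<Longrightarrow> iv g ** k ** g - mat 1 \<in> MP m"
      using Kc_conj_small[OF gU] by blast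
    have "\<forall>h\<in>Kc n \<inter> H. \<sigma> h w = w"
      using m n by (auto simp: H_iff \<sigma>)
    then show "\<exists>n. \<forall>h\<in>Kc n \<inter> H. \<sigma> h w = w"
      by blast
  next
    fix W' assume W': "V.subspace W'" "W' \<subseteq> W" "\<And>h v. h \<in> H \<Longrightarrow> v \<in> W' \<Longrightarrow> \<sigma> h v \<in> W'"
    have "\<rho> h w \<in> W'" if "h \<in> T.J" "g ** h ** iv g \<in> Kmax S" "w \<in> W'" for h w
    proof -
      have e: "iv g ** (g ** h ** iv g) ** g = h"
        using gU by (simp add: matrix_mul_assoc)
      then have "g ** h ** iv g \<in> H"
        using that by (simp add: H_iff)
      from W'(3)[OF this that(3)] show ?thesis
        by (simp add: \<sigma> e)
    qed
    then show "W' = {0} \<or> W' = W"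
      using rho W'(1,2) by blast
  next
    fix x assume x: "x \<in> Kmax S" "x \<notin> H"
    define h where "h = iv g ** x ** g"
    have "iv g ** x ** g \<notin> T.J"
      using x by (simp add: H_iff)
    then obtain n where n: "n \<in> Gfil_plus S y (r/2)" "g ** n ** iv g \<in> Kmax S" "h ** n ** iv h \<in> Gfil_plus S y (r/2)"
      "psi S (trace (T.\<Gamma>0 ** n)) \<noteq> psi S (trace (T.\<Gamma>0 ** (h ** n ** iv h)))"
      unfolding h_def by (rule T.not_intertwining[OF gU x(1)])
    have hU: "h \<in> carrier (U S)"
      using gU x by (simp add: h_def)
    have "trace (h ** n ** iv h) = trace n"
      using trace_mul_sym[of "h ** n" "iv h"] hU by (simp add: matrix_mul_assoc)
    then have ne: "Psi S \<Gamma> n \<noteq> Psi S \<Gamma> (h ** n ** iv h)"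
      unfolding uv(4) using n(4) by (intro Psi_cong) (auto simp: T.\<Gamma>0_def)
    \<comment> \<open>The test element transported into \<open>H\<close>: there \<sigma> evaluates
      \<rho> at \<open>n\<close> and at its conjugate by \<open>h\<close>, where it acts by the two
      different scalars.\<close>
    define n' where "n' = g ** n ** iv g"
    have c1: "iv g ** n' ** g = n"
      using gU by (simp add: n'_def matrix_mul_assoc)
    have c2: "iv g ** (x ** n' ** iv x) ** g = h ** n ** iv h"
      using gU x by (simp add: n'_def h_def iv_mult matrix_mul_assoc)
    have n'K: "n' \<in> Kmax S" using n(2) by (simp add: n'_def)
    have "n' \<in> H"
      using n'K n(1) T.J_Gfil_plus by (simp add: H_iff c1)
    moreover have "x ** n' ** iv x \<in> H"
      unfolding H_iff c2 using n'K n(3) T.J_Gfil_plus x by simp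
    moreover have "\<forall>w\<in>W. \<sigma> n' w = sc (Psi S \<Gamma> n) w" 
      "\<forall>w\<in>W. \<sigma> (x ** n' ** iv x) w = sc (Psi S \<Gamma> (h ** n ** iv h)) w"
      unfolding \<sigma> c1 c2 using rho n by blast+
    ultimately show "\<exists>n\<in>H. x ** n ** iv x \<in> H \<and>
        (\<exists>c c'. c \<noteq> c' \<and> (\<forall>w\<in>W. \<sigma> n w = sc c w) \<and> (\<forall>w\<in>W. \<sigma> (x ** n ** iv x) w = sc c' w))"
      using ne by blast
  qed
  then interpret M: mackey_setting S H sc W \<sigma> N .
  show ?thesis
    using M.irreducible_cInd unfolding J H_def \<sigma>_def .
qed

end
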